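(* Let $\mu,\nu\in\mathbb{C}$, let $N\ge0$ be an integer, and define $R_N(z,\mu,\nu)$ by $$S_{\mu,\nu}(z)=z^{\mu-1}\sum_{n=0}^{N-1}(-1)^n\frac{a_n(-\mu,\nu)}{z^{2n}}+R_N(z,\mu,\nu).$$ If $0<\pm\arg z<\pi$, $\Re(\mu)-\Re(\nu)<2N+1$ and $2N-\frac32<\Re(\mu)$, then $$R_N(z,\mu,\nu)=2^{\mu}\frac{\Gamma\left(\frac{\mu+\nu+1}{2}\right)}{\Gamma\left(\frac{\nu-\mu+1}{2}\right)}\left(z^{\mu-2N-1}\int_0^{+\infty}\frac{t^{2N-\mu}J_\nu(t)}{1-(t/z)^2}\,dt+e^{\mp\frac{\pi}{2}i\nu}K_\nu\left(ze^{\mp\frac{\pi}{2}i}\right)\right),$$ with upper signs taken together and lower signs taken together.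
   Context: $S_{\mu,\nu}$ is the Lommel function: $S_{\mu,\nu}(z)=s_{\mu,\nu}(z)+2^{\mu-1}\Gamma\left(\frac{\mu-\nu+1}{2}\right)\Gamma\left(\frac{\mu+\nu+1}{2}\right)\left(\sin\left(\frac{(\mu-\nu)\pi}{2}\right)J_\nu(z)-\cos\left(\frac{(\mu-\nu)\pi}{2}\right)Y_\nu(z)\right)$, where $s_{\mu,\nu}(z)=\frac{z^{\mu+1}}{(\mu+1)^2-\nu^2}\,{}_1F_2\left(1;\frac{\mu-\nu+3}{2},\frac{\mu+\nu+3}{2};-\frac{z^2}{4}\right)$. $J_\nu,Y_\nu$ are Bessel functions, $K_\nu$ the modified Bessel function of the second kind. $a_n(\mu,\nu)=\prod_{k=1}^n\left((\mu+2k-1)^2-\nu^2\right)=2^{2n}\left(\frac{\mu-\nu+1}{2}\right)_n\left(\frac{\mu+\nu+1}{2}\right)_n$. Empty sums are zero; principal branches. *)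

theory Defs
  imports "HOL-Analysis.Analysis"
begin

text \<open>Bessel function of the first kind (principal branch), written with the
  reciprocal Gamma function so that it is also correct for negative integer orders.\<close>
definition besselJ :: "complex \<Rightarrow> complex \<Rightarrow> complex" where
  "besselJ \<nu> z = (z / 2) powr \<nu> *
     (\<Sum>k. (-1) ^ k * (z / 2) ^ (2 * k) * rGamma (of_nat k + \<nu> + 1) / fact k)"

definition besselI :: "complex \<Rightarrow> complex \<Rightarrow> complex" where
  "besselI \<nu> z = (z / 2) powr \<nu> *
     (\<Sum>k. (z / 2) ^ (2 * k) * rGamma (of_nat k + \<nu> + 1) / fact k)"

text \<open>Bessel function of the second kind: the usual formula, extended to integer
  orders by the limit in the order (for non-integer orders the limit equals the formula).\<close>
definition besselY :: "complex \<Rightarrow> complex \<Rightarrow> complex" where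
  "besselY \<nu> z = Lim (at \<nu>)
     (\<lambda>m. (besselJ m z * cos (m * of_real pi) - besselJ (-m) z) / sin (m * of_real pi))"

definition besselK :: "complex \<Rightarrow> complex \<Rightarrow> complex" where
  "besselK \<nu> z = Lim (at \<nu>)
     (\<lambda>m. of_real pi / 2 * (besselI (-m) z - besselI m z) / sin (m * of_real pi))"

text \<open>1F2(1; a, b; x) = sum_k x^k / ((a)_k (b)_k), since (1)_k = k!.\<close>
definition hyp1F2_one :: "complex \<Rightarrow> complex \<Rightarrow> complex \<Rightarrow> complex" where
  "hyp1F2_one a b x = (\<Sum>k. x ^ k / (pochhammer a k * pochhammer b k))"

definition lommel_s :: "complex \<Rightarrow> complex \<Rightarrow> complex \<Rightarrow> complex" where
  "lommel_s \<mu> \<nu> z = z powr (\<mu> + 1) / ((\<mu> + 1)^2 - \<nu>^2) *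
     hyp1F2_one ((\<mu> - \<nu> + 3) / 2) ((\<mu> + \<nu> + 3) / 2) (- (z^2) / 4)"

definition lommel_S_formula :: "complex \<Rightarrow> complex \<Rightarrow> complex \<Rightarrow> complex" where
  "lommel_S_formula \<mu> \<nu> z = lommel_s \<mu> \<nu> z
     + 2 powr (\<mu> - 1) * Gamma ((\<mu> - \<nu> + 1) / 2) * Gamma ((\<mu> + \<nu> + 1) / 2) *
       (sin ((\<mu> - \<nu>) * of_real pi / 2) * besselJ \<nu> z
        - cos ((\<mu> - \<nu>) * of_real pi / 2) * besselY \<nu> z)"

text \<open>Lommel function S: the formula above, extended by its limit in mu at the
  exceptional parameters where the formula has removable singularities.\<close>
definition lommel_S :: "complex \<Rightarrow> complex \<Rightarrow> complex \<Rightarrow> complex" where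
  "lommel_S \<mu> \<nu> z = Lim (at \<mu>) (\<lambda>m. lommel_S_formula m \<nu> z)"

definition lommel_a :: "nat \<Rightarrow> complex \<Rightarrow> complex \<Rightarrow> complex" where
  "lommel_a n \<mu> \<nu> = (\<Prod>k=1..n. (\<mu> + 2 * of_nat k - 1)^2 - \<nu>^2)"

end

theory Submission
  imports Defs "HOL-Complex_Analysis.Complex_Analysis" "HOL-Real_Asymp.Real_Asymp"
begin

text \<open>
  With \<open>phi b x = (\<Sum>k. (-x)^k / (k! \<Gamma>(b + k)))\<close> one has \<open>J\<^sub>\<nu>(z) = (z/2)\<^sup>\<nu> phi (\<nu> + 1) (z\<^sup>2/4)\<close>, and the substitution
  \<open>x = t\<^sup>2/4\<close> turns the remainder integral into the Stieltjes transform
  \<open>L a b w = \<integral> x powr (a - 1) * phi b x / (x + w)\<close> over \<open>x > 0\<close>, with \<open>a = (\<nu> - \<mu> + 1)/2 + N\<close>,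
  \<open>b = \<nu> + 1\<close> and \<open>w = -z\<^sup>2/4\<close>. The heart of the proof is that for \<open>a \<notin> \<int>\<close>
  \<open>L a b w = \<pi> / sin (\<pi> a) * (w powr (a - 1) * phi b (-w) - (\<Sum>k. w^k / (\<Gamma>(2 - a + k) \<Gamma>(b - a + 1 + k))))\<close>.
  Both sides satisfy the same two contiguity relations and the same differential equation in \<open>w\<close>; for
  \<open>0 < Re a < 1\<close> and large \<open>Re b\<close> they agree to leading order at \<open>w = 0\<close>, hence everywhere, and the
  contiguity relations together with continuity in \<open>a\<close> extend the identity to the full range of convergence.
  Raising \<open>a\<close> in unit steps produces the terms of the asymptotic sum. The Bessel function of the second
  kind cancels because \<open>\<pi>/2 (\<plusminus>\<i> J\<^sub>\<nu>(z) - Y\<^sub>\<nu>(z))\<close> is exactly the \<open>K\<^sub>\<nu>\<close> term, and a limit in \<open>\<mu>\<close> covers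
  the exceptional parameters.
\<close>

section \<open>Lebesgue integrals over the positive half-line\<close>

text \<open>The hypotheses of the theorem are the conditions for the transform to make sense:
  \<open>Re a > 0\<close> is integrability at the origin, \<open>2 * Re a < Re b + 3/2\<close> is
  absolute integrability at infinity, and \<open>0 < \<plusminus> arg z < pi\<close> says that
  \<open>w\<close> lies off the cut (-oo, 0]. The second rests on the decay
  \<open>phi b x = O(x powr (1/4 - Re b / 2))\<close>, which the alternating power series does not
  show; hence the energy estimate. The obstacle afterwards is that the relation raising
  \<open>a\<close> uses the Mellin integral of \<open>phi b\<close>, whose absolute convergence
  needs the stronger \<open>2 * Re a < Re b - 1/2\<close>. The identity is therefore proved for
  \<open>Re b \<ge> 2\<close>, where the Mellin integrals that occur converge, and each later step
  is arranged so that the Mellin condition at the shifted parameters coincides with the condition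
  wanted for the new pair. Values of \<open>a\<close> with integer real part are not reached by unit
  steps from the open strip and are recovered as limits. At integer \<open>a\<close> itself the
  closed form is singular; there only the integral is used, through its continuity in the
  exponent.\<close>

abbreviation halfline :: "real measure" where
  "halfline \<equiv> restrict_space lborel {0<..}"

lemma space_halfline: "space halfline = {0<..}"
  by (simp add: space_restrict_space)

lemma sigma_finite_halfline: "sigma_finite_measure halfline"
  by (rule sigma_finite_measure_restrict_space) (auto intro: sigma_finite_lborel)

interpretation halfline: pair_sigma_finite halfline halfline
  by (simp add: pair_sigma_finite_def sigma_finite_halfline)

lemma measurable_halfline_id: "(\<lambda>x::real. x) \<in> borel_measurable halfline"
  by (simp add: measurable_restrict_space1)

lemma measurable_halfline_continuous:
  fixes f :: "real \<Rightarrow> 'a::topological_space"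
  assumes "continuous_on {0<..} f"
  shows "f \<in> borel_measurable halfline"
  using borel_measurable_continuous_on_restrict[OF assms]
  by (simp cong: measurable_cong_sets add: sets_restrict_space)

lemma integrable_halfline_iff:
  fixes f :: "real \<Rightarrow> 'a::{banach, second_countable_topology}"
  shows "integrable halfline f \<longleftrightarrow> set_integrable lborel {0<..} f"
  by (simp add: set_integrable_def integrable_restrict_space)

lemma integral_halfline_eq:
  fixes f :: "real \<Rightarrow> 'a::{banach, second_countable_topology}"
  shows "integral\<^sup>L halfline f = (LINT x:{0<..}|lborel. f x)"
  by (simp add: set_lebesgue_integral_def integral_restrict_space)

text \<open>The theorem speaks of the Henstock-Kurzweil integral over \<open>{0<..}\<close>, while
  Fubini and dominated convergence are applied to Lebesgue integrals; this is the bridge between the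
  two.\<close>

lemma integral_halfline_HK:
  fixes f :: "real \<Rightarrow> 'a::euclidean_space"
  assumes "integrable halfline f"
  shows "integral\<^sup>L halfline f = integral {0<..} f" "f absolutely_integrable_on {0<..}"
  using assms
  by (auto simp: integrable_halfline_iff integral_halfline_eq set_borel_integral_eq_integral 
      absolutely_integrable_on_def integrable_completion set_integrable_def)

lemma integrable_halfline_absolutely:
  fixes f :: "real \<Rightarrow> 'a::euclidean_space"
  assumes "f absolutely_integrable_on {0<..}" "f \<in> borel_measurable halfline"
  shows "integrable halfline f"
proof -
  have "(\<lambda>x. indicator {0<..} x *\<^sub>R f x) \<in> borel_measurable lborel"
    using assms(2) by (subst (asm) borel_measurable_restrict_space_iff) auto
  then show ?thesis
    using assms(1) by (simp add: integrable_halfline_iff set_integrable_def integrable_completion)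
qed

text \<open>The change of variables yields absolute integrability, which controls measurability only
  with respect to the completed measure. Integrability for \<open>lborel\<close> needs Borel
  measurability, hence the separate hypothesis \<open>m\<close>.\<close>

lemma halfline_substitution:
  fixes f :: "real \<Rightarrow> 'a::euclidean_space" and g h :: "real \<Rightarrow> real"
  assumes f: "integrable halfline f"
    and m: "(\<lambda>x. \<bar>h x\<bar> *\<^sub>R f (g x)) \<in> borel_measurable halfline"
    and d: "\<And>x. x > 0 \<Longrightarrow> (g has_field_derivative h x) (at x)"
    and b: "bij_betw g {0<..} {0<..}"
  shows "integrable halfline (\<lambda>x. \<bar>h x\<bar> *\<^sub>R f (g x))"
    "(\<integral>x. \<bar>h x\<bar> *\<^sub>R f (g x) \<partial>halfline) = integral\<^sup>L halfline f"
proof -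
  have *: "(\<lambda>x. \<bar>h x\<bar> *\<^sub>R f (g x)) absolutely_integrable_on {0<..} \<and>
      integral {0<..} (\<lambda>x. \<bar>h x\<bar> *\<^sub>R f (g x)) = integral {0<..} f"
    using b integral_halfline_HK(2)[OF f]
    by (subst has_absolute_integral_change_of_variables_real)
      (auto intro: d has_field_derivative_at_within simp: bij_betw_def)
  show i: "integrable halfline (\<lambda>x. \<bar>h x\<bar> *\<^sub>R f (g x))"
    using * m by (auto intro: integrable_halfline_absolutely)
  show "(\<integral>x. \<bar>h x\<bar> *\<^sub>R f (g x) \<partial>halfline) = integral\<^sup>L halfline f"
    using * by (simp add: integral_halfline_HK i f)
qed

section \<open>Gamma integrals and power majorants on the half-line\<close>

lemma measurable_halfline_powr:
  "(\<lambda>x. complex_of_real x powr a) \<in> borel_measurable halfline"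
  by (intro measurable_halfline_continuous continuous_intros) auto

lemma norm_of_real_powr: "x > 0 \<Longrightarrow> norm (complex_of_real x powr a) = x powr Re a"
  by (simp add: norm_powr_real_powr)

lemma Gamma_integral_halfline:
  fixes a :: complex and p :: real
  assumes a: "Re a > 0" and p: "p > 0"
  shows "integrable halfline (\<lambda>x. of_real x powr (a - 1) * of_real (exp (- (p * x))))"
    "(\<integral>x. of_real x powr (a - 1) * of_real (exp (- (p * x))) \<partial>halfline)
       = Gamma a * of_real p powr (- a)"
proof -
  define f where "f = (\<lambda>x. complex_of_real x powr (a - 1) * of_real (exp (- x)))"
  have fm: "f \<in> borel_measurable halfline"
    unfolding f_def by (intro borel_measurable_times measurable_halfline_powr measurable_halfline_continuous continuous_intros)
  have eq: "f = (\<lambda>t. of_real t powr (a - 1) / of_real (exp t))"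
    by (auto simp: f_def exp_minus field_simps fun_eq_iff)
  have f: "integrable halfline f"
    using absolutely_integrable_Gamma_integral'[OF a] fm
    by (intro integrable_halfline_absolutely) (simp add: eq)
  have fi: "integral\<^sup>L halfline f = Gamma a"
    using Gamma_integral_complex'[OF a] by (simp add: integral_halfline_HK f eq[symmetric] integral_unique)
  have bij: "bij_betw (\<lambda>x. p * x) {0<..} {0<..}"
    using p by (intro bij_betwI[where g="\<lambda>x. x / p"]) auto
  have m: "(\<lambda>x. \<bar>p\<bar> *\<^sub>R f (p * x)) \<in> borel_measurable halfline"
    using p unfolding f_def
    by (intro measurable_halfline_continuous continuous_intros) auto
  have d: "((\<lambda>x. p * x) has_field_derivative p) (at x)" for x
    by (auto intro!: derivative_eq_intros)
  have e: "\<bar>p\<bar> *\<^sub>R f (p * x) = of_real p powr a * (of_real x powr (a - 1) * of_real (exp (- (p * x))))"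
    if "x \<in> {0<..}" for x
    using p that by (simp add: f_def scaleR_conv_of_real powr_times_real powr_diff)
  note s = halfline_substitution[OF f m d bij]
  have i2: "integrable halfline (\<lambda>x. of_real p powr a * (of_real x powr (a - 1) * of_real (exp (- (p * x)))))"
    using s(1) by (subst (asm) Bochner_Integration.integrable_cong[OF refl e]) (simp_all add: space_halfline)
  have "(\<integral>x. of_real p powr a * (of_real x powr (a - 1) * of_real (exp (- (p * x)))) \<partial>halfline)
      = (\<integral>x. \<bar>p\<bar> *\<^sub>R f (p * x) \<partial>halfline)"
    by (rule Bochner_Integration.integral_cong[OF refl]) (rule e[symmetric], simp add: space_halfline)
  also have "\<dots> = Gamma a"
    using s(2) fi by simp
  finally have "(\<integral>x. of_real p powr a * (of_real x powr (a - 1) * of_real (exp (- (p * x)))) \<partial>halfline) = Gamma a" .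
  then show "(\<integral>x. of_real x powr (a - 1) * of_real (exp (- (p * x))) \<partial>halfline)
       = Gamma a * of_real p powr (- a)"
    using p by (simp add: powr_minus field_simps)
  show "integrable halfline (\<lambda>x. of_real x powr (a - 1) * of_real (exp (- (p * x))))"
    using integrable_mult_right[OF i2, of "inverse (of_real p powr a)"] p
    by (simp only: mult.assoc[symmetric]) (simp add: mult.assoc del: integrable_mult_right_iff)
qed

lemma Gamma_integral_halfline_real:
  fixes r p :: real
  assumes "r > 0" "p > 0"
  shows "integrable halfline (\<lambda>x. x powr (r - 1) * exp (- (p * x)))"
    "(\<integral>x. x powr (r - 1) * exp (- (p * x)) \<partial>halfline) = Gamma r * p powr (- r)"
proof -
  have e: "Re (of_real x powr (of_real r - 1) * of_real (exp (- (p * x)))) = x powr (r - 1) * exp (- (p * x))"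
    if "x \<in> {0<..}" for x
    using that powr_of_real[of x "r - 1"] by simp
  note G = Gamma_integral_halfline[of "of_real r" p]
  have "integrable halfline (\<lambda>x. Re (of_real x powr (of_real r - 1) * of_real (exp (- (p * x)))))"
    using assms by (intro integrable_Re G(1)) auto
  then show i: "integrable halfline (\<lambda>x. x powr (r - 1) * exp (- (p * x)))"
    by (subst (asm) Bochner_Integration.integrable_cong[OF refl e]) (simp_all add: space_halfline)
  have "(\<integral>x. Re (of_real x powr (of_real r - 1) * of_real (exp (- (p * x)))) \<partial>halfline)
     = Re (Gamma (of_real r) * of_real p powr (- of_real r))"
    using G assms by (subst integral_Re) auto
  also have "\<dots> = Gamma r * p powr (- r)"
    using assms powr_of_real[of p "- r"] by (simp add: Gamma_complex_of_real)
  finally show "(\<integral>x. x powr (r - 1) * exp (- (p * x)) \<partial>halfline) = Gamma r * p powr (- r)"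
    by (subst (asm) Bochner_Integration.integral_cong[OF refl e]) (simp_all add: space_halfline)
qed

lemma integrable_halfline_powr_cases:
  fixes \<alpha> \<beta> :: real
  assumes "\<alpha> > -1" "\<beta> < -1"
  shows "integrable halfline (\<lambda>x. if x \<le> 1 then x powr \<alpha> else x powr \<beta>)"
proof (rule integrable_halfline_absolutely)
  have "((\<lambda>x. x powr \<alpha>) has_integral (1 powr (\<alpha>+1) / (\<alpha>+1))) {0..1}"
    using assms by (intro has_integral_powr_from_0) auto
  then have 1: "((\<lambda>x. if x \<le> 1 then x powr \<alpha> else x powr \<beta>) has_integral (1 powr (\<alpha>+1) / (\<alpha>+1))) {0..1}"
    by (rule has_integral_eq[rotated]) auto
  have "((\<lambda>x. x powr \<beta>) has_integral -(1 powr (\<beta>+1)) / (\<beta>+1)) {1..}"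
    using assms by (intro has_integral_powr_to_inf) auto
  then have 2: "((\<lambda>x. if x \<le> 1 then x powr \<alpha> else x powr \<beta>) has_integral -(1 powr (\<beta>+1)) / (\<beta>+1)) {1..}"
    by (rule has_integral_eq[rotated]) auto
  have "((\<lambda>x. if x \<le> 1 then x powr \<alpha> else x powr \<beta>) has_integral 
     (1 powr (\<alpha>+1) / (\<alpha>+1)) + -(1 powr (\<beta>+1)) / (\<beta>+1)) ({0..1} \<union> {1..})"
    by (rule has_integral_Un[OF 1 2]) (simp add: Int_atLeastAtMost)
  also have "{0..1} \<union> {1..} = {0::real..}" by auto
  finally have "(\<lambda>x. if x \<le> 1 then x powr \<alpha> else x powr \<beta>) integrable_on {0..}" by blast
  then have "(\<lambda>x. if x \<le> 1 then x powr \<alpha> else x powr \<beta>) integrable_on {0<..}"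
    by (rule integrable_spike_set) (auto intro: negligible_subset[of "{0::real}"])
  then show "(\<lambda>x. if x \<le> 1 then x powr \<alpha> else x powr \<beta>) absolutely_integrable_on {0<..}"
    by (subst absolutely_integrable_on_iff_nonneg) auto
  have [measurable]: "(\<lambda>x::real. x) \<in> borel_measurable halfline" by (rule measurable_halfline_id)
  show "(\<lambda>x. if x \<le> 1 then x powr \<alpha> else x powr \<beta>) \<in> borel_measurable halfline"
    by measurable
qed

lemma FTC_halfline:
  fixes F f :: "real \<Rightarrow> complex"
  assumes F: "\<And>x. x > 0 \<Longrightarrow> (F has_vector_derivative f x) (at x)"
    and f: "continuous_on {0<..} f" "integrable halfline f"
    and A: "(F \<longlongrightarrow> A) (at_right 0)" and B: "(F \<longlongrightarrow> B) at_top"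
  shows "integral\<^sup>L halfline f = B - A"
proof -
  have e: "einterval 0 \<infinity> = {0<..}" by (auto simp: einterval_def)
  have "(LBINT x=0..\<infinity>. f x) = B - A"
  proof (rule interval_integral_FTC_integrable)
    show "((F \<circ> real_of_ereal) \<longlongrightarrow> A) (at_right 0)"
      using A unfolding zero_ereal_def ereal_tendsto_simps .
    show "((F \<circ> real_of_ereal) \<longlongrightarrow> B) (at_left \<infinity>)"
      using B unfolding ereal_tendsto_simps .
    show "isCont f x" if "0 < ereal x" for x
      using f(1) that by (simp add: continuous_on_eq_continuous_at)
  qed (use F f(2) in \<open>auto simp: e integrable_halfline_iff\<close>)
  then show ?thesis
    by (simp add: interval_lebesgue_integral_def e integral_halfline_eq)
qed

section \<open>The entire function underlying the Bessel functions\<close>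

text \<open>As soon as \<open>norm (c + k) \<ge> (k + 1) / 2\<close>, one step of the functional
  equation of \<open>rGamma\<close> gains the factor \<open>1 / (k + 1)\<close> up to a loss of at
  most 2. Uniformity in \<open>c\<close> is what later gives holomorphy in the order and continuity
  in the exponent.\<close>

lemma rGamma_shift_bound:
  fixes c0 :: complex
  obtains C where "C > 0"
    "\<And>c k. c \<in> cball c0 1 \<Longrightarrow> norm (rGamma (c + of_nat k)) \<le> C * 2 ^ k / fact k"
proof -
  \<comment> \<open>For \<open>k \<ge> K\<close> this gives
    \<open>norm c \<le> norm c0 + 1 \<le> (k - 1) / 2\<close>, hence
    \<open>norm (c + k) \<ge> (k + 1) / 2\<close>. The finitely many smaller \<open>k\<close> are
    absorbed into \<open>C\<close> by compactness.\<close>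
  define K where "K = nat \<lceil>2 * (norm c0 + 1) + 1\<rceil>"
  have K: "real K \<ge> 2 * (norm c0 + 1) + 1" unfolding K_def by linarith
  have "\<exists>B. \<forall>c\<in>cball c0 1. norm (rGamma (c + of_nat k)) \<le> B" for k
  proof -
    have "continuous_on (cball c0 1) (\<lambda>c. rGamma (c + of_nat k))"
      by (intro continuous_on_compose2[OF continuous_on_rGamma[of UNIV]] continuous_intros) auto
    then have "bounded ((\<lambda>c. rGamma (c + of_nat k)) ` cball c0 1)"
      by (intro compact_imp_bounded compact_continuous_image) auto
    then show ?thesis by (auto simp: bounded_iff)
  qed
  then obtain B where B: "\<And>k c. c \<in> cball c0 1 \<Longrightarrow> norm (rGamma (c + of_nat k)) \<le> B k" by metis
  define C where "C = 1 + (\<Sum>k\<le>K. \<bar>B k\<bar> * fact k)"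
  have C: "C \<ge> 1" unfolding C_def by (intro add_increasing2 sum_nonneg) auto
  have *: "norm (rGamma (c + of_nat k)) * fact k \<le> C * 2 ^ k" if c: "c \<in> cball c0 1" for c k
  proof (cases "k \<le> K")
    case True
    have "norm (rGamma (c + of_nat k)) * fact k \<le> \<bar>B k\<bar> * fact k"
      using B[OF c, of k] by (intro mult_right_mono) auto
    also have "\<dots> \<le> (\<Sum>k\<le>K. \<bar>B k\<bar> * fact k)"
      using True by (intro member_le_sum) auto
    also have "\<dots> \<le> C" by (simp add: C_def)
    also have "\<dots> \<le> C * 2 ^ k" using C by simp
    finally show ?thesis .
  next
    case False
    then have "K \<le> k" by simp
    then show ?thesis
    proof (induction k rule: dec_induct)
      case base
      have "norm (rGamma (c + of_nat K)) * fact K \<le> \<bar>B K\<bar> * fact K"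
        using B[OF c, of K] by (intro mult_right_mono) auto
      also have "\<dots> \<le> (\<Sum>k\<le>K. \<bar>B k\<bar> * fact k)"
        by (intro member_le_sum) auto
      also have "\<dots> \<le> C" by (simp add: C_def)
      also have "\<dots> \<le> C * 2 ^ K" using C by simp
      finally show ?case .
    next
      case (step k)
      have nc: "norm c \<le> norm c0 + 1"
        using c norm_triangle_ineq3[of c c0] by (auto simp: dist_norm norm_minus_commute)
      have k: "real k + 1 \<le> 2 * norm (c + of_nat k)"
        using norm_diff_ineq[of "of_nat k" c] nc K step(1) by (simp add: add.commute)
      have "norm (rGamma (c + of_nat (Suc k))) * fact (Suc k) * norm (c + of_nat k)
          = (real k + 1) * (norm (rGamma (c + of_nat k)) * fact k)"
        using rGamma_plus1[of "c + of_nat k"]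
        by (simp add: norm_mult[symmetric] algebra_simps flip: norm_mult)
      also have "\<dots> \<le> (real k + 1) * (C * 2 ^ k)"
        by (intro mult_left_mono step) auto
      also have "\<dots> \<le> 2 * norm (c + of_nat k) * (C * 2 ^ k)"
        using k C by (intro mult_right_mono) auto
      finally have "norm (c + of_nat k) * (norm (rGamma (c + of_nat (Suc k))) * fact (Suc k)) 
          \<le> norm (c + of_nat k) * (C * 2 ^ Suc k)"
        by (simp add: algebra_simps)
      moreover have "norm (c + of_nat k) > 0" using k by linarith
      ultimately show ?case using mult_le_cancel_left_pos by blast
    qed
  qed
  show ?thesis
    using C * by (intro that[of C]) (simp_all add: pos_le_divide_eq)
qed

text \<open>This is 0F1(; b; -x) divided by Gamma(b), the Bessel-Clifford function of order
  \<open>b - 1\<close> at \<open>-x\<close>. The reciprocal Gamma function keeps it defined for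
  every \<open>b\<close>, non-positive integers included.\<close>

definition phi :: "complex \<Rightarrow> complex \<Rightarrow> complex" where
  "phi b x = (\<Sum>k. (-1) ^ k * rGamma (b + of_nat k) / fact k * x ^ k)"

lemma summable_exp_real: "summable (\<lambda>k. C * (y::real) ^ k / fact k)"
  using summable_exp_generic[of y, THEN summable_mult[of _ C]]
  by (simp add: divide_inverse scaleR_conv_of_real mult.assoc mult.commute mult.left_commute)

lemma summable_norm_phi:
  "summable (\<lambda>k. norm ((-1) ^ k * rGamma (b + of_nat k) / fact k * (x::complex) ^ k))"
proof -
  obtain C where C: "C > 0" "\<And>c k. c \<in> cball b 1 \<Longrightarrow> norm (rGamma (c + of_nat k)) \<le> C * 2 ^ k / fact k"
    using rGamma_shift_bound[of b] by metis
  show ?thesis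
  proof (rule summable_comparison_test'[OF summable_exp_real[of C "2 * norm x"]])
    fix k :: nat
    have "norm (rGamma (b + of_nat k)) \<le> C * 2 ^ k / fact k" using C(2)[of b k] by simp
    also have "\<dots> \<le> C * 2 ^ k / 1" using C(1) by (intro divide_left_mono) auto
    finally have "norm (rGamma (b + of_nat k)) * norm x ^ k \<le> C * 2 ^ k / 1 * norm x ^ k"
      by (intro mult_right_mono) auto
    then show "norm (norm ((-1) ^ k * rGamma (b + of_nat k) / fact k * x ^ k)) \<le> C * (2 * norm x) ^ k / fact k"
      by (simp add: norm_mult norm_divide norm_power power_mult_distrib divide_simps mult_ac)
  qed
qed

lemma summable_phi: "summable (\<lambda>k. (-1) ^ k * rGamma (b + of_nat k) / fact k * (x::complex) ^ k)"
  using summable_norm_phi by (rule summable_norm_cancel)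

lemma phi_0 [simp]: "phi b 0 = rGamma b"
  unfolding phi_def by (subst powser_zero) simp

lemma has_field_derivative_phi:
  "(phi b has_field_derivative - phi (b + 1) x) (at x)"
proof -
  have "((\<lambda>x. \<Sum>k. ((-1) ^ k * rGamma (b + of_nat k) / fact k) * x ^ k) has_field_derivative
    (\<Sum>k. diffs (\<lambda>k. (-1) ^ k * rGamma (b + of_nat k) / fact k) k * x ^ k)) (at x)"
    by (rule termdiffs_strong_converges_everywhere) (rule summable_phi)
  also have "(\<lambda>k. diffs (\<lambda>k. (-1) ^ k * rGamma (b + of_nat k) / fact k) k * x ^ k)
     = (\<lambda>k. - ((-1) ^ k * rGamma (b + 1 + of_nat k) / fact k * x ^ k))"
  proof
    fix k
    have "rGamma (b + of_nat (Suc k)) = rGamma (b + 1 + of_nat k)"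
      by (simp add: add_ac)
    then show "diffs (\<lambda>k. (-1) ^ k * rGamma (b + of_nat k) / fact k) k * x ^ k
        = - ((-1) ^ k * rGamma (b + 1 + of_nat k) / fact k * x ^ k)"
      by (simp add: diffs_def divide_simps del: of_nat_Suc)
  qed
  also have "(\<Sum>k. - ((-1) ^ k * rGamma (b + 1 + of_nat k) / fact k * x ^ k)) = - phi (b + 1) x"
    unfolding phi_def by (rule suminf_minus) (rule summable_phi)
  finally show ?thesis unfolding phi_def[abs_def] .
qed

lemma has_field_derivative_phi' [derivative_intros]:
  "(f has_field_derivative f') (at x within A) \<Longrightarrow>
   ((\<lambda>x. phi b (f x)) has_field_derivative - phi (b + 1) (f x) * f') (at x within A)"
  using DERIV_chain[OF has_field_derivative_phi, of f f' x A b] by (simp add: o_def)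

lemma continuous_on_phi [continuous_intros]:
  "continuous_on A f \<Longrightarrow> continuous_on A (\<lambda>x. phi b (f x))"
  by (rule continuous_on_compose2[of UNIV "phi b"])
    (auto intro: DERIV_isCont has_field_derivative_phi simp: continuous_on_eq_continuous_at)

text \<open>This is the three-term recurrence of the Bessel functions. As the derivative of
  \<open>phi b\<close> is \<open>- phi (b + 1)\<close>, it is at the same time the differential
  equation \<open>x f'' + b f' + f = 0\<close> for \<open>f = phi b\<close>.\<close>

lemma phi_recurrence: "phi b x = b * phi (b + 1) x - x * phi (b + 2) x"
proof -
  have 1: "(\<lambda>k. b * ((-1) ^ k * rGamma (b + 1 + of_nat k) / fact k * x ^ k)) sums (b * phi (b + 1) x)"
    unfolding phi_def by (intro sums_mult summable_sums summable_phi)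
  have "(\<lambda>k. x * ((-1) ^ k * rGamma (b + 2 + of_nat k) / fact k * x ^ k)) sums (x * phi (b + 2) x)"
    unfolding phi_def by (intro sums_mult summable_sums summable_phi)
  then have 2: "(\<lambda>k. case k of 0 \<Rightarrow> 0 | Suc k \<Rightarrow> x * ((-1) ^ k * rGamma (b + 2 + of_nat k) / fact k * x ^ k)) sums (x * phi (b + 2) x)"
    using sums_Suc[of "\<lambda>k. case k of 0 \<Rightarrow> 0 | Suc k \<Rightarrow> x * ((-1) ^ k * rGamma (b + 2 + of_nat k) / fact k * x ^ k)"] by simp
  have "(\<lambda>k. b * ((-1) ^ k * rGamma (b + 1 + of_nat k) / fact k * x ^ k) - (case k of 0 \<Rightarrow> 0 | Suc k \<Rightarrow> x * ((-1) ^ k * rGamma (b + 2 + of_nat k) / fact k * x ^ k)))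
    = (\<lambda>k. (-1) ^ k * rGamma (b + of_nat k) / fact k * x ^ k)"
  proof
    fix k show "b * ((-1) ^ k * rGamma (b + 1 + of_nat k) / fact k * x ^ k) - (case k of 0 \<Rightarrow> 0 | Suc k \<Rightarrow> x * ((-1) ^ k * rGamma (b + 2 + of_nat k) / fact k * x ^ k))
      = (-1) ^ k * rGamma (b + of_nat k) / fact k * x ^ k"
    proof (cases k)
      case 0 then show ?thesis using rGamma_plus1[of b] by simp
    next
      case (Suc j)
      have r: "rGamma (b + of_nat k) = (b + of_nat k) * rGamma (b + 2 + of_nat j)"
        using rGamma_plus1[of "b + of_nat k"] by (simp add: Suc add_ac numeral_2_eq_2)
      have r': "rGamma (b + 1 + of_nat k) = rGamma (b + 2 + of_nat j)"
        by (simp add: Suc add_ac numeral_2_eq_2)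
      have f: "(fact k :: complex) = of_nat k * fact j" by (simp add: Suc)
      have "of_nat k \<noteq> (0::complex)" by (simp add: Suc del: of_nat_Suc)
      then show ?thesis unfolding r r' f
        by (simp add: Suc divide_simps del: of_nat_Suc) (simp add: algebra_simps)
    qed
  qed
  with sums_diff[OF 1 2] show ?thesis
    unfolding phi_def[of b] by (simp add: sums_iff)
qed

text \<open>The energy of \<open>t powr (b - 1/2) * phi b (t\<^sup>2/4)\<close>, a solution of
  \<open>u'' = (-1 + O(t\<^sup>-\<^sup>2)) u\<close>, stays bounded.\<close>
lemma phi_bound_at_top:
  obtains C where "C > 0"
    "\<And>x. x \<ge> 1 \<Longrightarrow> norm (phi b (of_real x)) \<le> C * x powr (1/4 - Re b / 2)"
proof -
  \<comment> \<open>Liouville normal form: up to a constant \<open>U\<close> is the square root of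
    \<open>z\<close> times the Bessel function of order \<open>b - 1\<close>. This exponent removes
    the first-order term of the equation and leaves
    \<open>U'' = (-1 + \<kappa> / z^2) U\<close>.\<close>
  define \<alpha> where "\<alpha> = b - 1/2"
  define \<kappa> where "\<kappa> = \<alpha> * (\<alpha> - 1)"
  define U where "U = (\<lambda>z. z powr \<alpha> * phi b (z\<^sup>2/4))"
  define U1 where "U1 = (\<lambda>z. \<alpha> * z powr (\<alpha> - 1) * phi b (z\<^sup>2/4) - z powr (\<alpha> + 1) / 2 * phi (b + 1) (z\<^sup>2/4))"
  define u where "u = (\<lambda>t. U (complex_of_real t))"
  define u1 where "u1 = (\<lambda>t. U1 (complex_of_real t))"
  have dU: "(U has_field_derivative U1 z) (at z)" if "z \<notin> \<real>\<^sub>\<le>\<^sub>0" for z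
    unfolding U_def U1_def using that
    by (auto intro!: derivative_eq_intros simp: powr_add field_simps)
  have dU1: "(U1 has_field_derivative (- U z + \<kappa> / z\<^sup>2 * U z)) (at z)" if "z \<notin> \<real>\<^sub>\<le>\<^sub>0" for z
  proof -
    have z: "z \<noteq> 0" using that by auto
    have r: "z\<^sup>2 * phi (b + 2) (z\<^sup>2/4) = 4 * (b * phi (b + 1) (z\<^sup>2/4) - phi b (z\<^sup>2/4))"
      using phi_recurrence[of b "z\<^sup>2/4"] by (simp add: field_simps)
    have p: "z powr (\<alpha> - 1) = z powr \<alpha> / z" "z powr (\<alpha> + 1) = z powr \<alpha> * z"
      "z powr (\<alpha> - 1 - 1) = z powr \<alpha> / z\<^sup>2"
      using z by (simp_all add: powr_diff powr_add power2_eq_square)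
    have b: "b = \<alpha> + 1/2" by (simp add: \<alpha>_def)
    have "(U1 has_field_derivative 
      \<alpha> * ((\<alpha> - 1) * z powr (\<alpha> - 1 - 1)) * phi b (z\<^sup>2/4) - \<alpha> * z powr (\<alpha> - 1) * phi (b + 1) (z\<^sup>2/4) * (z / 2)
      - ((\<alpha> + 1) * z powr (\<alpha> + 1 - 1) / 2 * phi (b + 1) (z\<^sup>2/4) - z powr (\<alpha> + 1) / 2 * (phi (b + 1 + 1) (z\<^sup>2/4) * (z / 2)))) (at z)"
      unfolding U1_def using that
      by (auto intro!: derivative_eq_intros simp: add_divide_distrib diff_divide_distrib algebra_simps)
    also have "\<alpha> * ((\<alpha> - 1) * z powr (\<alpha> - 1 - 1)) * phi b (z\<^sup>2/4) - \<alpha> * z powr (\<alpha> - 1) * phi (b + 1) (z\<^sup>2/4) * (z / 2)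
      - ((\<alpha> + 1) * z powr (\<alpha> + 1 - 1) / 2 * phi (b + 1) (z\<^sup>2/4) - z powr (\<alpha> + 1) / 2 * (phi (b + 1 + 1) (z\<^sup>2/4) * (z / 2)))
      = z powr \<alpha> * (\<kappa> / z\<^sup>2 * phi b (z\<^sup>2/4) - (\<alpha> + 1/2) * phi (b + 1) (z\<^sup>2/4) + (z\<^sup>2 * phi (b + 2) (z\<^sup>2/4)) / 4)"
      unfolding p \<kappa>_def using z by (simp add: field_simps power2_eq_square)
    also have "\<dots> = - U z + \<kappa> / z\<^sup>2 * U z"
      unfolding r U_def b[symmetric] using z by (simp add: field_simps)
    finally show ?thesis .
  qed
  have du: "(u has_vector_derivative u1 t) (at t)" if "t > 0" for t
    unfolding u_def u1_def using that by (intro has_vector_derivative_real_field dU) auto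
  have du1: "(u1 has_vector_derivative (- u t + \<kappa> / (of_real t)\<^sup>2 * u t)) (at t)" if "t > 0" for t
    unfolding u_def u1_def using that by (intro has_vector_derivative_real_field dU1) auto
  define E where "E = (\<lambda>t. u t \<bullet> u t + u1 t \<bullet> u1 t)"
  have dE: "(E has_real_derivative 2 * (u1 t \<bullet> (\<kappa> / (of_real t)\<^sup>2 * u t))) (at t)" if "t > 0" for t
    unfolding E_def has_field_derivative_def
    apply (rule has_derivative_eq_rhs)
     apply (rule derivative_intros du[OF that, unfolded has_vector_derivative_def] du1[OF that, unfolded has_vector_derivative_def])+
    apply (auto simp: fun_eq_iff inner_add_right inner_add_left inner_commute algebra_simps)
    done
  \<comment> \<open>Gronwall's argument: \<open>E' \<le> (norm \<kappa> / t^2) E\<close>, and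
    \<open>exp (norm \<kappa> / t)\<close> is the integrating factor that makes the product
    non-increasing. The factor lies between 1 and \<open>exp (norm \<kappa>)\<close> for
    \<open>t \<ge> 1\<close>.\<close>
  have dg: "((\<lambda>t. E t * exp (norm \<kappa> / t)) has_real_derivative 
      (2 * (u1 t \<bullet> (\<kappa> / (of_real t)\<^sup>2 * u t)) - norm \<kappa> / t\<^sup>2 * E t) * exp (norm \<kappa> / t)) (at t)"
    if "t > 0" for t
    using that by (auto intro!: derivative_eq_intros dE simp: field_simps power2_eq_square)
  have neg: "(2 * (u1 t \<bullet> (\<kappa> / (of_real t)\<^sup>2 * u t)) - norm \<kappa> / t\<^sup>2 * E t) * exp (norm \<kappa> / t) \<le> 0" if "t > 0" for t
  proof -
    have "u1 t \<bullet> (\<kappa> / (of_real t)\<^sup>2 * u t) \<le> norm (u1 t) * norm (\<kappa> / (of_real t)\<^sup>2 * u t)"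
      by (rule norm_cauchy_schwarz)
    also have "\<dots> = norm \<kappa> / t\<^sup>2 * (norm (u1 t) * norm (u t))"
      using that by (simp add: norm_mult norm_divide norm_power)
    finally have *: "u1 t \<bullet> (\<kappa> / (of_real t)\<^sup>2 * u t) \<le> norm \<kappa> / t\<^sup>2 * (norm (u1 t) * norm (u t))" .
    from mult_left_mono[OF *, of 2]
    have "2 * (u1 t \<bullet> (\<kappa> / (of_real t)\<^sup>2 * u t)) \<le> norm \<kappa> / t\<^sup>2 * (2 * norm (u1 t) * norm (u t))"
      by (simp add: algebra_simps)
    also have "\<dots> \<le> norm \<kappa> / t\<^sup>2 * E t"
      using sum_squares_bound[of "norm (u1 t)" "norm (u t)"]
      by (intro mult_left_mono) (auto simp: E_def power2_norm_eq_inner add.commute)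
    finally show ?thesis by (simp add: mult_nonpos_nonneg)
  qed
  define B where "B = E 1 * exp (norm \<kappa> / 1)"
  have E: "E t \<le> B" if "t \<ge> 1" for t
  proof -
    have "E t * 1 \<le> E t * exp (norm \<kappa> / t)"
      using that by (intro mult_left_mono) (auto simp: E_def)
    also have "\<dots> \<le> B" unfolding B_def
      using that by (intro DERIV_nonpos_imp_nonincreasing[OF that]) (auto intro!: exI dg neg)
    finally show ?thesis by simp
  qed
  define C where "C = (sqrt B + 1) * 2 powr (- Re \<alpha>)"
  have B0: "B \<ge> 0" by (auto simp: B_def E_def)
  show ?thesis
  proof (rule that[of C])
    show "C > 0" using B0 by (simp add: C_def add_nonneg_pos)
    fix x :: real assume x: "x \<ge> 1"
    define t where "t = 2 * sqrt x"
    have t: "t \<ge> 1" using x real_sqrt_ge_1_iff[of x] unfolding t_def by linarith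
    have tx: "t\<^sup>2 / 4 = x" using x by (simp add: t_def power_mult_distrib)
    have tp: "t powr r = 2 powr r * x powr (r / 2)" for r
      using x by (simp add: t_def powr_mult powr_half_sqrt[symmetric] powr_powr)
    have "(norm (u t))\<^sup>2 \<le> E t" by (simp add: E_def power2_norm_eq_inner)
    also have "\<dots> \<le> B" by (rule E[OF t])
    finally have "norm (u t) \<le> sqrt B" by (rule real_le_rsqrt)
    moreover have "norm (u t) = t powr Re \<alpha> * norm (phi b (of_real x))"
      using t by (simp add: u_def U_def norm_mult norm_of_real_powr flip: tx)
    ultimately have "t powr Re \<alpha> * norm (phi b (of_real x)) \<le> sqrt B + 1" by simp
    then have "t powr (- Re \<alpha>) * (t powr Re \<alpha> * norm (phi b (of_real x))) \<le> t powr (- Re \<alpha>) * (sqrt B + 1)"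
      by (intro mult_left_mono) auto
    then have "norm (phi b (of_real x)) \<le> t powr (- Re \<alpha>) * (sqrt B + 1)"
      using t by (simp add: powr_minus mult.assoc[symmetric])
    also have "\<dots> = C * x powr (1/4 - Re b / 2)"
      unfolding tp C_def by (simp add: \<alpha>_def diff_divide_distrib)
    finally show "norm (phi b (of_real x)) \<le> C * x powr (1/4 - Re b / 2)" .
  qed
qed

section \<open>The Mellin transform\<close>

lemma Re_pos_not_nonpos_Ints: "Re z > 0 \<Longrightarrow> z \<notin> \<int>\<^sub>\<le>\<^sub>0"
  by (auto elim!: nonpos_Ints_cases)

lemma phi_bound:
  obtains C where "C > 0"
    "\<And>x. x > 0 \<Longrightarrow> norm (phi b (of_real x)) \<le> C * (if x \<le> 1 then 1 else x powr (1/4 - Re b / 2))"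
proof -
  obtain C1 where C1: "C1 > 0" "\<And>x. x \<ge> 1 \<Longrightarrow> norm (phi b (of_real x)) \<le> C1 * x powr (1/4 - Re b / 2)"
    using phi_bound_at_top[of b] by metis
  have "bounded ((\<lambda>x. phi b (of_real x)) ` {0..1})"
    by (intro compact_imp_bounded compact_continuous_image continuous_intros) auto
  then obtain C2 where C2: "\<And>x. x \<in> {0..1} \<Longrightarrow> norm (phi b (of_real x)) \<le> C2"
    unfolding bounded_iff by blast
  show ?thesis
  proof (rule that[of "C1 + \<bar>C2\<bar>"])
    fix x :: real assume x: "x > 0"
    show "norm (phi b (of_real x)) \<le> (C1 + \<bar>C2\<bar>) * (if x \<le> 1 then 1 else x powr (1/4 - Re b / 2))"
    proof (cases "x \<le> 1")
      case True
      then show ?thesis using C2[of x] x C1(1) by simp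
    next
      case False
      then have "norm (phi b (of_real x)) \<le> C1 * x powr (1/4 - Re b / 2)" using C1 by simp
      also have "\<dots> \<le> (C1 + \<bar>C2\<bar>) * x powr (1/4 - Re b / 2)" by (intro mult_right_mono) auto
      finally show ?thesis using False by simp
    qed
  qed (use C1 in auto)
qed

lemma measurable_halfline_phi: "(\<lambda>x. phi b (of_real x)) \<in> borel_measurable halfline"
  by (intro measurable_halfline_continuous continuous_intros)

text \<open>One criterion for two integrals: \<open>\<delta> = 0\<close> gives the Mellin transform,
  \<open>\<delta> = 1\<close> the Stieltjes kernel. Near 0 only \<open>Re a > 0\<close> matters; at
  infinity the decay of \<open>phi b\<close> turns the last hypothesis into an exponent below
  \<open>-1\<close>.\<close>

lemma integrable_powr_phi:
  fixes g :: "real \<Rightarrow> complex"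
  assumes a: "Re a > 0" and g: "g \<in> borel_measurable halfline"
    and bd: "\<And>x. x > 0 \<Longrightarrow> norm (g x) \<le> K * (1 + x) powr (- \<delta>)" and \<delta>: "\<delta> \<ge> 0"
    and b: "2 * Re a < Re b - 1/2 + 2 * \<delta>"
  shows "integrable halfline (\<lambda>x. of_real x powr (a - 1) * phi b (of_real x) * g x)"
proof -
  obtain C where C: "C > 0"
    "\<And>x. x > 0 \<Longrightarrow> norm (phi b (of_real x)) \<le> C * (if x \<le> 1 then 1 else x powr (1/4 - Re b / 2))"
    using phi_bound[of b] by metis
  have K: "K \<ge> 0"
  proof -
    have "0 \<le> K * 2 powr (- \<delta>)" using bd[of 1] norm_ge_zero[of "g 1"] by (simp del: norm_ge_zero)
    then show ?thesis by (simp add: zero_le_mult_iff)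
  qed
  define h where "h = (\<lambda>x. C * K * (if x \<le> 1 then x powr (Re a - 1) else x powr (Re a - 3/4 - Re b / 2 - \<delta>)))"
  show ?thesis
  proof (rule Bochner_Integration.integrable_bound)
    have "Re a - 1 > -1" using a by simp
    moreover have "Re a - 3/4 - Re b / 2 - \<delta> < -1" using b by linarith
    ultimately show "integrable halfline h" unfolding h_def
      by (intro integrable_mult_right integrable_halfline_powr_cases)
    show "(\<lambda>x. of_real x powr (a - 1) * phi b (of_real x) * g x) \<in> borel_measurable halfline"
      by (intro borel_measurable_times measurable_halfline_powr measurable_halfline_phi g)
    have "norm (of_real x powr (a - 1) * phi b (of_real x) * g x) \<le> norm (h x)" if x: "x > 0" for x
    proof (cases "x \<le> 1")
      case True
      have "(1 + x) powr (- \<delta>) \<le> 1" using powr_mono2'[of "- \<delta>" 1 "1 + x"] x \<delta> by simp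
      then have "norm (g x) \<le> K * 1" using bd[OF x] K by (meson mult_left_mono order_trans)
      then have "norm (of_real x powr (a - 1) * phi b (of_real x) * g x) \<le> x powr (Re a - 1) * (C * 1) * (K * 1)"
        using C(2)[OF x] True x C K unfolding norm_mult
        by (intro mult_mono) (auto simp: norm_of_real_powr)
      then show ?thesis using True C K by (simp add: h_def mult_ac)
    next
      case False
      have "(1 + x) powr (- \<delta>) \<le> x powr (- \<delta>)" using x \<delta> by (intro powr_mono2') auto
      then have "norm (g x) \<le> K * x powr (- \<delta>)" using bd[OF x] K by (meson mult_left_mono order_trans)
      then have "norm (of_real x powr (a - 1) * phi b (of_real x) * g x) \<le> x powr (Re a - 1) * (C * x powr (1/4 - Re b / 2)) * (K * x powr (- \<delta>))"
        using C(2)[OF x] False x C K unfolding norm_mult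
        by (intro mult_mono) (auto simp: norm_of_real_powr)
      also have "\<dots> = C * K * (x powr (Re a - 1) * x powr (1/4 - Re b / 2) * x powr (- \<delta>))"
        by simp
      also have "x powr (Re a - 1) * x powr (1/4 - Re b / 2) * x powr (- \<delta>) = x powr (Re a - 3/4 - Re b / 2 - \<delta>)"
        by (simp add: powr_add[symmetric] algebra_simps)
      finally show ?thesis using False C K by (simp add: h_def)
    qed
    then show "AE x in halfline. norm (of_real x powr (a - 1) * phi b (of_real x) * g x) \<le> norm (h x)"
      by (intro AE_I2) (auto simp: space_halfline)
  qed
qed

lemma integrable_powr_phi_0:
  assumes "Re a > 0" "2 * Re a < Re b - 1/2"
  shows "integrable halfline (\<lambda>x. of_real x powr (a - 1) * phi b (of_real x))"
  using integrable_powr_phi[of a "\<lambda>_. 1" 1 0 b] assms by simp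

lemma pos_not_nonpos_Ints: "(r::real) > 0 \<Longrightarrow> r \<notin> \<int>\<^sub>\<le>\<^sub>0"
  by (auto elim!: nonpos_Ints_cases)

text \<open>Because \<open>norm (b + k) \<ge> Re b + k\<close>, the left side is non-increasing in
  \<open>k\<close>. It measures the loss when absolute values are taken inside the termwise
  integrals of the Laplace transform.\<close>

lemma norm_rGamma_Gamma_shift_bound:
  assumes "Re b > 0"
  shows "norm (rGamma (b + of_nat k)) * Gamma (Re b + real k) \<le> norm (rGamma b) * Gamma (Re b)"
proof (induction k)
  case (Suc k)
  have "norm (b + of_nat k) \<ge> Re b + real k" using complex_Re_le_cmod[of "b + of_nat k"] by simp
  moreover have pos: "Re b + real k > 0" using assms by simp
  ultimately have n: "norm (b + of_nat k) > 0" "(Re b + real k) / norm (b + of_nat k) \<le> 1" by (auto simp: divide_simps)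
  have 1: "rGamma (b + of_nat (Suc k)) = rGamma (b + of_nat k) / (b + of_nat k)"
    using rGamma_plus1[of "b + of_nat k"] n by (simp add: field_simps)
  have 2: "Gamma (Re b + real (Suc k)) = (Re b + real k) * Gamma (Re b + real k)"
    using Gamma_plus1[OF pos_not_nonpos_Ints[OF pos]] by (simp add: add_ac)
  have "norm (rGamma (b + of_nat (Suc k))) * Gamma (Re b + real (Suc k))
     = (norm (rGamma (b + of_nat k)) * Gamma (Re b + real k)) * ((Re b + real k) / norm (b + of_nat k))"
    unfolding 1 2 by (simp add: norm_divide)
  also have "\<dots> \<le> (norm (rGamma b) * Gamma (Re b)) * 1"
    by (rule mult_mono[OF Suc n(2)])
      (use n pos assms in \<open>auto intro!: mult_nonneg_nonneg Gamma_real_nonneg\<close>)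
  finally show ?case by simp
qed simp

text \<open>Integrating the power series term by term, each \<open>Gamma (b + k)\<close> cancels the
  coefficient \<open>rGamma (b + k)\<close>, and the exponential series in \<open>- 1 / p\<close>
  remains. The integrals of the absolute values are dominated by the series of
  \<open>exp (1 / p)\<close>.\<close>

lemma Laplace_phi:
  assumes b: "Re b > 0" and p: "p > 0"
  shows "(\<integral>x. of_real x powr (b - 1) * phi b (of_real x) * of_real (exp (- (p * x))) \<partial>halfline)
    = of_real p powr (- b) * of_real (exp (- (1 / p)))"
proof -
  define f where "f = (\<lambda>k x. (-1) ^ k * rGamma (b + of_nat k) / fact k *
     (complex_of_real x powr (b + of_nat k - 1) * of_real (exp (- (p * x)))))"
  have bk: "Re (b + of_nat k) > 0" for k using b by simp
  have fi: "integrable halfline (f k)" for k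
    unfolding f_def using Gamma_integral_halfline[OF bk p] by (intro integrable_mult_right) auto
  have G: "Gamma (b + of_nat k) * rGamma (b + of_nat k) = 1" for k
  proof -
    have "b + of_nat k \<notin> \<int>\<^sub>\<le>\<^sub>0" by (rule Re_pos_not_nonpos_Ints[OF bk])
    then show ?thesis by (simp add: rGamma_inverse_Gamma Gamma_eq_zero_iff)
  qed
  have If: "integral\<^sup>L halfline (f k) = of_real p powr (- b) * ((- 1 / of_real p) ^ k / fact k)" for k
  proof -
    have "integral\<^sup>L halfline (f k) = (-1) ^ k * rGamma (b + of_nat k) / fact k * (Gamma (b + of_nat k) * of_real p powr (- (b + of_nat k)))"
      unfolding f_def using Gamma_integral_halfline[OF bk p] by simp
    also have "\<dots> = (Gamma (b + of_nat k) * rGamma (b + of_nat k)) * (of_real p powr (- b) * ((- 1 / of_real p) ^ k / fact k))"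
    proof -
      have "complex_of_real p powr (- (b + of_nat k)) = of_real p powr (- b) * of_real p powr (- of_nat k)"
        by (simp add: powr_add[symmetric])
      also have "complex_of_real p powr (- of_nat k) = 1 / of_real p ^ k"
        using p by (simp add: powr_minus powr_nat' divide_inverse)
      finally show ?thesis by (simp add: power_minus' power_divide power_one_over field_simps)
    qed
    finally show ?thesis using G by simp
  qed
  have fx: "f k x = of_real x powr (b - 1) * of_real (exp (- (p * x))) * ((-1) ^ k * rGamma (b + of_nat k) / fact k * of_real x ^ k)"
    if "x > 0" for k x
  proof -
    have "complex_of_real x powr (b + of_nat k - 1) = of_real x powr (b - 1) * of_real x ^ k"
      using that powr_add[of "complex_of_real x" "b - 1" "of_nat k"] by (simp add: powr_nat' algebra_simps)
    then show ?thesis by (simp add: f_def)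
  qed
  have "(\<lambda>k. integral\<^sup>L halfline (f k)) sums (\<integral>x. (\<Sum>k. f k x) \<partial>halfline)"
  proof (rule sums_integral[OF fi])
    show "AE x in halfline. summable (\<lambda>k. norm (f k x))"
    proof (intro AE_I2)
      fix x assume "x \<in> space halfline"
      then have x: "x > 0" by (simp add: space_halfline)
      show "summable (\<lambda>k. norm (f k x))"
        unfolding fx[OF x] norm_mult[of "of_real x powr (b - 1) * of_real (exp (- (p * x)))"]
        by (intro summable_mult summable_norm_phi)
    qed
    have nI: "(\<integral>x. norm (f k x) \<partial>halfline) = norm (rGamma (b + of_nat k)) / fact k * (Gamma (Re b + real k) * p powr (- (Re b + real k)))" for k
    proof -
      have "(\<integral>x. norm (f k x) \<partial>halfline) = (\<integral>x. norm (rGamma (b + of_nat k)) / fact k * (x powr (Re b + real k - 1) * exp (- (p * x))) \<partial>halfline)"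
        by (intro Bochner_Integration.integral_cong refl)
          (simp add: f_def space_halfline norm_mult norm_divide norm_power norm_of_real_powr)
      then show ?thesis using Gamma_integral_halfline_real[of "Re b + real k" p] bk[of k] p by simp
    qed
    show "summable (\<lambda>k. \<integral>x. norm (f k x) \<partial>halfline)"
    proof (rule summable_comparison_test'[OF summable_exp_real[of "norm (rGamma b) * Gamma (Re b) * p powr (- Re b)" "1 / p"]])
      fix k :: nat
      have "norm (\<integral>x. norm (f k x) \<partial>halfline) = norm (rGamma (b + of_nat k)) * Gamma (Re b + real k) * (p powr (- Re b) * (1 / p) ^ k / fact k)"
        unfolding nI using bk[of k] b p Gamma_real_nonneg[of "Re b + real k"]
        by (simp add: powr_diff powr_realpow power_divide field_simps abs_mult)
      also have "\<dots> \<le> norm (rGamma b) * Gamma (Re b) * (p powr (- Re b) * (1 / p) ^ k / fact k)"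
        using p by (intro mult_right_mono norm_rGamma_Gamma_shift_bound b) auto
      finally show "norm (\<integral>x. norm (f k x) \<partial>halfline) \<le> norm (rGamma b) * Gamma (Re b) * p powr (- Re b) * (1 / p) ^ k / fact k"
        by simp
    qed
  qed
  moreover have "(\<integral>x. (\<Sum>k. f k x) \<partial>halfline) = (\<integral>x. of_real x powr (b - 1) * phi b (of_real x) * of_real (exp (- (p * x))) \<partial>halfline)"
  proof (intro Bochner_Integration.integral_cong refl)
    fix x assume "x \<in> space halfline"
    then have x: "x > 0" by (simp add: space_halfline)
    show "(\<Sum>k. f k x) = of_real x powr (b - 1) * phi b (of_real x) * of_real (exp (- (p * x)))"
      unfolding fx[OF x] phi_def by (subst suminf_mult[OF summable_phi]) (simp add: mult_ac)
  qed
  moreover have "(\<lambda>k. integral\<^sup>L halfline (f k)) sums (of_real p powr (- b) * exp (- 1 / of_real p))"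
    unfolding If using exp_converges[of "- 1 / complex_of_real p"]
    by (intro sums_mult) (simp add: scaleR_conv_of_real divide_inverse mult.commute)
  ultimately show ?thesis using sums_unique2 by (fastforce simp: exp_of_real[symmetric])
qed

lemma Gamma_integral_halfline_inverse:
  assumes a: "Re a > 0"
  shows "(\<integral>p. of_real p powr (- a - 1) * of_real (exp (- (1 / p))) \<partial>halfline) = Gamma a"
proof -
  define f where "f = (\<lambda>x. complex_of_real x powr (a - 1) * of_real (exp (- x)))"
  have f: "integrable halfline f" "integral\<^sup>L halfline f = Gamma a"
    using Gamma_integral_halfline[OF a, of 1] by (auto simp: f_def)
  have m: "(\<lambda>x. \<bar>- inverse (x\<^sup>2)\<bar> *\<^sub>R f (inverse x)) \<in> borel_measurable halfline"
    unfolding f_def by (intro measurable_halfline_continuous continuous_intros) auto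
  have d: "(inverse has_field_derivative - inverse (x\<^sup>2)) (at x)" if "x > 0" for x :: real
    using that by (auto intro!: derivative_eq_intros simp: power2_eq_square)
  have "bij_betw inverse {0<..} {0::real<..}"
    by (rule bij_betwI[where g=inverse]) auto
  note s = halfline_substitution(2)[OF f(1) m d this]
  have "\<bar>- inverse (p\<^sup>2)\<bar> *\<^sub>R f (inverse p) = of_real p powr (- a - 1) * of_real (exp (- (1 / p)))" if "p > 0" for p
  proof -
    have "complex_of_real (inverse p) powr (a - 1) = of_real p powr (1 - a)"
      using that powr_of_real by (simp add: powr_def Ln_inverse algebra_simps)
    moreover have "complex_of_real p powr (1 - a) = of_real p powr (- a - 1) * (of_real p)\<^sup>2"
      using that powr_add[of "of_real p" "- a - 1" 2] by (simp add: powr_nat')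
    ultimately show ?thesis
      using that by (simp add: f_def scaleR_conv_of_real divide_inverse mult_ac)
  qed
  then have "(\<integral>p. of_real p powr (- a - 1) * of_real (exp (- (1 / p))) \<partial>halfline) = (\<integral>x. \<bar>- inverse (x\<^sup>2)\<bar> *\<^sub>R f (inverse x) \<partial>halfline)"
    by (intro Bochner_Integration.integral_cong refl) (simp add: space_halfline)
  then show ?thesis using s f(2) by simp
qed

text \<open>Writing \<open>x powr (a - b)\<close> as a Laplace integral reduces the Mellin transform of \<open>phi b\<close> to
  the Laplace transform of \<open>x powr (b - 1) * phi b x\<close>.\<close>
lemma Mellin_phi:
  assumes a: "Re a > 0" and b: "2 * Re a < Re b - 1/2"
  shows "(\<integral>x. of_real x powr (a - 1) * phi b (of_real x) \<partial>halfline) = Gamma a * rGamma (b - a)"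
proof -
  define c where "c = b - a"
  have c: "Re c > 0" and b0: "Re b > 0" using a b by (auto simp: c_def)
  define f where "f = (\<lambda>x p. of_real x powr (b - 1) * phi b (of_real x) * (of_real p powr (c - 1) * of_real (exp (- (p * x)))))"
  have powr: "complex_of_real x powr (b - 1) * of_real x powr (- c) = of_real x powr (a - 1)" if "x > 0" for x
    using that by (simp add: c_def powr_add[symmetric])
  have i1: "(\<integral>p. f x p \<partial>halfline) = Gamma c * (of_real x powr (a - 1) * phi b (of_real x))" if "x > 0" for x
  proof -
    have "(\<integral>p. f x p \<partial>halfline) = of_real x powr (b - 1) * phi b (of_real x) * (\<integral>p. of_real p powr (c - 1) * of_real (exp (- (x * p))) \<partial>halfline)"
      unfolding f_def by (subst integral_mult_right_zero[symmetric]) (simp add: mult_ac)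
    then show ?thesis
      using Gamma_integral_halfline(2)[OF c that] powr[OF that, symmetric] by simp
  qed
  have i2: "(\<integral>x. f x p \<partial>halfline) = of_real p powr (- a - 1) * of_real (exp (- (1 / p)))" if "p > 0" for p
  proof -
    have "(\<integral>x. f x p \<partial>halfline) = of_real p powr (c - 1) * (\<integral>x. of_real x powr (b - 1) * phi b (of_real x) * of_real (exp (- (p * x))) \<partial>halfline)"
      unfolding f_def by (subst integral_mult_right_zero[symmetric]) (simp add: mult_ac)
    also have "\<dots> = of_real p powr (c - 1) * of_real p powr (- b) * of_real (exp (- (1 / p)))"
      using Laplace_phi[OF b0 that] by simp
    also have "complex_of_real p powr (c - 1) * of_real p powr (- b) = of_real p powr (- a - 1)"
      using that by (simp add: c_def powr_add[symmetric])
    finally show ?thesis .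
  qed
  have int: "integrable (halfline \<Otimes>\<^sub>M halfline) (case_prod f)"
  proof (rule halfline.Fubini_integrable)
    have [measurable]: "(\<lambda>x. complex_of_real x powr e) \<in> borel_measurable halfline" 
      "(\<lambda>x. phi b (of_real x)) \<in> borel_measurable halfline" "(\<lambda>x::real. x) \<in> borel_measurable halfline" for e
      by (rule measurable_halfline_powr measurable_halfline_phi measurable_halfline_id)+
    show "case_prod f \<in> borel_measurable (halfline \<Otimes>\<^sub>M halfline)"
      unfolding f_def by measurable
    \<comment> \<open>Integrating the modulus over \<open>p\<close> first returns the modulus of the
      Mellin integrand up to a constant, so the hypothesis of Fubini's theorem reduces to absolute
      convergence of the Mellin integral.\<close>
    have ni: "(\<integral>p. norm (f x p) \<partial>halfline) = Gamma (Re c) * norm (of_real x powr (a - 1) * phi b (of_real x))" if x: "x > 0" for x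
    proof -
      have "(\<integral>p. norm (f x p) \<partial>halfline) = (\<integral>p. x powr (Re b - 1) * norm (phi b (of_real x)) * (p powr (Re c - 1) * exp (- (x * p))) \<partial>halfline)"
        using x by (intro Bochner_Integration.integral_cong refl)
          (simp add: f_def space_halfline norm_mult norm_of_real_powr mult.commute)
      also have "\<dots> = x powr (Re b - 1) * norm (phi b (of_real x)) * (Gamma (Re c) * x powr (- Re c))"
        using Gamma_integral_halfline_real(2)[OF c x] by simp
      also have "\<dots> = Gamma (Re c) * ((x powr (Re b - 1) * x powr (- Re c)) * norm (phi b (of_real x)))"
        by simp
      also have "x powr (Re b - 1) * x powr (- Re c) = x powr (Re a - 1)"
        by (simp add: c_def powr_add[symmetric])
      finally show ?thesis using x by (simp add: norm_mult norm_of_real_powr)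
    qed
    have "integrable halfline (\<lambda>x. Gamma (Re c) * norm (of_real x powr (a - 1) * phi b (of_real x)))"
      using a b by (intro integrable_mult_right integrable_norm integrable_powr_phi_0) auto
    then show "integrable halfline (\<lambda>x. \<integral>y. norm (case (x, y) of (x, p) \<Rightarrow> f x p) \<partial>halfline)"
      by (subst Bochner_Integration.integrable_cong[OF refl]) (auto simp: space_halfline ni)
    have "integrable halfline (f x)" if x: "x > 0" for x
      using Gamma_integral_halfline(1)[OF c x] unfolding f_def
      by (intro integrable_mult_right) (simp add: mult.commute)
    then show "AE x in halfline. integrable halfline (\<lambda>y. case (x, y) of (x, p) \<Rightarrow> f x p)"
      by (intro AE_I2) (auto simp: space_halfline)
  qed
  have "Gamma c * (\<integral>x. of_real x powr (a - 1) * phi b (of_real x) \<partial>halfline) = (\<integral>x. (\<integral>p. f x p \<partial>halfline) \<partial>halfline)"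
    by (subst integral_mult_right_zero[symmetric], intro Bochner_Integration.integral_cong refl)
      (simp add: i1 space_halfline)
  also have "\<dots> = (\<integral>p. (\<integral>x. f x p \<partial>halfline) \<partial>halfline)"
    by (rule halfline.Fubini_integral[OF int, symmetric])
  also have "\<dots> = (\<integral>p. of_real p powr (- a - 1) * of_real (exp (- (1 / p))) \<partial>halfline)"
    by (intro Bochner_Integration.integral_cong refl) (simp add: i2 space_halfline)
  also have "\<dots> = Gamma a" by (rule Gamma_integral_halfline_inverse[OF a])
  finally have "Gamma c * (\<integral>x. of_real x powr (a - 1) * phi b (of_real x) \<partial>halfline) = Gamma a" .
  moreover have "Gamma c \<noteq> 0" using Re_pos_not_nonpos_Ints[OF c] by (simp add: Gamma_eq_zero_iff)
  ultimately show ?thesis by (simp add: rGamma_inverse_Gamma c_def[symmetric] field_simps)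
qed

section \<open>The Stieltjes transform\<close>

definition phi_Stieltjes :: "complex \<Rightarrow> complex \<Rightarrow> complex \<Rightarrow> complex" where
  "phi_Stieltjes a b w =
     (\<integral>x. of_real x powr (a - 1) * phi b (of_real x) * inverse (of_real x + w) \<partial>halfline)"

text \<open>For large \<open>x\<close> the triangle inequality suffices; for bounded
  \<open>x\<close> the distance of \<open>w\<close> from the closed slit does. The linear growth
  supplies the decay \<open>\<delta> = 1\<close> of the kernel, and the lower bound at bounded
  \<open>x\<close> the domination near \<open>w\<close>.\<close>

lemma slit_kernel_bound:
  fixes w :: complex
  assumes "w \<notin> \<real>\<^sub>\<le>\<^sub>0"
  obtains \<kappa> where "\<kappa> > 0" "\<And>x. x \<ge> 0 \<Longrightarrow> \<kappa> * (1 + x) \<le> norm (of_real x + w)"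
proof -
  have "open (- \<real>\<^sub>\<le>\<^sub>0 :: complex set)" by (intro open_Compl closed_nonpos_Reals_complex)
  then obtain e where e: "e > 0" "ball w e \<subseteq> - \<real>\<^sub>\<le>\<^sub>0"
    using openE[of "- \<real>\<^sub>\<le>\<^sub>0 :: complex set" w] assms by auto
  \<comment> \<open>The value 1/2 serves \<open>x \<ge> 2 * norm w + 1\<close>, where
    \<open>norm (x + w) \<ge> x - norm w \<ge> (1 + x) / 2\<close>. The other serves smaller
    \<open>x\<close>, where \<open>1 + x \<le> 2 * norm w + 2\<close> and
    \<open>norm (x + w) \<ge> e\<close>.\<close>
  define \<kappa> where "\<kappa> = min (1/2) (e / (2 * norm w + 2))"
  show ?thesis
  proof (rule that[of \<kappa>])
    have "2 * norm w + 2 > 0" using norm_ge_zero[of w] by linarith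
    then show "\<kappa> > 0" using e by (simp add: \<kappa>_def)
    fix x :: real assume x: "x \<ge> 0"
    show "\<kappa> * (1 + x) \<le> norm (of_real x + w)"
    proof (cases "x \<ge> 2 * norm w + 1")
      case True
      have "\<kappa> \<le> 1/2" unfolding \<kappa>_def by (rule min.cobounded1)
      then have "\<kappa> * (1 + x) \<le> 1/2 * (1 + x)" using x by (intro mult_right_mono) auto
      also have "\<dots> \<le> norm (of_real x + w)"
        using norm_diff_ineq[of "of_real x" w] x True by simp
      finally show ?thesis .
    next
      case False
      have "- of_real x \<notin> ball w e" using e x by auto
      then have "e \<le> norm (of_real x + w)" by (simp add: dist_norm add.commute)
      moreover have "\<kappa> * (1 + x) \<le> e / (2 * norm w + 2) * (2 * norm w + 2)"
        using False x e by (intro mult_mono) (auto simp: \<kappa>_def)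
      moreover have "2 * norm w + 2 \<noteq> 0" using norm_ge_zero[of w] by linarith
      ultimately show ?thesis by simp
    qed
  qed
qed

lemma slit_shift_nonzero:
  assumes "w \<notin> \<real>\<^sub>\<le>\<^sub>0" "x \<ge> 0"
  shows "complex_of_real x + w \<noteq> 0"
  using slit_kernel_bound[OF assms(1)] assms(2)
  by (metis add_increasing2 less_le_not_le mult_pos_pos norm_zero zero_less_one add_pos_nonneg)

lemma measurable_halfline_kernel:
  "w \<notin> \<real>\<^sub>\<le>\<^sub>0 \<Longrightarrow> (\<lambda>x. inverse (complex_of_real x + w)) \<in> borel_measurable halfline"
  using slit_shift_nonzero by (intro measurable_halfline_continuous continuous_intros) auto

lemma integrable_Stieltjes:
  assumes "w \<notin> \<real>\<^sub>\<le>\<^sub>0" "Re a > 0" "2 * Re a < Re b + 3/2"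
  shows "integrable halfline (\<lambda>x. of_real x powr (a - 1) * phi b (of_real x) * inverse (of_real x + w))"
proof -
  obtain \<kappa> where \<kappa>: "\<kappa> > 0" "\<And>x. x \<ge> 0 \<Longrightarrow> \<kappa> * (1 + x) \<le> norm (of_real x + w)"
    using slit_kernel_bound[OF assms(1)] by metis
  show ?thesis
  proof (rule integrable_powr_phi)
    show "norm (inverse (complex_of_real x + w)) \<le> (1 / \<kappa>) * (1 + x) powr (- 1)" if "x > 0" for x
      using le_imp_inverse_le[OF \<kappa>(2)[of x]] \<kappa>(1) that
      by (simp add: norm_inverse powr_minus divide_inverse)
  qed (use assms in \<open>auto intro: measurable_halfline_kernel\<close>)
qed

text \<open>From \<open>x / (x + w) = 1 - w / (x + w)\<close>. The summand 1 leaves the Mellin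
  integral of \<open>phi b\<close>, which is why the bound on \<open>Re a\<close> is stricter than
  the one for the transform itself.\<close>

lemma Stieltjes_shift_exponent:
  assumes w: "w \<notin> \<real>\<^sub>\<le>\<^sub>0" and a: "Re a > 0" and b: "2 * Re a < Re b - 1/2"
  shows "phi_Stieltjes (a + 1) b w = Gamma a * rGamma (b - a) - w * phi_Stieltjes a b w"
proof -
  have "phi_Stieltjes (a + 1) b w = (\<integral>x. of_real x powr (a - 1) * phi b (of_real x) -
      w * (of_real x powr (a - 1) * phi b (of_real x) * inverse (of_real x + w)) \<partial>halfline)"
    unfolding phi_Stieltjes_def
  proof (intro Bochner_Integration.integral_cong refl)
    fix x assume "x \<in> space halfline"
    then have x: "x > 0" by (simp add: space_halfline)
    have "complex_of_real x powr a = of_real x powr (a - 1) * of_real x"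
      using x by (simp add: powr_diff)
    then show "of_real x powr (a + 1 - 1) * phi b (of_real x) * inverse (of_real x + w) =
      of_real x powr (a - 1) * phi b (of_real x) -
      w * (of_real x powr (a - 1) * phi b (of_real x) * inverse (of_real x + w))"
      using slit_shift_nonzero[OF w, of x] x by (simp add: field_simps)
  qed
  also have "\<dots> = Gamma a * rGamma (b - a) - w * phi_Stieltjes a b w"
    using assms unfolding phi_Stieltjes_def
    by (subst Bochner_Integration.integral_diff) (auto intro!: integrable_powr_phi_0 integrable_Stieltjes simp: Mellin_phi)
  finally show ?thesis .
qed

text \<open>The recurrence of \<open>phi\<close> under the integral sign. Raising \<open>a\<close>
  by 1 and \<open>b\<close> by 2 leaves the difference \<open>Re b - 2 * Re a\<close> unchanged, so
  this relation holds on the whole range of convergence.\<close>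

lemma Stieltjes_shift_order:
  assumes w: "w \<notin> \<real>\<^sub>\<le>\<^sub>0" and a: "Re a > 0" and b: "2 * Re a < Re b + 3/2"
  shows "phi_Stieltjes a b w = b * phi_Stieltjes a (b + 1) w - phi_Stieltjes (a + 1) (b + 2) w"
proof -
  have "phi_Stieltjes a b w = (\<integral>x. b * (of_real x powr (a - 1) * phi (b + 1) (of_real x) * inverse (of_real x + w)) -
      of_real x powr (a + 1 - 1) * phi (b + 2) (of_real x) * inverse (of_real x + w) \<partial>halfline)"
    unfolding phi_Stieltjes_def
  proof (intro Bochner_Integration.integral_cong refl)
    fix x assume "x \<in> space halfline"
    then have x: "x > 0" by (simp add: space_halfline)
    have "complex_of_real x powr (a + 1 - 1) = of_real x powr (a - 1) * of_real x"
      using x by (simp add: powr_diff)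
    then show "of_real x powr (a - 1) * phi b (of_real x) * inverse (of_real x + w) =
      b * (of_real x powr (a - 1) * phi (b + 1) (of_real x) * inverse (of_real x + w)) -
      of_real x powr (a + 1 - 1) * phi (b + 2) (of_real x) * inverse (of_real x + w)"
      by (subst phi_recurrence[of b]) (simp add: algebra_simps)
  qed
  also have "\<dots> = b * phi_Stieltjes a (b + 1) w - phi_Stieltjes (a + 1) (b + 2) w"
    using assms integrable_Stieltjes[OF w, of "a + 1" "b + 2"] unfolding phi_Stieltjes_def
    by (subst Bochner_Integration.integral_diff) (auto intro!: integrable_mult_right integrable_Stieltjes)
  finally show ?thesis .
qed

section \<open>Dependence of the transform on \<open>w\<close>\<close>

lemma integral_dominated_convergence_at:
  fixes f :: "'b::first_countable_topology \<Rightarrow> 'a \<Rightarrow> 'c::{banach, second_countable_topology}"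
  assumes h: "h \<in> borel_measurable M" and g: "integrable M g"
    and bd: "eventually (\<lambda>y. f y \<in> borel_measurable M \<and> (\<forall>x\<in>space M. norm (f y x) \<le> g x)) (at y0)"
    and lim: "\<And>x. x \<in> space M \<Longrightarrow> ((\<lambda>y. f y x) \<longlongrightarrow> h x) (at y0)"
  shows "((\<lambda>y. integral\<^sup>L M (f y)) \<longlongrightarrow> integral\<^sup>L M h) (at y0)"
  unfolding tendsto_at_iff_sequentially comp_def
proof (intro allI impI)
  fix X assume X: "\<forall>i. X i \<in> UNIV - {y0}" "X \<longlonglongrightarrow> y0"
  have X': "filterlim X (at y0) sequentially"
    using X by (auto simp: filterlim_at)
  obtain n0 where n0: "\<And>n. n \<ge> n0 \<Longrightarrow> f (X n) \<in> borel_measurable M \<and> (\<forall>x\<in>space M. norm (f (X n) x) \<le> g x)"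
    using eventually_compose_filterlim[OF bd X'] unfolding eventually_sequentially by blast
  have "(\<lambda>n. integral\<^sup>L M (f (X (n + n0)))) \<longlonglongrightarrow> integral\<^sup>L M h"
  proof (rule integral_dominated_convergence[where w = g])
    show "AE x in M. (\<lambda>n. f (X (n + n0)) x) \<longlonglongrightarrow> h x"
      by (intro AE_I2 LIMSEQ_ignore_initial_segment filterlim_compose[OF lim X'])
  qed (use h g n0 in auto)
  then show "(\<lambda>n. integral\<^sup>L M (f (X n))) \<longlonglongrightarrow> integral\<^sup>L M h"
    by (rule LIMSEQ_offset)
qed

lemma integrable_Stieltjes_square:
  assumes "w \<notin> \<real>\<^sub>\<le>\<^sub>0" "Re a > 0" "2 * Re a < Re b + 3/2"
  shows "integrable halfline (\<lambda>x. of_real x powr (a - 1) * phi b (of_real x) * (inverse (of_real x + w))\<^sup>2)"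
proof -
  obtain \<kappa> where \<kappa>: "\<kappa> > 0" "\<And>x. x \<ge> 0 \<Longrightarrow> \<kappa> * (1 + x) \<le> norm (of_real x + w)"
    using slit_kernel_bound[OF assms(1)] by metis
  show ?thesis
  proof (rule Bochner_Integration.integrable_bound)
    show "integrable halfline (\<lambda>x. of_real (1 / \<kappa>) * (of_real x powr (a - 1) * phi b (of_real x) * inverse (of_real x + w)))"
      using assms by (intro integrable_mult_right integrable_Stieltjes)
    show "(\<lambda>x. of_real x powr (a - 1) * phi b (of_real x) * (inverse (of_real x + w))\<^sup>2) \<in> borel_measurable halfline"
      using assms by (intro borel_measurable_times borel_measurable_power measurable_halfline_powr measurable_halfline_phi measurable_halfline_kernel)
    have "norm (inverse (of_real x + w)) \<le> 1 / \<kappa>" if "x > 0" for x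
    proof -
      have "\<kappa> * 1 \<le> \<kappa> * (1 + x)" using \<kappa>(1) that by (intro mult_left_mono) auto
      also have "\<dots> \<le> norm (of_real x + w)" using \<kappa>(2) that by simp
      finally show ?thesis using \<kappa>(1) le_imp_inverse_le[of \<kappa> "norm (of_real x + w)"] by (simp add: norm_inverse divide_inverse)
    qed
    then have "norm (of_real x powr (a - 1) * phi b (of_real x)) * norm (inverse (of_real x + w)) * norm (inverse (of_real x + w))
       \<le> norm (of_real x powr (a - 1) * phi b (of_real x)) * norm (inverse (of_real x + w)) * (1 / \<kappa>)" if "x > 0" for x
      using that by (intro mult_left_mono) auto
    then show "AE x in halfline. norm (of_real x powr (a - 1) * phi b (of_real x) * (inverse (of_real x + w))\<^sup>2)
       \<le> norm (of_real (1 / \<kappa>) * (of_real x powr (a - 1) * phi b (of_real x) * inverse (of_real x + w)))"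
      using \<kappa>(1) by (intro AE_I2) (simp add: space_halfline norm_mult norm_divide power2_eq_square mult_ac)
  qed
qed

text \<open>The difference quotient is itself the integral of \<open>F v\<close>, with kernel
  \<open>- 1 / ((x + w) (x + v))\<close>. For \<open>v\<close> within \<open>\<kappa> / 2\<close> of
  \<open>w\<close> one has \<open>norm (x + v) \<ge> \<kappa> / 2\<close>, which dominates it by the
  integrand at \<open>w\<close>.\<close>

lemma has_field_derivative_Stieltjes:
  assumes w: "w \<notin> \<real>\<^sub>\<le>\<^sub>0" and a: "Re a > 0" and b: "2 * Re a < Re b + 3/2"
  shows "(phi_Stieltjes a b has_field_derivative
     - (\<integral>x. of_real x powr (a - 1) * phi b (of_real x) * (inverse (of_real x + w))\<^sup>2 \<partial>halfline)) (at w)"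
proof -
  obtain \<kappa> where \<kappa>: "\<kappa> > 0" "\<And>x. x \<ge> 0 \<Longrightarrow> \<kappa> * (1 + x) \<le> norm (of_real x + w)"
    using slit_kernel_bound[OF w] by metis
  define f where "f = (\<lambda>x. complex_of_real x powr (a - 1) * phi b (of_real x))"
  define F where "F = (\<lambda>v x. - (f x * inverse (of_real x + w) * inverse (of_real x + v)))"
  have fm: "f \<in> borel_measurable halfline"
    unfolding f_def by (intro borel_measurable_times measurable_halfline_powr measurable_halfline_phi)
  have near: "eventually (\<lambda>v. v \<noteq> w \<and> v \<notin> \<real>\<^sub>\<le>\<^sub>0 \<and> dist v w < \<kappa> / 2) (at w)"
  proof (intro eventually_conj)
    have "eventually (\<lambda>v. v \<in> - \<real>\<^sub>\<le>\<^sub>0) (at w)"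
      using w by (intro eventually_at_in_open' open_Compl closed_nonpos_Reals_complex) auto
    then show "eventually (\<lambda>v. v \<notin> \<real>\<^sub>\<le>\<^sub>0) (at w)" by simp
    show "eventually (\<lambda>v. dist v w < \<kappa> / 2) (at w)"
      using \<kappa> unfolding eventually_at by (intro exI[of _ "\<kappa> / 2"]) auto
  qed (rule eventually_neq_at_within)
  have "((\<lambda>v. integral\<^sup>L halfline (F v)) \<longlongrightarrow> integral\<^sup>L halfline (F w)) (at w)"
  proof (rule integral_dominated_convergence_at[where g = "\<lambda>x. 2 / \<kappa> * norm (f x * inverse (of_real x + w))"])
    show "F w \<in> borel_measurable halfline"
      unfolding F_def by (intro borel_measurable_uminus borel_measurable_times fm measurable_halfline_kernel w)
    show "integrable halfline (\<lambda>x. 2 / \<kappa> * norm (f x * inverse (of_real x + w)))"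
      unfolding f_def by (intro integrable_mult_right integrable_norm integrable_Stieltjes assms)
    show "\<forall>\<^sub>F v in at w. F v \<in> borel_measurable halfline \<and> (\<forall>x\<in>space halfline. norm (F v x) \<le> 2 / \<kappa> * norm (f x * inverse (of_real x + w)))"
      using near
    proof eventually_elim
      case (elim v)
      have "norm (F v x) \<le> 2 / \<kappa> * norm (f x * inverse (of_real x + w))" if "x > 0" for x
      proof -
        have "\<kappa> * 1 \<le> \<kappa> * (1 + x)" using that \<kappa>(1) by (intro mult_left_mono) auto
        then have "\<kappa> \<le> norm (of_real x + w)" using \<kappa>(2)[of x] that by simp
        moreover have "norm (of_real x + w) \<le> norm (of_real x + v) + dist v w"
          using norm_triangle_ineq[of "of_real x + v" "w - v"] by (simp add: dist_norm norm_minus_commute)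
        ultimately have "\<kappa> / 2 \<le> norm (of_real x + v)" using elim by linarith
        then have "norm (inverse (of_real x + v)) \<le> 2 / \<kappa>"
          using \<kappa>(1) le_imp_inverse_le[of "\<kappa> / 2" "norm (of_real x + v)"] by (simp add: norm_inverse)
        then have "norm (f x * inverse (of_real x + w)) * norm (inverse (of_real x + v)) \<le> norm (f x * inverse (of_real x + w)) * (2 / \<kappa>)"
          by (intro mult_left_mono) auto
        then show ?thesis unfolding F_def norm_minus_cancel norm_mult[of _ "inverse (of_real x + v)"] by (simp add: mult_ac)
      qed
      moreover have "F v \<in> borel_measurable halfline"
        unfolding F_def using elim by (intro borel_measurable_uminus borel_measurable_times fm measurable_halfline_kernel w) auto
      ultimately show ?case by (simp add: space_halfline)
    qed
    show "((\<lambda>v. F v x) \<longlongrightarrow> F w x) (at w)" if "x \<in> space halfline" for x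
      unfolding F_def using slit_shift_nonzero[OF w, of x] that
      by (intro tendsto_intros) (auto simp: space_halfline)
  qed
  moreover have "eventually (\<lambda>v. integral\<^sup>L halfline (F v) = (phi_Stieltjes a b v - phi_Stieltjes a b w) / (v - w)) (at w)"
    using near
  proof eventually_elim
    case (elim v)
    have "phi_Stieltjes a b v - phi_Stieltjes a b w = (\<integral>x. f x * inverse (of_real x + v) - f x * inverse (of_real x + w) \<partial>halfline)"
      unfolding phi_Stieltjes_def f_def using elim assms
      by (subst Bochner_Integration.integral_diff) (auto intro!: integrable_Stieltjes)
    also have "\<dots> = (\<integral>x. (v - w) * F v x \<partial>halfline)"
    proof (intro Bochner_Integration.integral_cong refl)
      fix x assume "x \<in> space halfline"
      then have "complex_of_real x + w \<noteq> 0" "complex_of_real x + v \<noteq> 0"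
        using elim w slit_shift_nonzero by (auto simp: space_halfline)
      then have *: "inverse (of_real x + v) - inverse (of_real x + w) = - (inverse (of_real x + v) * (v - w) * inverse (of_real x + w))"
        by (subst inverse_diff_inverse) auto
      then show "f x * inverse (of_real x + v) - f x * inverse (of_real x + w) = (v - w) * F v x"
        unfolding F_def right_diff_distrib[symmetric] * by simp
    qed
    finally show ?case using elim by simp
  qed
  ultimately have "((\<lambda>v. (phi_Stieltjes a b v - phi_Stieltjes a b w) / (v - w)) \<longlongrightarrow> integral\<^sup>L halfline (F w)) (at w)"
    by (rule Lim_transform_eventually)
  then show ?thesis
    by (simp add: has_field_derivative_iff F_def f_def power2_eq_square mult.assoc)
qed

lemma tendsto_powr_phi_kernel:
  assumes w: "w \<notin> \<real>\<^sub>\<le>\<^sub>0" and a: "Re a > 0" and b: "2 * Re a < Re b + 3/2"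
  shows "((\<lambda>x. of_real x powr a * phi b (of_real x) * inverse (of_real x + w)) \<longlongrightarrow> 0) (at_right 0)"
    "((\<lambda>x. of_real x powr a * phi b (of_real x) * inverse (of_real x + w)) \<longlongrightarrow> 0) at_top"
proof -
  obtain \<kappa> where \<kappa>: "\<kappa> > 0" "\<And>x. x \<ge> 0 \<Longrightarrow> \<kappa> * (1 + x) \<le> norm (of_real x + w)"
    using slit_kernel_bound[OF w] by metis
  obtain C where C: "C > 0"
    "\<And>x. x > 0 \<Longrightarrow> norm (phi b (of_real x)) \<le> C * (if x \<le> 1 then 1 else x powr (1/4 - Re b / 2))"
    using phi_bound[of b] by metis
  have k: "norm (inverse (of_real x + w)) \<le> 1 / (\<kappa> * (1 + x))" if "x > 0" for x
    using le_imp_inverse_le[OF \<kappa>(2)[of x]] \<kappa>(1) that by (simp add: norm_inverse divide_inverse)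
  have b1: "norm (of_real x powr a * phi b (of_real x) * inverse (of_real x + w)) \<le> x powr Re a * (C / \<kappa>)" if "x > 0" "x \<le> 1" for x
  proof -
    have "1 / (\<kappa> * (1 + x)) \<le> 1 / (\<kappa> * 1)"
      using that \<kappa>(1) by (intro divide_left_mono mult_left_mono) auto
    then have "norm (inverse (of_real x + w)) \<le> 1 / \<kappa>" using k[OF that(1)] by simp
    then have "norm (of_real x powr a * phi b (of_real x) * inverse (of_real x + w)) \<le> x powr Re a * (C * 1) * (1 / \<kappa>)"
      using C(2)[of x] C(1) that unfolding norm_mult by (intro mult_mono) (auto simp: norm_of_real_powr)
    then show ?thesis by simp
  qed
  have b2: "norm (of_real x powr a * phi b (of_real x) * inverse (of_real x + w)) \<le> C / \<kappa> * x powr (Re a - Re b / 2 - 3/4)" if "x > 1" for x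
  proof -
    have "1 / (\<kappa> * (1 + x)) \<le> 1 / (\<kappa> * x)"
      using that \<kappa>(1) by (intro divide_left_mono mult_left_mono) auto
    then have "norm (inverse (of_real x + w)) \<le> 1 / \<kappa> * x powr (-1)" using k[of x] that by (simp add: powr_minus divide_inverse)
    then have "norm (of_real x powr a * phi b (of_real x) * inverse (of_real x + w)) \<le> x powr Re a * (C * x powr (1/4 - Re b / 2)) * (1 / \<kappa> * x powr (-1))"
      using C(2)[of x] C(1) that unfolding norm_mult by (intro mult_mono) (auto simp: norm_of_real_powr)
    also have "\<dots> = C / \<kappa> * (x powr Re a * x powr (1/4 - Re b / 2) * x powr (-1))" by simp
    also have "x powr Re a * x powr (1/4 - Re b / 2) * x powr (-1) = x powr (Re a - Re b / 2 - 3/4)"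
      by (simp only: powr_add[symmetric]) (simp add: algebra_simps)
    finally show ?thesis .
  qed
  show "((\<lambda>x. of_real x powr a * phi b (of_real x) * inverse (of_real x + w)) \<longlongrightarrow> 0) (at_right 0)"
  proof (rule Lim_null_comparison)
    show "\<forall>\<^sub>F x in at_right 0. norm (of_real x powr a * phi b (of_real x) * inverse (of_real x + w)) \<le> x powr Re a * (C / \<kappa>)"
      using b1 by (auto simp: eventually_at_right_field intro!: exI[of _ 1])
    show "((\<lambda>x. x powr Re a * (C / \<kappa>)) \<longlongrightarrow> 0) (at_right 0)"
      using a by real_asymp
  qed
  \<comment> \<open>This is the convergence condition of the transform again, so the boundary term
    at infinity vanishes on the full range.\<close>
  have e: "Re a - Re b / 2 - 3/4 < 0" using b by linarith
  show "((\<lambda>x. of_real x powr a * phi b (of_real x) * inverse (of_real x + w)) \<longlongrightarrow> 0) at_top"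
  proof (rule Lim_null_comparison)
    show "\<forall>\<^sub>F x in at_top. norm (of_real x powr a * phi b (of_real x) * inverse (of_real x + w)) \<le> C / \<kappa> * x powr (Re a - Re b / 2 - 3/4)"
      using eventually_gt_at_top[of 1] by eventually_elim (rule b2)
    show "((\<lambda>x. C / \<kappa> * x powr (Re a - Re b / 2 - 3/4)) \<longlongrightarrow> 0) at_top"
      by (intro tendsto_mult_right_zero tendsto_neg_powr e filterlim_ident)
  qed
qed

text \<open>Integrating the \<open>x\<close>-derivative of
  \<open>x powr a * phi b x / (x + w)\<close> over the half-line gives 0, and this relation trades
  the squared kernel of the derivative for transforms. The bound on \<open>Re a\<close> is the
  convergence condition for the pair \<open>(a + 1, b + 1)\<close>.\<close>

lemma DERIV_Stieltjes:
  assumes w: "w \<notin> \<real>\<^sub>\<le>\<^sub>0" and a: "Re a > 0" and b: "2 * Re a < Re b + 1/2"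
  shows "(phi_Stieltjes a b has_field_derivative
     ((a - 1) * phi_Stieltjes a b w - phi_Stieltjes (a + 1) (b + 1) w) / w) (at w)"
proof -
  define f where "f = (\<lambda>x. (a - 1) * (complex_of_real x powr (a - 1) * phi b (of_real x) * inverse (of_real x + w))
     - of_real x powr (a + 1 - 1) * phi (b + 1) (of_real x) * inverse (of_real x + w)
     + w * (of_real x powr (a - 1) * phi b (of_real x) * (inverse (of_real x + w))\<^sup>2))"
  have i1: "integrable halfline (\<lambda>x. (a - 1) * (complex_of_real x powr (a - 1) * phi b (of_real x) * inverse (of_real x + w)))"
    using a b by (intro integrable_mult_right integrable_Stieltjes w) auto
  have i2: "integrable halfline (\<lambda>x. of_real x powr (a + 1 - 1) * phi (b + 1) (of_real x) * inverse (of_real x + w))"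
    using a b by (intro integrable_Stieltjes w) auto
  have i3: "integrable halfline (\<lambda>x. w * (of_real x powr (a - 1) * phi b (of_real x) * (inverse (of_real x + w))\<^sup>2))"
    using a b by (intro integrable_mult_right integrable_Stieltjes_square w) auto
  note i12 = Bochner_Integration.integrable_diff[OF i1 i2]
  have fi: "integrable halfline f"
    unfolding f_def by (intro Bochner_Integration.integrable_add i12 i3)
  have "integral\<^sup>L halfline f = 0 - 0"
  proof (rule FTC_halfline[where F = "\<lambda>x. of_real x powr a * phi b (of_real x) * inverse (of_real x + w)"])
    fix x :: real assume x: "x > 0"
    have nz: "complex_of_real x + w \<noteq> 0" using slit_shift_nonzero[OF w, of x] x by simp
    have nn: "complex_of_real x \<notin> \<real>\<^sub>\<le>\<^sub>0" using x by auto
    have p: "complex_of_real x powr a = of_real x powr (a - 1) * of_real x" using x by (simp add: powr_diff)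
    have "((\<lambda>z. z powr a * phi b z * inverse (z + w)) has_field_derivative
      (a * of_real x powr (a - 1) * phi b (of_real x) + (- phi (b + 1) (of_real x)) * of_real x powr a) * inverse (of_real x + w)
       + (- (inverse (of_real x + w) * inverse (of_real x + w))) * (of_real x powr a * phi b (of_real x))) (at (of_real x))"
      using nz nn by (auto intro!: derivative_eq_intros)
    also have "(a * of_real x powr (a - 1) * phi b (of_real x) + (- phi (b + 1) (of_real x)) * of_real x powr a) * inverse (of_real x + w)
       + (- (inverse (of_real x + w) * inverse (of_real x + w))) * (of_real x powr a * phi b (of_real x)) = f x"
    proof -
      define y where "y = inverse (complex_of_real x + w)"
      \<comment> \<open>Splitting \<open>y = (x + w) * y^2\<close> replaces
        \<open>x / (x + w)^2\<close> by \<open>1 / (x + w) - w / (x + w)^2\<close>, the only kernels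
        for which integrability is known here.\<close>
      have y: "y = of_real x * y\<^sup>2 + w * y\<^sup>2"
        using nz by (simp add: y_def power2_eq_square flip: distrib_right mult.assoc)
      have "(a * of_real x powr (a - 1) * phi b (of_real x) + (- phi (b + 1) (of_real x)) * of_real x powr a) * y
       + (- (y * y)) * (of_real x powr a * phi b (of_real x))
       = f x + of_real x powr (a - 1) * phi b (of_real x) * (y - (of_real x * y\<^sup>2 + w * y\<^sup>2))"
        unfolding f_def y_def[symmetric] by (simp add: p algebra_simps power2_eq_square)
      with y show ?thesis by (simp add: y_def)
    qed
    finally show "((\<lambda>x. of_real x powr a * phi b (of_real x) * inverse (of_real x + w)) has_vector_derivative f x) (at x)"
      by (rule has_vector_derivative_real_field)
  next
    show "continuous_on {0<..} f"
      unfolding f_def using slit_shift_nonzero[OF w] by (intro continuous_intros) auto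
  qed (use a b w fi in \<open>auto intro!: tendsto_powr_phi_kernel\<close>)
  moreover have "integral\<^sup>L halfline f = (a - 1) * phi_Stieltjes a b w - phi_Stieltjes (a + 1) (b + 1) w
     + w * (\<integral>x. of_real x powr (a - 1) * phi b (of_real x) * (inverse (of_real x + w))\<^sup>2 \<partial>halfline)"
    unfolding f_def phi_Stieltjes_def Bochner_Integration.integral_add[OF i12 i3] Bochner_Integration.integral_diff[OF i1 i2]
    by simp
  moreover have "w \<noteq> 0" using w by auto
  ultimately have "((a - 1) * phi_Stieltjes a b w - phi_Stieltjes (a + 1) (b + 1) w) / w = 
     - (\<integral>x. of_real x powr (a - 1) * phi b (of_real x) * (inverse (of_real x + w))\<^sup>2 \<partial>halfline)"
    by (simp add: field_simps eq_neg_iff_add_eq_0)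
  then show ?thesis using has_field_derivative_Stieltjes[OF w a] b by simp
qed

lemma holomorphic_Stieltjes:
  assumes "Re a > 0" "2 * Re a < Re b + 3/2"
  shows "phi_Stieltjes a b holomorphic_on (- \<real>\<^sub>\<le>\<^sub>0)"
  using has_field_derivative_Stieltjes[OF _ assms]
  by (subst holomorphic_on_open) (auto intro: open_Compl)

section \<open>Behaviour of the Stieltjes transform at the origin\<close>

lemma integrable_powr_kernel:
  assumes a: "0 < Re a" "Re a < 1" and t: "t > 0"
  shows "integrable halfline (\<lambda>x. of_real x powr (a - 1) * inverse (of_real x + of_real t))"
proof -
  define h where "h = (\<lambda>x. (1 + 1 / t) * (if x \<le> 1 then x powr (Re a - 1) else x powr (Re a - 2)))"
  have tn: "complex_of_real t \<notin> \<real>\<^sub>\<le>\<^sub>0" using t by auto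
  show ?thesis
  proof (rule Bochner_Integration.integrable_bound)
    show "integrable halfline h" unfolding h_def
      using a by (intro integrable_mult_right integrable_halfline_powr_cases) auto
    show "(\<lambda>x. of_real x powr (a - 1) * inverse (of_real x + of_real t)) \<in> borel_measurable halfline"
      by (intro borel_measurable_times measurable_halfline_powr measurable_halfline_kernel tn)
    have "norm (of_real x powr (a - 1) * inverse (of_real x + complex_of_real t)) \<le> norm (h x)" if x: "x > 0" for x
    proof -
      have "norm (of_real x powr (a - 1) * inverse (of_real x + complex_of_real t)) = x powr (Re a - 1) * inverse (x + t)"
        using x t by (simp add: norm_mult norm_of_real_powr norm_inverse flip: of_real_add)
      also have "\<dots> \<le> h x"
      proof (cases "x \<le> 1")
        case True
        have "inverse (x + t) \<le> inverse t" using x t by (intro le_imp_inverse_le) auto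
        also have "\<dots> \<le> 1 + 1 / t" by (simp add: divide_inverse)
        finally have "x powr (Re a - 1) * inverse (x + t) \<le> x powr (Re a - 1) * (1 + 1 / t)" by (intro mult_left_mono) auto
        then show ?thesis using True by (simp add: h_def mult.commute)
      next
        case False
        have "x powr (Re a - 1) * inverse (x + t) \<le> x powr (Re a - 1) * inverse x"
          using x t by (intro mult_left_mono le_imp_inverse_le) auto
        also have "\<dots> = x powr (Re a - 2)" using x powr_add[of x "Re a - 2" 1] by (simp add: powr_add divide_simps)
        also have "\<dots> \<le> (1 + 1 / t) * x powr (Re a - 2)" using t by (simp add: distrib_right)
        finally show ?thesis using False by (simp add: h_def)
      qed
      finally show ?thesis by simp
    qed
    then show "AE x in halfline. norm (of_real x powr (a - 1) * inverse (of_real x + of_real t)) \<le> norm (h x)"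
      by (intro AE_I2) (auto simp: space_halfline)
  qed
qed

text \<open>Euler's integral. Writing \<open>1 / (x + t)\<close> as a Laplace integral and
  exchanging the integrations yields \<open>Gamma a * Gamma (1 - a)\<close>, evaluated by the
  reflection formula.\<close>

lemma integral_powr_kernel:
  assumes a: "0 < Re a" "Re a < 1" and t: "t > 0"
  shows "(\<integral>x. of_real x powr (a - 1) * inverse (of_real x + of_real t) \<partial>halfline)
     = of_real t powr (a - 1) * (of_real pi / sin (of_real pi * a))"
proof -
  define f where "f = (\<lambda>x s. complex_of_real x powr (a - 1) * of_real (exp (- ((x + t) * s))))"
  have E: "integrable halfline (\<lambda>s. exp (- (y * s)))" "(\<integral>s. exp (- (y * s)) \<partial>halfline) = inverse y" if "y > 0" for y :: real
  proof -
    have c: "s powr (1 - 1) * exp (- (y * s)) = exp (- (y * s))" if "s \<in> space halfline" for s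
      using that by (simp add: space_halfline)
    note G = Gamma_integral_halfline_real[OF zero_less_one that]
    show "integrable halfline (\<lambda>s. exp (- (y * s)))"
      by (rule iffD1[OF Bochner_Integration.integrable_cong[OF refl c] G(1)])
    show "(\<integral>s. exp (- (y * s)) \<partial>halfline) = inverse y"
      using trans[OF Bochner_Integration.integral_cong[OF refl c, symmetric] G(2)] that
      by (simp add: powr_minus)
  qed
  have i1: "(\<integral>s. f x s \<partial>halfline) = of_real x powr (a - 1) * inverse (of_real x + of_real t)" if "x > 0" for x
    using E(2)[of "x + t"] that t by (simp add: f_def integral_complex_of_real flip: of_real_add of_real_inverse)
  have i2: "(\<integral>x. f x s \<partial>halfline) = Gamma a * (of_real s powr (1 - a - 1) * of_real (exp (- (t * s))))" if "s > 0" for s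
  proof -
    have "(\<integral>x. f x s \<partial>halfline) = (\<integral>x. of_real (exp (- (t * s))) * (of_real x powr (a - 1) * of_real (exp (- (s * x)))) \<partial>halfline)"
      by (intro Bochner_Integration.integral_cong refl) (simp add: f_def algebra_simps exp_add exp_diff exp_minus field_simps)
    then show ?thesis using Gamma_integral_halfline(2)[OF a(1) that] by simp
  qed
  have int: "integrable (halfline \<Otimes>\<^sub>M halfline) (case_prod f)"
  proof (rule halfline.Fubini_integrable)
    have [measurable]: "(\<lambda>x. complex_of_real x powr e) \<in> borel_measurable halfline" 
      "(\<lambda>x::real. x) \<in> borel_measurable halfline" for e
      by (rule measurable_halfline_powr measurable_halfline_id)+
    show "case_prod f \<in> borel_measurable (halfline \<Otimes>\<^sub>M halfline)"
      unfolding f_def by measurable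
    have "(\<integral>s. norm (f x s) \<partial>halfline) = norm (of_real x powr (a - 1) * inverse (of_real x + complex_of_real t))" if "x > 0" for x
      using E(2)[of "x + t"] that t
      by (simp add: f_def norm_mult norm_inverse flip: of_real_add)
    then show "integrable halfline (\<lambda>x. \<integral>y. norm (case (x, y) of (x, p) \<Rightarrow> f x p) \<partial>halfline)"
      using integrable_norm[OF integrable_powr_kernel[OF assms]]
      by (subst Bochner_Integration.integrable_cong[OF refl]) (auto simp: space_halfline)
    have "integrable halfline (f x)" if x: "x > 0" for x
      using E(1)[of "x + t"] t x unfolding f_def
      by (intro integrable_mult_right integrable_of_real) simp
    then show "AE x in halfline. integrable halfline (\<lambda>y. case (x, y) of (x, p) \<Rightarrow> f x p)"
      by (intro AE_I2) (auto simp: space_halfline)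
  qed
  have "(\<integral>x. of_real x powr (a - 1) * inverse (of_real x + of_real t) \<partial>halfline) = (\<integral>x. (\<integral>s. f x s \<partial>halfline) \<partial>halfline)"
    by (intro Bochner_Integration.integral_cong refl) (simp add: i1 space_halfline)
  also have "\<dots> = (\<integral>s. (\<integral>x. f x s \<partial>halfline) \<partial>halfline)"
    by (rule halfline.Fubini_integral[OF int, symmetric])
  also have "\<dots> = (\<integral>s. Gamma a * (of_real s powr (1 - a - 1) * of_real (exp (- (t * s)))) \<partial>halfline)"
    by (intro Bochner_Integration.integral_cong refl) (simp add: i2 space_halfline)
  also have "\<dots> = Gamma a * (Gamma (1 - a) * of_real t powr (- (1 - a)))"
    using Gamma_integral_halfline(2)[of "1 - a" t] a t by simp
  also have "\<dots> = of_real t powr (a - 1) * (of_real pi / sin (of_real pi * a))"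
    unfolding Gamma_reflection_complex[of a, symmetric] by simp
  finally show ?thesis .
qed

text \<open>Near 0 the function is Lipschitz and \<open>x \<le> x powr \<epsilon>\<close>; beyond 1
  it is bounded, since \<open>Re b \<ge> 1/2\<close> makes the decay exponent non-positive. A small
  power instead of \<open>x\<close> itself is wanted so that Euler's integral still converges with
  the exponent raised by \<open>\<epsilon>\<close>.\<close>

lemma phi_increment_bound:
  assumes b: "Re b \<ge> 1/2" and \<epsilon>: "0 < \<epsilon>" "\<epsilon> \<le> 1"
  obtains C where "C > 0" "\<And>x. x > 0 \<Longrightarrow> norm (phi b (of_real x) - rGamma b) \<le> C * x powr \<epsilon>"
proof -
  obtain C1 where C1: "C1 > 0"
    "\<And>x. x > 0 \<Longrightarrow> norm (phi b (of_real x)) \<le> C1 * (if x \<le> 1 then 1 else x powr (1/4 - Re b / 2))"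
    using phi_bound[of b] by metis
  have "bounded (phi (b + 1) ` cball 0 1)"
    by (intro compact_imp_bounded compact_continuous_image continuous_intros) auto
  then obtain B where B: "\<And>z. z \<in> cball 0 1 \<Longrightarrow> norm (- phi (b + 1) z) \<le> B"
    unfolding bounded_iff by (metis imageI norm_minus_cancel)
  have B0: "B \<ge> 0" using B[of 0] norm_ge_zero[of "- phi (b + 1) 0"] by (simp del: norm_ge_zero phi_0)
  have lip: "norm (phi b z - phi b 0) \<le> B * norm (z - 0)" if "z \<in> cball 0 1" for z
    by (rule field_differentiable_bound[OF convex_cball, of 0 1 "phi b" "\<lambda>z. - phi (b + 1) z"])
      (use B that in \<open>auto intro: has_field_derivative_phi has_field_derivative_at_within\<close>)
  show ?thesis
  proof (rule that[of "B + C1 + norm (rGamma b)"])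
    fix x :: real assume x: "x > 0"
    show "norm (phi b (of_real x) - rGamma b) \<le> (B + C1 + norm (rGamma b)) * x powr \<epsilon>"
    proof (cases "x \<le> 1")
      case True
      have "norm (phi b (of_real x) - rGamma b) \<le> B * x" using lip[of "of_real x"] x True by simp
      also have "x \<le> x powr \<epsilon>" using powr_mono'[of \<epsilon> 1 x] x True \<epsilon> by simp
      then have "B * x \<le> B * x powr \<epsilon>" using B0 by (rule mult_left_mono)
      also have "\<dots> \<le> (B + C1 + norm (rGamma b)) * x powr \<epsilon>" using C1 by (intro mult_right_mono) auto
      finally show ?thesis .
    next
      case False
      have "x powr (1/4 - Re b / 2) \<le> 1" using powr_mono[of "1/4 - Re b / 2" 0 x] False b x by simp
      then have "C1 * x powr (1/4 - Re b / 2) \<le> C1 * 1" using C1 by (intro mult_left_mono) auto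
      then have "norm (phi b (of_real x)) \<le> C1" using C1(2)[OF x] False by simp
      then have "norm (phi b (of_real x) - rGamma b) \<le> C1 + norm (rGamma b)"
        using norm_triangle_ineq4[of "phi b (of_real x)" "rGamma b"] by linarith
      also have "\<dots> \<le> (B + C1 + norm (rGamma b)) * 1" using B0 by simp
      also have "\<dots> \<le> (B + C1 + norm (rGamma b)) * x powr \<epsilon>"
        using False \<epsilon> C1 B0 by (intro mult_left_mono ge_one_powr_ge_zero) auto
      finally show ?thesis .
    qed
  next
    show "B + C1 + norm (rGamma b) > 0" using C1(1) B0 norm_ge_zero[of "rGamma b"] by linarith
  qed
qed

text \<open>Replacing \<open>phi b\<close> by its value \<open>rGamma b\<close> at 0 gives exactly
  Euler's integral. The error is bounded by Euler's integral with exponent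
  \<open>Re a + \<epsilon>\<close>, which is smaller by the factor
  \<open>t powr \<epsilon>\<close>.\<close>

lemma Stieltjes_at_0:
  assumes a: "0 < Re a" "Re a < 1" and b: "Re b \<ge> 1/2" "2 * Re a < Re b + 3/2"
  shows "((\<lambda>t. of_real t powr (1 - a) * phi_Stieltjes a b (of_real t)) \<longlongrightarrow> rGamma b * (of_real pi / sin (of_real pi * a))) (at_right 0)"
proof -
  \<comment> \<open>Half the room left below 1, so that \<open>Re a + \<epsilon>\<close> stays
    inside the strip of Euler's integral.\<close>
  define \<epsilon> where "\<epsilon> = (1 - Re a) / 2"
  have \<epsilon>: "0 < \<epsilon>" "\<epsilon> \<le> 1" "Re a + \<epsilon> < 1" using a by (auto simp: \<epsilon>_def field_simps)
  obtain C where C: "C > 0" "\<And>x. x > 0 \<Longrightarrow> norm (phi b (of_real x) - rGamma b) \<le> C * x powr \<epsilon>"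
    using phi_increment_bound[OF b(1) \<epsilon>(1,2)] by metis
  define r where "r = complex_of_real (Re a + \<epsilon>)"
  have r: "0 < Re r" "Re r < 1" using a \<epsilon> by (auto simp: r_def)
  define D where "D = C * norm (of_real pi / sin (of_real pi * r))"
  have main: "norm (of_real t powr (1 - a) * phi_Stieltjes a b (of_real t) - rGamma b * (of_real pi / sin (of_real pi * a))) \<le> D * t powr \<epsilon>"
    if t: "t > 0" for t
  proof -
    have tn: "complex_of_real t \<notin> \<real>\<^sub>\<le>\<^sub>0" using t by auto
    define k where "k = (\<lambda>x. complex_of_real x powr (a - 1) * inverse (of_real x + of_real t))"
    have ik: "integrable halfline k" unfolding k_def by (rule integrable_powr_kernel[OF a t])
    have "of_real t powr (1 - a) * (\<integral>x. k x \<partial>halfline) = of_real pi / sin (of_real pi * a)"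
      using integral_powr_kernel[OF a t] t by (simp add: k_def powr_add[symmetric] mult.assoc[symmetric] del: times_divide_eq_right)
    then have "of_real t powr (1 - a) * phi_Stieltjes a b (of_real t) - rGamma b * (of_real pi / sin (of_real pi * a))
      = of_real t powr (1 - a) * (phi_Stieltjes a b (of_real t) - rGamma b * (\<integral>x. k x \<partial>halfline))"
      by (simp add: algebra_simps)
    also have "phi_Stieltjes a b (of_real t) - rGamma b * (\<integral>x. k x \<partial>halfline) = (\<integral>x. k x * (phi b (of_real x) - rGamma b) \<partial>halfline)"
    proof -
      have "phi_Stieltjes a b (of_real t) - rGamma b * (\<integral>x. k x \<partial>halfline) =
        (\<integral>x. of_real x powr (a - 1) * phi b (of_real x) * inverse (of_real x + of_real t) - rGamma b * k x \<partial>halfline)"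
        using Bochner_Integration.integral_diff[OF integrable_Stieltjes[OF tn a(1) b(2)] integrable_mult_right[OF ik]]
        by (simp add: phi_Stieltjes_def)
      also have "\<dots> = (\<integral>x. k x * (phi b (of_real x) - rGamma b) \<partial>halfline)"
        by (intro Bochner_Integration.integral_cong refl) (simp add: k_def algebra_simps)
      finally show ?thesis .
    qed
    finally have eq: "norm (of_real t powr (1 - a) * phi_Stieltjes a b (of_real t) - rGamma b * (of_real pi / sin (of_real pi * a)))
      = t powr (1 - Re a) * norm (\<integral>x. k x * (phi b (of_real x) - rGamma b) \<partial>halfline)"
      using t by (simp add: norm_mult norm_of_real_powr)
    have ir: "integrable halfline (\<lambda>x. of_real x powr (r - 1) * inverse (of_real x + complex_of_real t))"
      by (rule integrable_powr_kernel[OF r t])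
    have "norm (\<integral>x. k x * (phi b (of_real x) - rGamma b) \<partial>halfline)
      \<le> (\<integral>x. C * Re (of_real x powr (r - 1) * inverse (of_real x + complex_of_real t)) \<partial>halfline)"
    proof (rule Bochner_Integration.integral_norm_bound_integral)
      have "integrable halfline (\<lambda>x. of_real x powr (a - 1) * phi b (of_real x) * inverse (of_real x + of_real t) - rGamma b * k x)"
        by (intro Bochner_Integration.integrable_diff integrable_mult_right ik integrable_Stieltjes tn a b)
      moreover have "(\<lambda>x. of_real x powr (a - 1) * phi b (of_real x) * inverse (of_real x + of_real t) - rGamma b * k x)
          = (\<lambda>x. k x * (phi b (of_real x) - rGamma b))"
        by (auto simp: k_def algebra_simps)
      ultimately show "integrable halfline (\<lambda>x. k x * (phi b (of_real x) - rGamma b))" by simp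
      show "integrable halfline (\<lambda>x. C * Re (of_real x powr (r - 1) * inverse (of_real x + complex_of_real t)))"
        by (intro integrable_mult_right integrable_Re ir)
      fix x assume "x \<in> space halfline"
      then have x: "x > 0" by (simp add: space_halfline)
      have "norm (k x * (phi b (of_real x) - rGamma b)) \<le> x powr (Re a - 1) * inverse (x + t) * (C * x powr \<epsilon>)"
        unfolding k_def norm_mult using x t C(2)[OF x]
        by (intro mult_mono) (auto simp: norm_of_real_powr norm_inverse simp flip: of_real_add)
      also have "\<dots> = C * (x powr (Re a + \<epsilon> - 1) * inverse (x + t))"
        using x by (simp add: powr_add powr_diff)
      also have "complex_of_real x powr (r - 1) = of_real (x powr (Re a + \<epsilon> - 1))"
        using x powr_of_real[of x "Re a + \<epsilon> - 1"] by (simp add: r_def)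
      then have "x powr (Re a + \<epsilon> - 1) * inverse (x + t) = Re (of_real x powr (r - 1) * inverse (of_real x + complex_of_real t))"
        by (simp flip: of_real_add of_real_inverse)
      finally show "norm (k x * (phi b (of_real x) - rGamma b)) \<le> C * Re (of_real x powr (r - 1) * inverse (of_real x + complex_of_real t))" .
    qed
    also have "\<dots> = C * Re (of_real t powr (r - 1) * (of_real pi / sin (of_real pi * r)))"
      unfolding integral_mult_right_zero integral_Re[OF ir] integral_powr_kernel[OF r t] ..
    also have "\<dots> \<le> C * norm (of_real t powr (r - 1) * (of_real pi / sin (of_real pi * r)))"
      using C(1) by (intro mult_left_mono complex_Re_le_cmod) auto
    also have "\<dots> = D * t powr (Re a + \<epsilon> - 1)"
      unfolding norm_mult norm_of_real_powr[OF t] D_def by (simp add: r_def)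
    finally have "t powr (1 - Re a) * norm (\<integral>x. k x * (phi b (of_real x) - rGamma b) \<partial>halfline)
       \<le> t powr (1 - Re a) * (D * t powr (Re a + \<epsilon> - 1))"
      by (intro mult_left_mono) auto
    also have "\<dots> = D * t powr \<epsilon>"
      using t by (simp add: powr_add[symmetric])
    finally show ?thesis unfolding eq .
  qed
  show ?thesis
  proof (rule Lim_transform2[OF tendsto_const], rule Lim_null_comparison)
    show "\<forall>\<^sub>F t in at_right 0. norm (rGamma b * (of_real pi / sin (of_real pi * a)) - of_real t powr (1 - a) * phi_Stieltjes a b (of_real t)) \<le> D * t powr \<epsilon>"
      using main by (auto simp: eventually_at_right_field norm_minus_commute intro!: exI[of _ 1])
    show "((\<lambda>t. D * t powr \<epsilon>) \<longlongrightarrow> 0) (at_right 0)"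
      using \<epsilon>(1) by real_asymp
  qed
qed

text \<open>Two solutions \<open>(x, y)\<close> and \<open>(phi b (-w), phi (b + 1) (-w))\<close> of the same system have
  Wronskian \<open>const * w powr (-b)\<close>.\<close>
lemma Bessel_system_zero:
  fixes x y :: "complex \<Rightarrow> complex"
  assumes b: "Re b > 0"
    and dx: "\<And>w. Re w > 0 \<Longrightarrow> (x has_field_derivative y w) (at w)"
    and dy: "\<And>w. Re w > 0 \<Longrightarrow> (y has_field_derivative (x w - b * y w) / w) (at w)"
    and x0: "((\<lambda>t. x (of_real t)) \<longlongrightarrow> 0) (at_right 0)"
    and y0: "((\<lambda>t. y (of_real t)) \<longlongrightarrow> 0) (at_right 0)"
  obtains \<epsilon> where "\<epsilon> > 0" "\<And>w. Re w > 0 \<Longrightarrow> norm w < \<epsilon> \<Longrightarrow> x w = 0"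
proof -
  define f where "f = (\<lambda>w. phi b (- w))"
  define g where "g = (\<lambda>w. phi (b + 1) (- w))"
  have df: "(f has_field_derivative g w) (at w)" for w
    unfolding f_def g_def by (auto intro!: derivative_eq_intros)
  have dg: "(g has_field_derivative (f w - b * g w) / w) (at w)" if "Re w > 0" for w
  proof -
    have "w \<noteq> 0" using that by auto
    then show ?thesis
      unfolding f_def g_def using phi_recurrence[of b "- w"]
      by (auto intro!: derivative_eq_intros simp: field_simps)
  qed
  have f0: "((\<lambda>t. f (of_real t)) \<longlongrightarrow> rGamma b) (at_right 0)"
  proof -
    have "((\<lambda>t. f (of_real t)) \<longlongrightarrow> f (of_real 0)) (at_right 0)"
      unfolding f_def by (intro continuous_on_tendsto_compose[of UNIV "phi b"] continuous_intros tendsto_intros) auto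
    then show ?thesis by (simp add: f_def)
  qed
  have g0: "((\<lambda>t. g (of_real t)) \<longlongrightarrow> rGamma (b + 1)) (at_right 0)"
  proof -
    have "((\<lambda>t. g (of_real t)) \<longlongrightarrow> g (of_real 0)) (at_right 0)"
      unfolding g_def by (intro continuous_on_tendsto_compose[of UNIV "phi (b + 1)"] continuous_intros tendsto_intros) auto
    then show ?thesis by (simp add: g_def)
  qed
  define W where "W = (\<lambda>w. x w * g w - y w * f w)"
  have dW: "((\<lambda>w. w powr b * W w) has_field_derivative 0) (at w within {w. Re w > 0})" if "w \<in> {w. Re w > 0}" for w
  proof -
    have w: "Re w > 0" "w \<noteq> 0" "w \<notin> \<real>\<^sub>\<le>\<^sub>0" using that by (auto elim!: nonpos_Reals_cases)
    have "(W has_field_derivative (y w * g w + (f w - b * g w) / w * x w - ((x w - b * y w) / w * f w + g w * y w))) (at w)"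
      unfolding W_def by (intro derivative_intros dx dy df dg w)
    also have "(y w * g w + (f w - b * g w) / w * x w - ((x w - b * y w) / w * f w + g w * y w)) = - b * W w / w"
      using w by (simp add: W_def field_simps)
    finally have "((\<lambda>w. w powr b * W w) has_field_derivative (b * w powr (b - 1) * W w + (- b * W w / w) * w powr b)) (at w)"
      using w by (auto intro!: derivative_eq_intros)
    then have "((\<lambda>w. w powr b * W w) has_field_derivative 0) (at w)"
      using w by (simp add: powr_diff)
    then show ?thesis by (rule has_field_derivative_at_within)
  qed
  have cH: "convex {w. Re w > 0}" by (rule convex_halfspace_Re_gt)
  obtain c where c: "\<And>w. Re w > 0 \<Longrightarrow> w powr b * W w = c"
    using has_field_derivative_zero_constant[OF cH dW] by auto
  \<comment> \<open>\<open>Re b > 0\<close> sends the power to 0 while \<open>W\<close> tends to 0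
    as well, so the constant \<open>c\<close> vanishes and the two solutions are
    proportional.\<close>
  have "((\<lambda>t. of_real t powr b * W (of_real t)) \<longlongrightarrow> 0 * (0 * rGamma (b + 1) - 0 * rGamma b)) (at_right 0)"
    unfolding W_def
  proof (intro tendsto_intros x0 y0 f0 g0)
    show "((\<lambda>t. complex_of_real t powr b) \<longlongrightarrow> 0) (at_right 0)"
    proof (rule Lim_null_comparison)
      show "\<forall>\<^sub>F t in at_right 0. norm (complex_of_real t powr b) \<le> t powr Re b"
        by (auto simp: eventually_at_right_field norm_of_real_powr intro!: exI[of _ 1])
      show "((\<lambda>t. t powr Re b) \<longlongrightarrow> 0) (at_right 0)" using b by real_asymp
    qed
  qed
  moreover have "((\<lambda>t. of_real t powr b * W (of_real t)) \<longlongrightarrow> c) (at_right 0)"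
    by (rule tendsto_eventually) (auto simp: eventually_at_right_field c intro!: exI[of _ 1])
  ultimately have "c = 0" using tendsto_unique[of "at_right (0::real)"] by fastforce
  then have W: "W w = 0" if "Re w > 0" for w
    using c[OF that] that by auto
  have rb: "rGamma b \<noteq> 0"
    using Re_pos_not_nonpos_Ints[OF b] by (simp add: rGamma_eq_zero_iff)
  have "isCont f 0" using df DERIV_isCont by blast
  then have "\<forall>\<^sub>F w in at 0. f w \<noteq> 0"
    using rb unfolding isCont_def by (intro tendsto_imp_eventually_ne) (auto simp: f_def)
  then obtain \<epsilon> where \<epsilon>: "\<epsilon> > 0" "\<And>w. w \<noteq> 0 \<Longrightarrow> norm w < \<epsilon> \<Longrightarrow> f w \<noteq> 0"
    unfolding eventually_at by (auto simp: dist_norm)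
  define S where "S = {w. Re w > 0} \<inter> ball 0 \<epsilon>"
  \<comment> \<open>The derivative of the quotient is \<open>- W / f^2 = 0\<close>. The quotient is
    formed only near the origin, where \<open>f\<close> is known to be nonzero because it tends to
    \<open>rGamma b\<close>.\<close>
  have dq: "((\<lambda>w. x w / f w) has_field_derivative 0) (at w within S)" if "w \<in> S" for w
  proof -
    have w: "Re w > 0" "f w \<noteq> 0" using that \<epsilon>(2)[of w] by (cases "w = 0"; auto simp: S_def)+
    have "((\<lambda>w. x w / f w) has_field_derivative (y w * f w - x w * g w) / (f w * f w)) (at w)"
      by (intro DERIV_divide dx df w)
    then show ?thesis using W[OF w(1)] by (simp add: W_def has_field_derivative_at_within)
  qed
  have "convex S" unfolding S_def by (intro convex_Int cH convex_ball)
  then obtain d where d: "\<And>w. w \<in> S \<Longrightarrow> x w / f w = d"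
    using has_field_derivative_zero_constant[OF _ dq] by auto
  have "((\<lambda>t. x (of_real t) / f (of_real t)) \<longlongrightarrow> 0 / rGamma b) (at_right 0)"
    by (intro tendsto_intros x0 f0 rb)
  moreover have "((\<lambda>t. x (of_real t) / f (of_real t)) \<longlongrightarrow> d) (at_right 0)"
    using \<epsilon>(1) by (intro tendsto_eventually) (auto simp: eventually_at_right_field S_def intro!: exI[of _ \<epsilon>] d)
  ultimately have "d = 0" using tendsto_unique[of "at_right (0::real)"] by fastforce
  show ?thesis
  proof (rule that[OF \<epsilon>(1)])
    fix w :: complex assume w: "Re w > 0" "norm w < \<epsilon>"
    then have "w \<noteq> 0" by (cases "w = 0") auto
    then have "f w \<noteq> 0" by (rule \<epsilon>(2)) (rule w(2))
    moreover have "x w / f w = 0" using d[of w] w \<open>d = 0\<close> by (simp add: S_def)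
    ultimately show "x w = 0" by simp
  qed
qed

section \<open>The closed form\<close>

text \<open>This is 1F2(1; 2 - a, b - a + 1; w) divided by Gamma(2 - a) Gamma(b - a + 1). With
  \<open>a = (\<nu> - \<mu> + 1) / 2\<close> and \<open>b = \<nu> + 1\<close> it is the series of
  \<open>lommel_s\<close>, freed from vanishing denominators.\<close>

definition lommel_series :: "complex \<Rightarrow> complex \<Rightarrow> complex \<Rightarrow> complex" where
  "lommel_series a b w = (\<Sum>k. rGamma (2 - a + of_nat k) * rGamma (b - a + 1 + of_nat k) * w ^ k)"

text \<open>Two copies of the bound for shifted \<open>rGamma\<close>, with one of the two
  factorials given away. It is uniform in \<open>a\<close> so that Tannery's theorem can pass to the
  limit in the exponent.\<close>

lemma lommel_coeff_bound:
  fixes a0 b :: complex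
  obtains C where "C > 0"
    "\<And>a k. a \<in> cball a0 1 \<Longrightarrow> norm (rGamma (2 - a + of_nat k) * rGamma (b - a + 1 + of_nat k)) \<le> C * 4 ^ k / fact k"
proof -
  obtain C1 where C1: "C1 > 0" "\<And>c k. c \<in> cball (2 - a0) 1 \<Longrightarrow> norm (rGamma (c + of_nat k)) \<le> C1 * 2 ^ k / fact k"
    using rGamma_shift_bound[of "2 - a0"] by metis
  obtain C2 where C2: "C2 > 0" "\<And>c k. c \<in> cball (b - a0 + 1) 1 \<Longrightarrow> norm (rGamma (c + of_nat k)) \<le> C2 * 2 ^ k / fact k"
    using rGamma_shift_bound[of "b - a0 + 1"] by metis
  show ?thesis
  proof (rule that[of "C1 * C2"])
    fix a k assume a: "a \<in> cball a0 1"
    have "2 - a \<in> cball (2 - a0) 1" "b - a + 1 \<in> cball (b - a0 + 1) 1"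
      using a by (auto simp: dist_norm norm_minus_commute)
    note C1(2)[OF this(1), of k] C2(2)[OF this(2), of k]
    then have "norm (rGamma (2 - a + of_nat k) * rGamma (b - a + 1 + of_nat k)) \<le> (C1 * 2 ^ k / fact k) * (C2 * 2 ^ k / fact k)"
      using C1 C2 unfolding norm_mult by (intro mult_mono) auto
    also have "\<dots> \<le> (C1 * 2 ^ k / fact k) * (C2 * 2 ^ k / 1)"
      using C1(1) C2(1) by (intro mult_left_mono divide_left_mono) auto
    also have "\<dots> = C1 * C2 * 4 ^ k / fact k"
      by (simp add: power_mult_distrib[symmetric])
    finally show "norm (rGamma (2 - a + of_nat k) * rGamma (b - a + 1 + of_nat k)) \<le> C1 * C2 * 4 ^ k / fact k" .
  qed (use C1 C2 in auto)
qed

lemma summable_lommel: "summable (\<lambda>k. rGamma (2 - a + of_nat k) * rGamma (b - a + 1 + of_nat k) * (w::complex) ^ k)"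
proof -
  obtain C where C: "C > 0"
    "\<And>c k. c \<in> cball a 1 \<Longrightarrow> norm (rGamma (2 - c + of_nat k) * rGamma (b - c + 1 + of_nat k)) \<le> C * 4 ^ k / fact k"
    using lommel_coeff_bound[of a b] by metis
  show ?thesis
  proof (rule summable_comparison_test'[OF summable_exp_real[of C "4 * norm w"]])
    fix k :: nat
    show "norm (rGamma (2 - a + of_nat k) * rGamma (b - a + 1 + of_nat k) * w ^ k) \<le> C * (4 * norm w) ^ k / fact k"
      using mult_right_mono[OF C(2)[of a k], of "norm w ^ k"]
      by (simp add: norm_mult norm_power power_mult_distrib mult_ac)
  qed
qed

lemma tendsto_lommel_series:
  "((\<lambda>a. lommel_series a b w) \<longlongrightarrow> lommel_series a0 b w) (at a0)"
proof -
  obtain C where C: "C > 0"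
    "\<And>c k. c \<in> cball a0 1 \<Longrightarrow> norm (rGamma (2 - c + of_nat k) * rGamma (b - c + 1 + of_nat k)) \<le> C * 4 ^ k / fact k"
    using lommel_coeff_bound[of a0 b] by metis
  let ?f = "\<lambda>k a. rGamma (2 - a + of_nat k) * rGamma (b - a + 1 + of_nat k) * w ^ k"
  have near: "\<forall>\<^sub>F a in at a0. a \<in> cball a0 1"
    by (auto simp: eventually_at dist_commute intro!: exI[of _ 1])
  have "((\<lambda>a. \<Sum>k. ?f k a) \<longlongrightarrow> (\<Sum>k. ?f k a0)) (at a0)"
  proof (rule conjunct2[OF conjunct2[OF tannerys_theorem]])
    fix k
    have "isCont (\<lambda>a. ?f k a) a0"
      by (intro continuous_intros isCont_o2[OF _ isCont_rGamma[OF continuous_ident]])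
    then show "((\<lambda>a. ?f k a) \<longlongrightarrow> ?f k a0) (at a0)" by (simp add: isCont_def)
  next
    show "summable (\<lambda>k. C * (4 * norm w) ^ k / fact k)" by (rule summable_exp_real)
    have "\<forall>\<^sub>F (k::nat, a) in at_top \<times>\<^sub>F at a0. a \<in> cball a0 1"
      using eventually_prodI[OF eventually_True[of "at_top :: nat filter"] near]
      by (simp add: case_prod_unfold)
    then show "\<forall>\<^sub>F (k, a) in at_top \<times>\<^sub>F at a0. norm (?f k a) \<le> C * (4 * norm w) ^ k / fact k"
    proof eventually_elim
      case (elim x)
      obtain k a where x: "x = (k, a)" by (cases x)
      show ?case
        using mult_right_mono[OF C(2)[of a k], of "norm w ^ k"] elim
        by (simp add: x norm_mult norm_power power_mult_distrib mult_ac)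
    qed
  qed simp
  then show ?thesis unfolding lommel_series_def .
qed

text \<open>Raising \<open>a\<close> lowers both Gamma arguments by 1, so the series is shifted by
  one index and acquires a new first coefficient.\<close>

lemma lommel_series_shift_exponent:
  "lommel_series (a + 1) b w = rGamma (1 - a) * rGamma (b - a) + w * lommel_series a b w"
proof -
  have "(\<Sum>k. rGamma (2 - (a + 1) + of_nat (Suc k)) * rGamma (b - (a + 1) + 1 + of_nat (Suc k)) * w ^ Suc k)
     = (\<Sum>k. w * (rGamma (2 - a + of_nat k) * rGamma (b - a + 1 + of_nat k) * w ^ k))"
    by (simp add: algebra_simps)
  also have "\<dots> = w * lommel_series a b w"
    unfolding lommel_series_def by (rule suminf_mult[OF summable_lommel])
  finally have "(\<Sum>k. rGamma (2 - (a + 1) + of_nat (Suc k)) * rGamma (b - (a + 1) + 1 + of_nat (Suc k)) * w ^ Suc k) = w * lommel_series a b w" .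
  moreover have "lommel_series (a + 1) b w
      = (\<Sum>k. rGamma (2 - (a + 1) + of_nat (Suc k)) * rGamma (b - (a + 1) + 1 + of_nat (Suc k)) * w ^ Suc k)
        + rGamma (2 - (a + 1) + of_nat 0) * rGamma (b - (a + 1) + 1 + of_nat 0) * w ^ 0"
    unfolding lommel_series_def using suminf_split_head[OF summable_lommel, of "a + 1" b w] by simp
  moreover have "2 - (a + 1) + of_nat 0 = 1 - a" "b - (a + 1) + 1 + of_nat 0 = b - a" by auto
  ultimately show ?thesis by simp
qed

text \<open>Coefficientwise this is \<open>b + (1 - a + k) = b - a + 1 + k\<close>, each factor
  coming from one functional equation of \<open>rGamma\<close>.\<close>

lemma lommel_series_shift_order:
  "lommel_series a b w = b * lommel_series a (b + 1) w + lommel_series (a + 1) (b + 2) w"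
proof -
  have "b * lommel_series a (b + 1) w + lommel_series (a + 1) (b + 2) w
     = (\<Sum>k. b * (rGamma (2 - a + of_nat k) * rGamma (b + 1 - a + 1 + of_nat k) * w ^ k)
         + rGamma (2 - (a + 1) + of_nat k) * rGamma (b + 2 - (a + 1) + 1 + of_nat k) * w ^ k)"
    unfolding lommel_series_def
    by (simp only: suminf_mult[OF summable_lommel] suminf_add[OF summable_mult[OF summable_lommel] summable_lommel, symmetric])
  also have "\<dots> = lommel_series a b w"
    unfolding lommel_series_def
  proof (intro suminf_cong)
    fix k
    define r s where "r = rGamma (2 - a + of_nat k)" and "s = rGamma (b - a + 2 + of_nat k)"
    have 1: "rGamma (2 - (a + 1) + of_nat k) = (1 - a + of_nat k) * r"
      using rGamma_plus1[of "1 - a + of_nat k"] by (simp add: r_def algebra_simps)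
    have 2: "rGamma (b - a + 1 + of_nat k) = (b - a + 1 + of_nat k) * s"
      using rGamma_plus1[of "b - a + 1 + of_nat k"] by (simp add: s_def algebra_simps)
    have 3: "rGamma (b + 1 - a + 1 + of_nat k) = s" "rGamma (b + 2 - (a + 1) + 1 + of_nat k) = s"
      by (simp_all add: s_def algebra_simps)
    show "b * (rGamma (2 - a + of_nat k) * rGamma (b + 1 - a + 1 + of_nat k) * w ^ k)
         + rGamma (2 - (a + 1) + of_nat k) * rGamma (b + 2 - (a + 1) + 1 + of_nat k) * w ^ k
       = rGamma (2 - a + of_nat k) * rGamma (b - a + 1 + of_nat k) * w ^ k"
      unfolding 1 2 3 r_def[symmetric] by (simp add: algebra_simps)
  qed
  finally show ?thesis by simp
qed

text \<open>The operator \<open>w d/dw\<close> multiplies the coefficient of index \<open>k\<close>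
  by \<open>k = (a - 1) + (1 - a + k)\<close>, and the last factor is absorbed by passing to
  \<open>a + 1\<close> and \<open>b + 1\<close>.\<close>

lemma DERIV_lommel_series:
  assumes w: "w \<noteq> 0"
  shows "(lommel_series a b has_field_derivative ((a - 1) * lommel_series a b w + lommel_series (a + 1) (b + 1) w) / w) (at w)"
proof -
  define q where "q = (\<lambda>k. rGamma (2 - a + of_nat k) * rGamma (b - a + 1 + of_nat k))"
  have d: "((\<lambda>w. \<Sum>k. q k * w ^ k) has_field_derivative (\<Sum>k. diffs q k * w ^ k)) (at w)"
    by (rule termdiffs_strong_converges_everywhere) (use summable_lommel in \<open>simp add: q_def\<close>)
  have "summable (\<lambda>k. diffs q k * w ^ k)"
    by (rule termdiff_converges_all) (use summable_lommel in \<open>simp add: q_def\<close>)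
  then have "(\<lambda>k. w * (diffs q k * w ^ k)) sums (w * (\<Sum>k. diffs q k * w ^ k))"
    by (intro sums_mult summable_sums)
  then have "(\<lambda>k. of_nat (Suc k) * q (Suc k) * w ^ Suc k) sums (w * (\<Sum>k. diffs q k * w ^ k))"
    by (simp add: diffs_def mult_ac)
  then have "(\<lambda>k. of_nat k * q k * w ^ k) sums (w * (\<Sum>k. diffs q k * w ^ k) + of_nat 0 * q 0 * w ^ 0)"
    by (rule sums_Suc)
  then have 1: "w * (\<Sum>k. diffs q k * w ^ k) = (\<Sum>k. of_nat k * q k * w ^ k)"
    by (simp add: sums_iff)
  have "(a - 1) * lommel_series a b w + lommel_series (a + 1) (b + 1) w
     = (\<Sum>k. (a - 1) * (rGamma (2 - a + of_nat k) * rGamma (b - a + 1 + of_nat k) * w ^ k)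
         + rGamma (2 - (a + 1) + of_nat k) * rGamma (b + 1 - (a + 1) + 1 + of_nat k) * w ^ k)"
    unfolding lommel_series_def
    by (simp only: suminf_mult[OF summable_lommel] suminf_add[OF summable_mult[OF summable_lommel] summable_lommel, symmetric])
  also have "\<dots> = (\<Sum>k. of_nat k * q k * w ^ k)"
  proof (intro suminf_cong)
    fix k
    define r where "r = rGamma (2 - a + of_nat k)"
    have 1: "rGamma (2 - (a + 1) + of_nat k) = (1 - a + of_nat k) * r"
      using rGamma_plus1[of "1 - a + of_nat k"] by (simp add: r_def algebra_simps)
    have 2: "b + 1 - (a + 1) + 1 + of_nat k = b - a + 1 + of_nat k" by simp
    show "(a - 1) * (rGamma (2 - a + of_nat k) * rGamma (b - a + 1 + of_nat k) * w ^ k)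
         + rGamma (2 - (a + 1) + of_nat k) * rGamma (b + 1 - (a + 1) + 1 + of_nat k) * w ^ k = of_nat k * q k * w ^ k"
      unfolding 1 2 q_def r_def[symmetric] by (simp add: algebra_simps)
  qed
  finally have "((a - 1) * lommel_series a b w + lommel_series (a + 1) (b + 1) w) / w = (\<Sum>k. diffs q k * w ^ k)"
    using 1 w by (simp add: field_simps)
  then show ?thesis using d by (simp add: lommel_series_def[abs_def] q_def)
qed

text \<open>The first part carries the singular behaviour \<open>w powr (a - 1)\<close> at the
  origin, the second is a power series in \<open>w\<close>. At integer \<open>a\<close> the
  prefactor is 0 by the convention for division, so the formula is meaningful for
  \<open>a \<notin> \<int>\<close> only.\<close>

definition Stieltjes_closed :: "complex \<Rightarrow> complex \<Rightarrow> complex \<Rightarrow> complex" where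
  "Stieltjes_closed a b w = of_real pi / sin (of_real pi * a) * (w powr (a - 1) * phi b (- w) - lommel_series a b w)"

lemma sin_pi_plus1: "sin (of_real pi * (a + 1)) = - sin (of_real pi * a :: complex)"
  by (simp add: distrib_left sin_add)

lemma sin_pi_nonzero: "a \<notin> \<int> \<Longrightarrow> sin (of_real pi * a :: complex) \<noteq> 0"
  unfolding sin_eq_0 by auto

lemma reflection_rGamma:
  fixes a :: complex
  assumes "a \<notin> \<int>"
  shows "of_real pi / sin (of_real pi * a) * rGamma (1 - a) = Gamma a"
proof -
  have "1 - a \<notin> \<int>\<^sub>\<le>\<^sub>0" using assms by (metis Ints_1 Ints_diff diff_diff_eq2 add_diff_cancel_left' nonpos_Ints_subset_Ints subsetD)
  then have "Gamma (1 - a) * rGamma (1 - a) = 1"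
    by (simp add: rGamma_inverse_Gamma Gamma_eq_zero_iff)
  then show ?thesis
    unfolding Gamma_reflection_complex[symmetric] by (simp add: mult.assoc)
qed

text \<open>The prefactor changes sign when \<open>a\<close> is raised by 1, which converts the
  signs of the relations for \<open>lommel_series\<close> into those for the transform. The
  reflection formula turns the new first coefficient into the Mellin value
  \<open>Gamma a * rGamma (b - a)\<close>. No real part is constrained, unlike for the
  integral.\<close>

lemma closed_shift_exponent:
  assumes a: "a \<notin> \<int>" and w: "w \<noteq> 0"
  shows "Stieltjes_closed (a + 1) b w = Gamma a * rGamma (b - a) - w * Stieltjes_closed a b w"
proof -
  have "w powr (a + 1 - 1) = w * w powr (a - 1)" using w by (simp add: powr_diff power2_eq_square)
  then show ?thesis
    unfolding Stieltjes_closed_def sin_pi_plus1 lommel_series_shift_exponent reflection_rGamma[OF a, symmetric]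
    by (simp add: algebra_simps diff_divide_distrib add_divide_distrib)
qed

lemma closed_shift_order:
  assumes w: "w \<noteq> 0"
  shows "Stieltjes_closed a b w = b * Stieltjes_closed a (b + 1) w - Stieltjes_closed (a + 1) (b + 2) w"
proof -
  have "w powr (a + 1 - 1) = w * w powr (a - 1)" using w by (simp add: powr_diff power2_eq_square)
  then show ?thesis
    unfolding Stieltjes_closed_def sin_pi_plus1
    by (subst lommel_series_shift_order[of a b], subst phi_recurrence[of b])
      (simp add: algebra_simps diff_divide_distrib add_divide_distrib)
qed

lemma DERIV_closed:
  assumes w: "w \<notin> \<real>\<^sub>\<le>\<^sub>0"
  shows "(Stieltjes_closed a b has_field_derivative
     ((a - 1) * Stieltjes_closed a b w - Stieltjes_closed (a + 1) (b + 1) w) / w) (at w)"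
proof -
  have w0: "w \<noteq> 0" using w by auto
  have p: "w powr (a - 1 - 1) = w powr (a - 1) / w" "w powr (a + 1 - 1) = w * w powr (a - 1)"
    using w0 by (simp_all add: powr_diff power2_eq_square)
  have "(Stieltjes_closed a b has_field_derivative of_real pi / sin (of_real pi * a) *
     (((a - 1) * w powr (a - 1 - 1)) * phi b (- w) + phi (b + 1) (- w) * w powr (a - 1)
       - ((a - 1) * lommel_series a b w + lommel_series (a + 1) (b + 1) w) / w)) (at w)"
    unfolding Stieltjes_closed_def
    by (rule derivative_eq_intros DERIV_lommel_series w0 w refl | simp add: w)+
  also have "of_real pi / sin (of_real pi * a) *
     (((a - 1) * w powr (a - 1 - 1)) * phi b (- w) + phi (b + 1) (- w) * w powr (a - 1)
       - ((a - 1) * lommel_series a b w + lommel_series (a + 1) (b + 1) w) / w)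
    = ((a - 1) * Stieltjes_closed a b w - Stieltjes_closed (a + 1) (b + 1) w) / w"
    unfolding Stieltjes_closed_def sin_pi_plus1 p using w0
    by (simp add: divide_simps) (simp add: algebra_simps)
  finally show ?thesis .
qed

text \<open>After scaling by \<open>t powr (1 - a)\<close> the power series is suppressed because
  \<open>Re a < 1\<close>; the limit is the one found for the transform, so the scaled difference
  vanishes at the origin.\<close>

lemma closed_at_0:
  assumes a: "Re a < 1"
  shows "((\<lambda>t. of_real t powr (1 - a) * Stieltjes_closed a b (of_real t)) \<longlongrightarrow> rGamma b * (of_real pi / sin (of_real pi * a))) (at_right 0)"
proof -
  have ls: "isCont (lommel_series a b) 0"
  proof -
    have "isCont (\<lambda>w. \<Sum>k. (rGamma (2 - a + of_nat k) * rGamma (b - a + 1 + of_nat k)) * w ^ k) 0"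
      by (rule isCont_powser_converges_everywhere) (rule summable_lommel)
    then show ?thesis by (simp add: lommel_series_def[abs_def])
  qed
  have t0: "((\<lambda>t. complex_of_real t) \<longlongrightarrow> 0) (at_right 0)"
    using tendsto_of_real[of "\<lambda>t. t" 0 "at_right (0::real)"] by simp
  have l: "((\<lambda>t. lommel_series a b (of_real t)) \<longlongrightarrow> lommel_series a b 0) (at_right 0)"
    by (rule isCont_tendsto_compose[OF ls t0])
  have p: "((\<lambda>t. phi b (- of_real t)) \<longlongrightarrow> phi b 0) (at_right 0)"
    using isCont_tendsto_compose[OF DERIV_isCont[OF has_field_derivative_phi] tendsto_minus[OF t0]] by simp
  have q: "((\<lambda>t. complex_of_real t powr (1 - a)) \<longlongrightarrow> 0) (at_right 0)"
  proof (rule Lim_null_comparison)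
    show "\<forall>\<^sub>F t in at_right 0. norm (complex_of_real t powr (1 - a)) \<le> t powr (1 - Re a)"
      by (auto simp: eventually_at_right_field norm_of_real_powr intro!: exI[of _ 1])
    show "((\<lambda>t. t powr (1 - Re a)) \<longlongrightarrow> 0) (at_right 0)" using a by real_asymp
  qed
  have "((\<lambda>t. of_real pi / sin (of_real pi * a) * (phi b (- of_real t) - of_real t powr (1 - a) * lommel_series a b (of_real t)))
     \<longlongrightarrow> of_real pi / sin (of_real pi * a) * (phi b 0 - 0 * lommel_series a b 0)) (at_right 0)"
    by (intro tendsto_mult_left tendsto_diff tendsto_mult p q l)
  moreover have "\<forall>\<^sub>F t in at_right 0. of_real pi / sin (of_real pi * a) * (phi b (- of_real t) - of_real t powr (1 - a) * lommel_series a b (of_real t))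
     = of_real t powr (1 - a) * Stieltjes_closed a b (of_real t)"
  proof -
    have "of_real pi / sin (of_real pi * a) * (phi b (- of_real t) - of_real t powr (1 - a) * lommel_series a b (of_real t))
     = of_real t powr (1 - a) * Stieltjes_closed a b (of_real t)" if "t > 0" for t
    proof -
      have "complex_of_real t powr (1 - a) * of_real t powr (a - 1) = 1"
        using that by (simp add: powr_add[symmetric])
      moreover have "of_real t powr (1 - a) * Stieltjes_closed a b (of_real t) = of_real pi / sin (of_real pi * a) *
          ((complex_of_real t powr (1 - a) * of_real t powr (a - 1)) * phi b (- of_real t) - of_real t powr (1 - a) * lommel_series a b (of_real t))"
        unfolding Stieltjes_closed_def by (simp only: right_diff_distrib mult_ac)
      ultimately show ?thesis by simp
    qed
    then show ?thesis by (auto simp: eventually_at_right_field intro!: exI[of _ 1])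
  qed
  ultimately show ?thesis by (simp add: Lim_transform_eventually mult.commute)
qed

section \<open>The Stieltjes transform equals the closed form\<close>

text \<open>In the difference of the two sides the Mellin term cancels, so the contiguity relations
  become homogeneous and close the derivative formulas for the orders \<open>b\<close> and
  \<open>b + 1\<close> into a first-order system. With \<open>Re a < 1\<close>, the bound
  \<open>Re b \<ge> 2\<close> secures every convergence condition on the way.\<close>

lemma Stieltjes_eq_closed_seed:
  assumes a: "0 < Re a" "Re a < 1" and b: "Re b \<ge> 2" and w: "w \<notin> \<real>\<^sub>\<le>\<^sub>0"
  shows "phi_Stieltjes a b w = Stieltjes_closed a b w"
proof -
  have aZ: "a \<notin> \<int>" using a by (auto elim!: Ints_cases)
  define X where "X = (\<lambda>w. phi_Stieltjes a b w - Stieltjes_closed a b w)"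
  define Y where "Y = (\<lambda>w. phi_Stieltjes a (b + 1) w - Stieltjes_closed a (b + 1) w)"
  \<comment> \<open>This factor removes the terms with \<open>a - 1\<close> and leaves
    \<open>x' = y\<close>, \<open>w y' = x - b y\<close>, the system solved by
    \<open>phi b (- w)\<close>. It is also the scaling under which both sides have finite limits at
    the origin.\<close>
  define x where "x = (\<lambda>w. w powr (1 - a) * X w)"
  define y where "y = (\<lambda>w. w powr (1 - a) * Y w)"
  have pos: "w \<notin> \<real>\<^sub>\<le>\<^sub>0" "w \<noteq> 0" if "Re w > 0" for w
    using that by (auto elim!: nonpos_Reals_cases)
  have s1: "phi_Stieltjes (a + 1) (b + 1) w - Stieltjes_closed (a + 1) (b + 1) w = - w * Y w"
    if "Re w > 0" for w
    using Stieltjes_shift_exponent[of w a "b + 1"] closed_shift_exponent[OF aZ, of w "b + 1"] pos[OF that] a b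
    by (simp add: Y_def algebra_simps)
  have s2: "phi_Stieltjes (a + 1) (b + 2) w - Stieltjes_closed (a + 1) (b + 2) w = b * Y w - X w"
    if "Re w > 0" for w
  proof -
    have "phi_Stieltjes (a + 1) (b + 2) w = b * phi_Stieltjes a (b + 1) w - phi_Stieltjes a b w"
      using Stieltjes_shift_order[of w a b] pos[OF that] a b by (simp add: algebra_simps)
    moreover have "Stieltjes_closed (a + 1) (b + 2) w = b * Stieltjes_closed a (b + 1) w - Stieltjes_closed a b w"
      using closed_shift_order[of w a b] pos[OF that] by (simp add: algebra_simps)
    ultimately show ?thesis unfolding X_def Y_def by (simp only:) (simp add: algebra_simps)
  qed
  have dX: "(X has_field_derivative ((a - 1) * X w + w * Y w) / w) (at w)" if "Re w > 0" for w
  proof -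
    have "(X has_field_derivative ((a - 1) * phi_Stieltjes a b w - phi_Stieltjes (a + 1) (b + 1) w) / w
       - ((a - 1) * Stieltjes_closed a b w - Stieltjes_closed (a + 1) (b + 1) w) / w) (at w)"
      unfolding X_def using a b by (intro DERIV_diff DERIV_Stieltjes DERIV_closed pos[OF that]) auto
    also have "((a - 1) * phi_Stieltjes a b w - phi_Stieltjes (a + 1) (b + 1) w) / w
       - ((a - 1) * Stieltjes_closed a b w - Stieltjes_closed (a + 1) (b + 1) w) / w
       = ((a - 1) * X w - (phi_Stieltjes (a + 1) (b + 1) w - Stieltjes_closed (a + 1) (b + 1) w)) / w"
      by (simp add: X_def diff_divide_distrib[symmetric] algebra_simps)
    finally show ?thesis unfolding s1[OF that] by simp
  qed
  have dY: "(Y has_field_derivative ((a - 1) * Y w - (b * Y w - X w)) / w) (at w)" if "Re w > 0" for w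
  proof -
    have 2: "b + 1 + 1 = b + 2" by simp
    have "(Y has_field_derivative ((a - 1) * phi_Stieltjes a (b + 1) w - phi_Stieltjes (a + 1) (b + 2) w) / w
       - ((a - 1) * Stieltjes_closed a (b + 1) w - Stieltjes_closed (a + 1) (b + 2) w) / w) (at w)"
      unfolding Y_def 2[symmetric] using a b by (intro DERIV_diff DERIV_Stieltjes DERIV_closed pos[OF that]) auto
    also have "((a - 1) * phi_Stieltjes a (b + 1) w - phi_Stieltjes (a + 1) (b + 2) w) / w
       - ((a - 1) * Stieltjes_closed a (b + 1) w - Stieltjes_closed (a + 1) (b + 2) w) / w
       = ((a - 1) * Y w - (phi_Stieltjes (a + 1) (b + 2) w - Stieltjes_closed (a + 1) (b + 2) w)) / w"
      by (simp add: Y_def diff_divide_distrib[symmetric] algebra_simps)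
    finally show ?thesis unfolding s2[OF that] .
  qed
  have dp: "((\<lambda>w. w powr (1 - a)) has_field_derivative (1 - a) * (w powr (1 - a) / w)) (at w)" if "Re w > 0" for w
    using has_field_derivative_powr[OF pos(1)[OF that], of "1 - a"] powr_diff[of w "1 - a" 1] pos(2)[OF that] by simp
  have dx: "(x has_field_derivative y w) (at w)" if "Re w > 0" for w
  proof -
    have "(x has_field_derivative (1 - a) * (w powr (1 - a) / w) * X w + ((a - 1) * X w + w * Y w) / w * w powr (1 - a)) (at w)"
      unfolding x_def by (intro DERIV_mult dp dX that)
    also have "(1 - a) * (w powr (1 - a) / w) * X w + ((a - 1) * X w + w * Y w) / w * w powr (1 - a) = y w"
      unfolding y_def using pos[OF that] by (simp add: divide_simps) (simp add: algebra_simps)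
    finally show ?thesis .
  qed
  have dy: "(y has_field_derivative (x w - b * y w) / w) (at w)" if "Re w > 0" for w
  proof -
    have "(y has_field_derivative (1 - a) * (w powr (1 - a) / w) * Y w + ((a - 1) * Y w - (b * Y w - X w)) / w * w powr (1 - a)) (at w)"
      unfolding y_def by (intro DERIV_mult dp dY that)
    also have "(1 - a) * (w powr (1 - a) / w) * Y w + ((a - 1) * Y w - (b * Y w - X w)) / w * w powr (1 - a) = (x w - b * y w) / w"
      unfolding x_def y_def using pos[OF that] by (simp add: divide_simps) (simp add: algebra_simps)
    finally show ?thesis .
  qed
  have x0: "((\<lambda>t. x (of_real t)) \<longlongrightarrow> 0) (at_right 0)"
    using tendsto_diff[OF Stieltjes_at_0[of a b] closed_at_0[of a b]] a b
    by (simp add: x_def X_def right_diff_distrib)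
  have y0: "((\<lambda>t. y (of_real t)) \<longlongrightarrow> 0) (at_right 0)"
    using tendsto_diff[OF Stieltjes_at_0[of a "b + 1"] closed_at_0[of a "b + 1"]] a b
    by (simp add: y_def Y_def right_diff_distrib)
  obtain \<epsilon> where \<epsilon>: "\<epsilon> > 0" "\<And>w. Re w > 0 \<Longrightarrow> norm w < \<epsilon> \<Longrightarrow> x w = 0"
    using Bessel_system_zero[OF _ dx dy x0 y0] b by auto
  have near: "phi_Stieltjes a b v = Stieltjes_closed a b v" if "v \<in> {w. Re w > 0} \<inter> ball 0 \<epsilon>" for v
    using \<epsilon>(2)[of v] that pos[of v] by (auto simp: x_def X_def)
  have sl: "(\<real>\<^sub>\<le>\<^sub>0 :: complex set) = complex_of_real ` {..0}"
    by (auto elim!: nonpos_Reals_cases)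
  show ?thesis
  \<comment> \<open>The vanishing of \<open>x\<close> is known only on a half-disc at the origin;
    both sides are holomorphic on the connected slit plane, and the identity theorem does the
    rest.\<close>
  proof (rule analytic_continuation_open[where f = "phi_Stieltjes a b" and g = "Stieltjes_closed a b" and s = "{w. Re w > 0} \<inter> ball 0 \<epsilon>" and s' = "- \<real>\<^sub>\<le>\<^sub>0"])
    show "open ({w. Re w > 0} \<inter> ball 0 \<epsilon>)" by (intro open_Int open_halfspace_Re_gt open_ball)
    show "open (- \<real>\<^sub>\<le>\<^sub>0 :: complex set)" by (intro open_Compl closed_nonpos_Reals_complex)
    have "complex_of_real (\<epsilon> / 2) \<in> {w. Re w > 0} \<inter> ball 0 \<epsilon>" using \<epsilon>(1) by (simp add: norm_divide)
    then show "{w. Re w > 0} \<inter> ball 0 \<epsilon> \<noteq> {}" by blast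
    show "connected (- \<real>\<^sub>\<le>\<^sub>0 :: complex set)"
      unfolding sl by (intro starlike_imp_connected starlike_slotted_complex_plane_left)
    show "{w. Re w > 0} \<inter> ball 0 \<epsilon> \<subseteq> - \<real>\<^sub>\<le>\<^sub>0" using pos by auto
    show "phi_Stieltjes a b holomorphic_on (- \<real>\<^sub>\<le>\<^sub>0)"
      using a b by (intro holomorphic_Stieltjes) auto
    show "Stieltjes_closed a b holomorphic_on (- \<real>\<^sub>\<le>\<^sub>0)"
      by (subst holomorphic_on_open) (auto intro: DERIV_closed open_Compl)
  qed (use near w in auto)
qed

text \<open>Downward induction on \<open>Re b\<close>, with \<open>n\<close> counting unit steps
  below 2. The order relation involves \<open>(a, b + 1)\<close> and \<open>(a + 1, b + 2)\<close>;
  the latter is brought back to \<open>(a, b + 2)\<close>, and the Mellin condition for that step is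
  exactly the assumed \<open>2 * Re a < Re b + 3/2\<close>.\<close>

lemma Stieltjes_eq_closed_strip:
  assumes a: "0 < Re a" "Re a < 1" and b: "2 * Re a < Re b + 3/2" and w: "w \<notin> \<real>\<^sub>\<le>\<^sub>0"
  shows "phi_Stieltjes a b w = Stieltjes_closed a b w"
proof -
  have aZ: "a \<notin> \<int>" using a by (auto elim!: Ints_cases)
  have w0: "w \<noteq> 0" using w by auto
  have "phi_Stieltjes a b w = Stieltjes_closed a b w" if "2 * Re a < Re b + 3/2" "Re b \<ge> 2 - real n" for n b
    using that
  proof (induction n arbitrary: b)
    case 0
    then show ?case using a w by (intro Stieltjes_eq_closed_seed) auto
  next
    case (Suc n)
    have 1: "phi_Stieltjes a (b + 1) w = Stieltjes_closed a (b + 1) w"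
      and 2: "phi_Stieltjes a (b + 2) w = Stieltjes_closed a (b + 2) w"
      using Suc.prems by (auto intro!: Suc.IH)
    show ?case
      using Stieltjes_shift_order[OF w a(1) Suc.prems(1)] closed_shift_order[OF w0, of a b]
        Stieltjes_shift_exponent[OF w a(1), of "b + 2"] closed_shift_exponent[OF aZ w0, of "b + 2"] Suc.prems(1)
      by (simp add: 1 2)
  qed
  from this[of b "nat \<lceil>2 - Re b\<rceil>"] b show ?thesis by linarith
qed

text \<open>Induction on the integer part of \<open>Re a\<close>. The Mellin condition for
  \<open>(a - 1, b)\<close> is again precisely the convergence condition for \<open>(a, b)\<close>.
  Integer real parts are excluded since descending from them leads to \<open>Re a = 0\<close>,
  outside the domain of the transform.\<close>

lemma Stieltjes_eq_closed_noninteger_Re: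
  assumes a: "real n < Re a" "Re a < real n + 1" and b: "2 * Re a < Re b + 3/2" and w: "w \<notin> \<real>\<^sub>\<le>\<^sub>0"
  shows "phi_Stieltjes a b w = Stieltjes_closed a b w"
  using a b
proof (induction n arbitrary: a)
  case 0
  then show ?case by (intro Stieltjes_eq_closed_strip w) auto
next
  case (Suc n)
  have w0: "w \<noteq> 0" using w by auto
  have aZ: "a - 1 \<notin> \<int>"
  proof
    assume "a - 1 \<in> \<int>"
    then obtain k where "a - 1 = of_int k" by (rule Ints_cases)
    then have "Re a = of_int k + 1" by (metis Re_complex_of_real complex_Re_of_int diff_add_cancel one_complex.sel(1) plus_complex.sel(1))
    with Suc.prems have "int n < k" "k < int n + 1" by linarith+
    then show False by linarith
  qed
  have IH: "phi_Stieltjes (a - 1) b w = Stieltjes_closed (a - 1) b w"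
    using Suc.prems by (intro Suc.IH) auto
  have "phi_Stieltjes (a - 1 + 1) b w = Stieltjes_closed (a - 1 + 1) b w"
    using Suc.prems unfolding closed_shift_exponent[OF aZ w0] IH[symmetric]
    by (intro Stieltjes_shift_exponent w) auto
  then show ?case by simp
qed

section \<open>Continuity in the exponent and the exceptional vertical lines\<close>

lemma tendsto_Stieltjes_exponent:
  assumes a0: "Re a0 > 0" and b: "2 * Re a0 < Re b + 3/2" and w: "w \<notin> \<real>\<^sub>\<le>\<^sub>0"
  shows "((\<lambda>a. phi_Stieltjes a b w) \<longlongrightarrow> phi_Stieltjes a0 b w) (at a0)"
proof -
  \<comment> \<open>Half the smaller distance from \<open>Re a0\<close> to the ends of the interval
    of convergence. The integrands at \<open>a0 - \<delta>\<close> and \<open>a0 + \<delta>\<close>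
    are then integrable and dominate all nearby ones, the former on \<open>x \<le> 1\<close> and the
    latter beyond.\<close>
  define \<delta> where "\<delta> = min (Re a0) (Re b / 2 + 3/4 - Re a0) / 2"
  have \<delta>: "\<delta> > 0" "\<delta> < Re a0" "\<delta> < Re b / 2 + 3/4 - Re a0"
    using a0 b by (auto simp: \<delta>_def min_def field_simps)
  define F where "F = (\<lambda>a x. complex_of_real x powr (a - 1) * phi b (of_real x) * inverse (of_real x + w))"
  define g where "g = (\<lambda>x. norm (F (a0 - of_real \<delta>) x) + norm (F (a0 + of_real \<delta>) x))"
  have Fm: "F a \<in> borel_measurable halfline" for a
    unfolding F_def by (intro borel_measurable_times measurable_halfline_powr measurable_halfline_phi measurable_halfline_kernel w)
  have "((\<lambda>a. integral\<^sup>L halfline (F a)) \<longlongrightarrow> integral\<^sup>L halfline (F a0)) (at a0)"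
  proof (rule integral_dominated_convergence_at[where g = g])
    show "F a0 \<in> borel_measurable halfline" by (rule Fm)
    show "integrable halfline g"
      unfolding g_def F_def using \<delta>
      by (intro Bochner_Integration.integrable_add integrable_norm integrable_Stieltjes w) auto
    have "norm (F a x) \<le> g x" if x: "x > 0" and a: "dist a a0 < \<delta>" for a x
    proof -
      have "\<bar>Re a - Re a0\<bar> < \<delta>" using abs_Re_le_cmod[of "a - a0"] a by (simp add: dist_norm)
      then have r: "Re a0 - \<delta> \<le> Re a" "Re a \<le> Re a0 + \<delta>" by auto
      have "x powr (Re a - 1) \<le> x powr (Re a0 - \<delta> - 1) + x powr (Re a0 + \<delta> - 1)"
      proof (cases "x \<le> 1")
        case True
        then have "x powr (Re a - 1) \<le> x powr (Re a0 - \<delta> - 1)" using r x by (intro powr_mono') auto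
        then show ?thesis by (simp add: add_increasing2)
      next
        case False
        then have "x powr (Re a - 1) \<le> x powr (Re a0 + \<delta> - 1)" using r by (intro powr_mono) auto
        then show ?thesis by (simp add: add_increasing)
      qed
      then have "x powr (Re a - 1) * norm (phi b (of_real x) * inverse (of_real x + w))
        \<le> (x powr (Re a0 - \<delta> - 1) + x powr (Re a0 + \<delta> - 1)) * norm (phi b (of_real x) * inverse (of_real x + w))"
        by (intro mult_right_mono) auto
      then show ?thesis
        using x by (simp add: F_def g_def norm_mult norm_of_real_powr algebra_simps)
    qed
    then show "\<forall>\<^sub>F a in at a0. F a \<in> borel_measurable halfline \<and> (\<forall>x\<in>space halfline. norm (F a x) \<le> g x)"
      using \<delta>(1) Fm by (auto simp: eventually_at space_halfline intro!: exI[of _ \<delta>])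
    show "((\<lambda>a. F a x) \<longlongrightarrow> F a0 x) (at a0)" if "x \<in> space halfline" for x
      unfolding F_def using that by (intro tendsto_intros) (auto simp: space_halfline)
  qed
  then show ?thesis by (simp add: F_def phi_Stieltjes_def)
qed

lemma tendsto_closed_exponent:
  assumes a0: "a0 \<notin> \<int>" and w: "w \<notin> \<real>\<^sub>\<le>\<^sub>0"
  shows "((\<lambda>a. Stieltjes_closed a b w) \<longlongrightarrow> Stieltjes_closed a0 b w) (at a0)"
  unfolding Stieltjes_closed_def
  by (intro tendsto_intros tendsto_lommel_series sin_pi_nonzero a0 disjI1[OF w])

lemma Stieltjes_eq_closed:
  assumes a: "Re a > 0" "a \<notin> \<int>" and b: "2 * Re a < Re b + 3/2" and w: "w \<notin> \<real>\<^sub>\<le>\<^sub>0"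
  shows "phi_Stieltjes a b w = Stieltjes_closed a b w"
proof (cases "Re a \<in> \<int>")
  case False
  then have "Re a \<noteq> real (nat \<lfloor>Re a\<rfloor>)" by (metis Ints_of_nat)
  then show ?thesis
    using a by (intro Stieltjes_eq_closed_noninteger_Re[of "nat \<lfloor>Re a\<rfloor>"] b w) linarith+
next
  case True
  then obtain k where k: "Re a = of_int k" by (auto elim: Ints_cases)
  \<comment> \<open>The offset 2 keeps the increment strictly between 0 and 1, so
    \<open>Re (s n)\<close> lies in the open strip to the right of the integer
    \<open>Re a\<close>.\<close>
  define s where "s = (\<lambda>n. a + of_real (1 / real (n + 2)))"
  have "(\<lambda>n. complex_of_real (1 / real (n + 2))) \<longlonglongrightarrow> of_real 0"
    by (intro tendsto_of_real) real_asymp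
  then have "s \<longlonglongrightarrow> a + of_real 0" unfolding s_def by (rule tendsto_add[OF tendsto_const])
  moreover have "s n \<noteq> a" for n
  proof -
    have "complex_of_real (1 / real (n + 2)) \<noteq> 0" by (simp only: of_real_eq_0_iff) simp
    then show ?thesis by (simp add: s_def)
  qed
  ultimately have s: "filterlim s (at a) sequentially"
    by (simp add: filterlim_at)
  have 1: "(\<lambda>n. phi_Stieltjes (s n) b w) \<longlonglongrightarrow> phi_Stieltjes a b w"
    by (rule filterlim_compose[OF tendsto_Stieltjes_exponent[OF a(1) b w] s])
  have 2: "(\<lambda>n. Stieltjes_closed (s n) b w) \<longlonglongrightarrow> Stieltjes_closed a b w"
    by (rule filterlim_compose[OF tendsto_closed_exponent[OF a(2) w] s])
  have 3: "\<forall>\<^sub>F n in sequentially. phi_Stieltjes (s n) b w = Stieltjes_closed (s n) b w"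
  proof -
    have "(\<lambda>n. Re (s n)) \<longlonglongrightarrow> Re a" using s by (intro tendsto_Re) (auto simp: filterlim_at)
    then have "\<forall>\<^sub>F n in sequentially. Re (s n) < (Re b + 3/2) / 2"
      using b by (intro order_tendstoD) auto
    then show ?thesis
    proof eventually_elim
      case (elim n)
      have r: "Re (s n) = of_int k + 1 / real (n + 2)" by (simp add: s_def k)
      have k0: "k > 0" using a(1) k by simp
      have "1 / real (n + 2) > 0" "1 / real (n + 2) < 1" by auto
      then show ?case using elim r k0
        by (intro Stieltjes_eq_closed_noninteger_Re[of "nat k"] w) auto
    qed
  qed
  show ?thesis
    by (rule LIMSEQ_unique[OF Lim_transform_eventually[OF 1 3] 2])
qed

text \<open>The power of \<open>- w\<close> is factored out in front so that the bracket contains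
  the unshifted closed form; the sum then consists of the asymptotic terms, up to
  normalisation.\<close>

lemma closed_shift_exponent_iterate:
  assumes a: "a \<notin> \<int>" and w: "w \<noteq> 0"
  shows "Stieltjes_closed (a + of_nat N) b w =
    (-w) ^ N * (Stieltjes_closed a b w + (\<Sum>j<N. Gamma (a + of_nat j) * rGamma (b - a - of_nat j) / (- w) ^ Suc j))"
proof (induction N)
  case (Suc N)
  have aN: "a + of_nat N \<notin> \<int>" using a by (metis Ints_diff Ints_of_nat add_diff_cancel_right')
  have "Stieltjes_closed (a + of_nat (Suc N)) b w = Stieltjes_closed (a + of_nat N + 1) b w" by (simp add: add_ac)
  also have "\<dots> = Gamma (a + of_nat N) * rGamma (b - (a + of_nat N)) - w * Stieltjes_closed (a + of_nat N) b w"
    by (rule closed_shift_exponent[OF aN w])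
  also have "\<dots> = (-w) ^ Suc N * (Stieltjes_closed a b w + (\<Sum>j<Suc N. Gamma (a + of_nat j) * rGamma (b - a - of_nat j) / (- w) ^ Suc j))"
  proof -
    have nz: "(- w) ^ Suc N \<noteq> 0" using w by simp
    show ?thesis
      unfolding Suc.IH sum.lessThan_Suc add.assoc[symmetric] distrib_left[of "(- w) ^ Suc N" _ "_ / _"]
        nonzero_mult_div_cancel_left[OF nz] times_divide_eq_right diff_diff_add
      by (simp add: algebra_simps)
  qed
  finally show ?case .
qed simp

section \<open>Bessel functions in terms of \<open>phi\<close>\<close>

lemma besselJ_eq_phi: "besselJ \<nu> z = (z / 2) powr \<nu> * phi (\<nu> + 1) ((z / 2)\<^sup>2)"
  unfolding besselJ_def phi_def by (simp add: power_mult[symmetric] mult_ac add_ac)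

lemma besselI_eq_phi: "besselI \<nu> z = (z / 2) powr \<nu> * phi (\<nu> + 1) (- (z / 2)\<^sup>2)"
proof -
  have "(-1) ^ k * rGamma (\<nu> + 1 + of_nat k) / fact k * (- (z / 2)\<^sup>2) ^ k =
    (z / 2) ^ (2 * k) * rGamma (of_nat k + \<nu> + 1) / fact k" for k
    by (simp add: power_minus[of "(z / 2)\<^sup>2"] power_mult[symmetric] power_mult_distrib[symmetric] add_ac)
  then show ?thesis unfolding besselI_def phi_def by simp
qed

section \<open>Differentiability in the order and the limits at integer orders\<close>

lemma holomorphic_phi_order: "(\<lambda>b. phi b x) holomorphic_on UNIV"
proof (rule holomorphic_uniform_sequence)
  show "(\<lambda>b. \<Sum>k<n. (-1) ^ k * rGamma (b + of_nat k) / fact k * x ^ k) holomorphic_on UNIV" for n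
    by (intro holomorphic_intros) auto
next
  fix b0 :: complex
  obtain C where C: "C > 0" "\<And>c k. c \<in> cball b0 1 \<Longrightarrow> norm (rGamma (c + of_nat k)) \<le> C * 2 ^ k / fact k"
    using rGamma_shift_bound[of b0] by metis
  have "uniform_limit (cball b0 1) (\<lambda>n b. \<Sum>k<n. (-1) ^ k * rGamma (b + of_nat k) / fact k * x ^ k) (\<lambda>b. phi b x) sequentially"
    unfolding phi_def
  proof (rule Weierstrass_m_test)
    fix k b assume b: "b \<in> cball b0 1"
    have "norm (rGamma (b + of_nat k)) \<le> C * 2 ^ k / fact k" using C(2)[OF b] .
    also have "\<dots> \<le> C * 2 ^ k / 1" using C(1) by (intro divide_left_mono) auto
    finally have "norm (rGamma (b + of_nat k)) * norm x ^ k \<le> C * 2 ^ k / 1 * norm x ^ k"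
      by (intro mult_right_mono) auto
    then show "norm ((-1) ^ k * rGamma (b + of_nat k) / fact k * x ^ k) \<le> C * (2 * norm x) ^ k / fact k"
      by (simp add: norm_mult norm_divide norm_power power_mult_distrib divide_simps mult_ac)
  qed (rule summable_exp_real)
  then show "\<exists>d>0. cball b0 d \<subseteq> UNIV \<and> uniform_limit (cball b0 d) (\<lambda>n b. \<Sum>k<n. (-1) ^ k * rGamma (b + of_nat k) / fact k * x ^ k) (\<lambda>b. phi b x) sequentially"
    by (intro exI[of _ 1]) auto
qed auto

lemma phi_order_differentiable: "(\<lambda>b. phi b x) field_differentiable (at b)"
  using holomorphic_phi_order by (auto simp: holomorphic_on_def)

lemma besselI_order_differentiable:
  assumes "z \<noteq> 0"
  shows "(\<lambda>m. besselI m z) field_differentiable (at \<nu>)" "(\<lambda>m. besselI (- m) z) field_differentiable (at \<nu>)"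
proof -
  have 1: "(\<lambda>m. besselI m z) field_differentiable (at \<nu>)" for \<nu>
  proof -
    have "(\<lambda>m. phi (m + 1) (- (z / 2)\<^sup>2)) field_differentiable (at \<nu>)"
      using field_differentiable_compose[of "\<lambda>m. m + 1" \<nu> "\<lambda>b. phi b (- (z / 2)\<^sup>2)"]
      by (simp add: o_def phi_order_differentiable field_differentiable_add field_differentiable_ident field_differentiable_const)
    moreover have "(\<lambda>m. exp (m * Ln (z / 2))) field_differentiable (at \<nu>)"
      by (auto simp: field_differentiable_def intro!: exI derivative_eq_intros)
    then have "(\<lambda>m. (z / 2) powr m) field_differentiable (at \<nu>)"
      using assms by (simp add: powr_def)
    ultimately show ?thesis
      unfolding besselI_eq_phi by (intro field_differentiable_mult)
  qed
  show "(\<lambda>m. besselI m z) field_differentiable (at \<nu>)" by (rule 1)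
  show "(\<lambda>m. besselI (- m) z) field_differentiable (at \<nu>)"
    using field_differentiable_compose[of uminus \<nu> "\<lambda>m. besselI m z"] 1
    by (simp add: o_def field_differentiable_minus field_differentiable_ident)
qed

text \<open>The symmetry between the Bessel functions of orders \<open>n\<close> and
  \<open>- n\<close>, obtained by running the recurrence from both sides. It makes the numerator in
  the definition of \<open>besselK\<close> vanish at integer orders.\<close>

lemma phi_reflect: "phi (1 - of_nat n) x = (- x) ^ n * phi (1 + of_nat n) x"
proof (induction n rule: induct_nat_012)
  case 1
  show ?case using phi_recurrence[of 0 x] by simp
next
  case (ge2 n)
  have "phi (1 - of_nat (Suc (Suc n))) x = (1 - of_nat (Suc (Suc n))) * phi (1 - of_nat (Suc n)) x - x * phi (1 - of_nat n) x"
    using phi_recurrence[of "1 - of_nat (Suc (Suc n))" x] by (simp add: algebra_simps)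
  also have "\<dots> = (- x) ^ Suc n * (phi (1 + of_nat n) x - (of_nat n + 1) * phi (1 + of_nat (Suc n)) x)"
    unfolding ge2 by (simp add: algebra_simps)
  also have "phi (1 + of_nat n) x = (1 + of_nat n) * phi (1 + of_nat (Suc n)) x - x * phi (1 + of_nat (Suc (Suc n))) x"
    using phi_recurrence[of "1 + of_nat n" x] by (simp add: add_ac)
  finally show ?case by (simp add: algebra_simps)
qed simp

lemma besselI_neg_of_nat:
  assumes "z \<noteq> 0"
  shows "besselI (- of_nat n) z = besselI (of_nat n) z"
proof -
  have "phi (- of_nat n + 1) (- (z / 2)\<^sup>2) = ((z / 2) ^ n * (z / 2) ^ n) * phi (of_nat n + 1) (- (z / 2)\<^sup>2)"
    using phi_reflect[of n "- (z / 2)\<^sup>2"] by (simp add: add.commute power_mult_distrib[symmetric] power2_eq_square)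
  moreover have "(z / 2) powr (- of_nat n) = inverse ((z / 2) ^ n)" "(z / 2) powr of_nat n = (z / 2) ^ n"
    using assms by (simp_all add: powr_minus powr_nat')
  ultimately show ?thesis
    unfolding besselI_eq_phi using assms by (simp add: mult.assoc[symmetric])
qed

lemma besselI_neg_of_int:
  assumes "z \<noteq> 0"
  shows "besselI (- of_int n) z = besselI (of_int n) z"
  using besselI_neg_of_nat[OF assms] by (cases n rule: int_cases2) auto

text \<open>A value given by \<open>Lim\<close> is informative only once the limit exists, and
  existence is the content here: by continuity at non-integer orders, by l'Hospital's rule at
  integers, where numerator and denominator both vanish and the zero of the sine is simple.\<close>

lemma besselK_tendsto:
  assumes z: "z \<noteq> 0"
  shows "((\<lambda>m. of_real pi / 2 * (besselI (-m) z - besselI m z) / sin (m * of_real pi)) \<longlongrightarrow> besselK \<nu> z) (at \<nu>)"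
proof -
  define f where "f = (\<lambda>m. of_real pi / 2 * (besselI (-m) z - besselI m z))"
  define g where "g = (\<lambda>m::complex. sin (m * of_real pi))"
  have df: "f field_differentiable (at m)" for m
    unfolding f_def by (intro field_differentiable_mult field_differentiable_diff field_differentiable_const besselI_order_differentiable z)
  then obtain f' where f': "(f has_field_derivative f') (at \<nu>)" by (auto simp: field_differentiable_def)
  have g': "(g has_field_derivative cos (\<nu> * of_real pi) * of_real pi) (at \<nu>)"
    unfolding g_def by (auto intro!: derivative_eq_intros)
  have "\<exists>l. ((\<lambda>m. f m / g m) \<longlongrightarrow> l) (at \<nu>)"
  proof (cases "g \<nu> = 0")
    case False
    then show ?thesis
      using DERIV_isCont[OF f'] DERIV_isCont[OF g'] by (auto simp: isCont_def intro!: exI tendsto_divide)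
  next
    case True
    then obtain n where n: "\<nu> = of_int n" by (auto simp: g_def sin_eq_0)
    have f0: "f \<nu> = 0" using besselI_neg_of_int[OF z, of n] by (simp add: f_def n)
    have c: "cos (\<nu> * of_real pi) \<noteq> 0" using True sin_cos_squared_add[of "\<nu> * of_real pi"] by (auto simp: g_def)
    have "((\<lambda>m. (f m - f \<nu>) / (m - \<nu>)) \<longlongrightarrow> f') (at \<nu>)" using f' by (simp add: has_field_derivative_iff)
    moreover have "((\<lambda>m. (g m - g \<nu>) / (m - \<nu>)) \<longlongrightarrow> cos (\<nu> * of_real pi) * of_real pi) (at \<nu>)"
      using g' by (simp add: has_field_derivative_iff)
    ultimately have "((\<lambda>m. ((f m - f \<nu>) / (m - \<nu>)) / ((g m - g \<nu>) / (m - \<nu>))) \<longlongrightarrow> f' / (cos (\<nu> * of_real pi) * of_real pi)) (at \<nu>)"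
      using c by (intro tendsto_divide) auto
    moreover have "\<forall>\<^sub>F m in at \<nu>. ((f m - f \<nu>) / (m - \<nu>)) / ((g m - g \<nu>) / (m - \<nu>)) = f m / g m"
      using eventually_neq_at_within[of \<nu>] by eventually_elim (simp add: f0 True)
    ultimately show ?thesis by (intro exI) (rule Lim_transform_eventually)
  qed
  then obtain l where l: "((\<lambda>m. f m / g m) \<longlongrightarrow> l) (at \<nu>)" by blast
  then have "besselK \<nu> z = l"
    unfolding besselK_def f_def g_def by (intro tendsto_Lim) auto
  with l show ?thesis by (simp add: f_def g_def)
qed

lemma eventually_at_not_Ints: "\<forall>\<^sub>F m in at (a::complex). m \<notin> \<int>"
proof -
  have "\<not> a islimpt \<int>"
  proof (rule discrete_imp_not_islimpt[of 1])
    fix x y :: complex assume "x \<in> \<int>" "y \<in> \<int>" "dist y x < 1"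
    then show "y = x"
      by (auto elim!: Ints_cases simp: dist_of_int)
  qed simp
  then show ?thesis by (simp add: islimpt_iff_eventually)
qed

text \<open>Both choices of sign at once: \<open>s = 1\<close> is the upper and
  \<open>s = -1\<close> the lower half-plane. The rotated point \<open>\<zeta>\<close> lies in the
  open right half-plane and \<open>w = (\<zeta> / 2)^2\<close>, so that logarithms of
  \<open>z\<close>, \<open>\<zeta>\<close> and \<open>w\<close> can be compared without leaving the
  principal branch.\<close>

locale upper_lower_plane =
  fixes z :: complex and s :: real
  assumes s: "s = 1 \<or> s = -1" and arg: "0 < s * Arg z" "s * Arg z < pi"
begin

definition \<zeta> :: complex where "\<zeta> = z * exp (- of_real s * of_real pi / 2 * \<i>)"
definition w :: complex where "w = - (z / 2)\<^sup>2"

lemma z_nonzero: "z \<noteq> 0"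
  using arg by (auto simp: Arg_zero)

lemma Im_Ln_bounds: "0 < s * Im (Ln z)" "s * Im (Ln z) < pi"
  using arg z_nonzero by (simp_all add: Arg_eq_Im_Ln)

lemma Ln_z_half: "Ln (z / 2) = Ln z - Ln 2"
  using Ln_divide_of_real[of 2 z] Ln_of_real[of 2] z_nonzero by simp

lemma Ln_zeta_half: "Ln (\<zeta> / 2) = Ln z - Ln 2 - of_real s * of_real pi / 2 * \<i>"
proof -
  define C where "C = of_real s * of_real pi / 2 * \<i>"
  have z: "\<zeta> = z * exp (- C)" by (simp add: \<zeta>_def C_def)
  have "exp (Ln z - Ln 2 - C) = \<zeta> / 2"
    unfolding z exp_diff exp_minus using z_nonzero by (simp add: field_simps)
  moreover have "Ln (2::complex) = of_real (ln 2)" using Ln_of_real[of 2] by simp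
  then have "Im (Ln z - Ln 2 - C) = Im (Ln z) - s * pi / 2" by (simp add: C_def)
  then have "-pi < Im (Ln z - Ln 2 - C)" "Im (Ln z - Ln 2 - C) \<le> pi" using s Im_Ln_bounds by auto
  then have "Ln (exp (Ln z - Ln 2 - C)) = Ln z - Ln 2 - C" by (rule Ln_exp)
  ultimately show ?thesis unfolding C_def by (simp only:)
qed

lemma zeta_nonzero: "\<zeta> \<noteq> 0"
  using z_nonzero by (simp add: \<zeta>_def)

lemma exp_sign_pi: "exp (of_real s * of_real pi * \<i>) = -1"
  using s exp_pi_i by (auto simp: exp_minus mult.commute)

lemma zeta_half_power2: "(\<zeta> / 2)\<^sup>2 = w"
proof -
  have "(exp (- of_real s * of_real pi / 2 * \<i>))\<^sup>2 = exp (- (of_real s * of_real pi * \<i>))"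
    by (simp add: power2_eq_square mult_exp_exp field_simps)
  also have "\<dots> = -1" unfolding exp_minus exp_sign_pi by simp
  finally show ?thesis by (simp add: \<zeta>_def w_def power_divide power_mult_distrib)
qed

lemma w_nonzero: "w \<noteq> 0"
  using z_nonzero by (simp add: w_def)

lemma Ln_w: "Ln w = 2 * Ln z - 2 * Ln 2 - of_real s * of_real pi * \<i>"
proof -
  define D where "D = 2 * Ln z - 2 * Ln 2 - of_real s * of_real pi * \<i>"
  have "D = 2 * Ln (\<zeta> / 2)" by (simp add: Ln_zeta_half D_def)
  then have "exp D = (exp (Ln (\<zeta> / 2)))\<^sup>2" by (simp add: exp_double)
  also have "\<dots> = w" using zeta_nonzero by (simp add: zeta_half_power2)
  finally have e: "exp D = w" .
  have "Ln (2::complex) = of_real (ln 2)" using Ln_of_real[of 2] by simp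
  then have "Im D = 2 * Im (Ln z) - s * pi" by (simp add: D_def)
  then have "-pi < Im D" "Im D \<le> pi" using s Im_Ln_bounds by auto
  then have "Ln (exp D) = D" by (rule Ln_exp)
  then show ?thesis unfolding e unfolding D_def .
qed

text \<open>On the slit \<open>Im (Ln w) = pi\<close>, which would put \<open>Im (Ln z)\<close> at
  \<open>pi\<close> for \<open>s = 1\<close> or at 0 for \<open>s = -1\<close>; the strict bounds on
  the argument of \<open>z\<close> exclude both.\<close>

lemma w_slit: "w \<notin> \<real>\<^sub>\<le>\<^sub>0"
proof
  assume "w \<in> \<real>\<^sub>\<le>\<^sub>0"
  then have "Re w < 0" "Im w = 0" using w_nonzero by (auto elim!: nonpos_Reals_cases)
  then have "Im (Ln w) = pi" using Im_Ln_eq_pi[OF w_nonzero] by simp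
  moreover have "Ln (2::complex) = of_real (ln 2)" using Ln_of_real[of 2] by simp
  then have "Im (Ln w) = 2 * Im (Ln z) - s * pi" by (simp add: Ln_w)
  ultimately show False using s Im_Ln_bounds by auto
qed

lemma besselJ_eq_besselI: "besselJ m z = exp (of_real s * of_real pi / 2 * \<i> * m) * besselI m \<zeta>"
proof -
  have "(z / 2) powr m = exp (of_real s * of_real pi / 2 * \<i> * m) * (\<zeta> / 2) powr m"
    using z_nonzero zeta_nonzero by (simp add: powr_def Ln_zeta_half Ln_z_half mult_exp_exp algebra_simps)
  then show ?thesis
    unfolding besselJ_eq_phi besselI_eq_phi zeta_half_power2 by (simp add: w_def)
qed

text \<open>The \<open>besselK\<close> term is a multiple of the Hankel function of the first kind
  for \<open>s = 1\<close> and of the second kind for \<open>s = -1\<close>. The identity is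
  verified at non-integer orders, and passing to the limit also shows that the limit defining
  \<open>besselY\<close> exists.\<close>

lemma besselY_eq_besselK:
  "besselY \<nu> z = of_real s * \<i> * besselJ \<nu> z - 2 / of_real pi * (exp (- of_real s * of_real pi / 2 * \<i> * \<nu>) * besselK \<nu> \<zeta>)"
proof -
  define k where "k = (\<lambda>m. of_real pi / 2 * (besselI (-m) \<zeta> - besselI m \<zeta>) / sin (m * of_real pi))"
  have contJ: "isCont (\<lambda>m. besselJ m z) \<nu>"
    unfolding besselJ_eq_besselI
    by (intro continuous_intros field_differentiable_imp_continuous_at besselI_order_differentiable zeta_nonzero)
  have "((\<lambda>m. of_real s * \<i> * besselJ m z - 2 / of_real pi * (exp (- of_real s * of_real pi / 2 * \<i> * m) * k m)) \<longlongrightarrow>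
     of_real s * \<i> * besselJ \<nu> z - 2 / of_real pi * (exp (- of_real s * of_real pi / 2 * \<i> * \<nu>) * besselK \<nu> \<zeta>)) (at \<nu>)"
    unfolding k_def
    by (intro tendsto_intros besselK_tendsto zeta_nonzero contJ[unfolded isCont_def])
  moreover have "\<forall>\<^sub>F m in at \<nu>. of_real s * \<i> * besselJ m z - 2 / of_real pi * (exp (- of_real s * of_real pi / 2 * \<i> * m) * k m)
     = (besselJ m z * cos (m * of_real pi) - besselJ (-m) z) / sin (m * of_real pi)"
    using eventually_at_not_Ints[of \<nu>]
  proof eventually_elim
    case (elim m)
    define E where "E = exp (of_real s * of_real pi / 2 * \<i> * m)"
    have S: "sin (m * of_real pi) \<noteq> 0" using sin_pi_nonzero[OF elim] by (simp add: mult.commute)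
    have E0: "E \<noteq> 0" by (simp add: E_def)
    have E1: "exp (- of_real s * of_real pi / 2 * \<i> * m) = 1 / E"
    proof -
      have "- of_real s * of_real pi / 2 * \<i> * m = - (of_real s * of_real pi / 2 * \<i> * m)"
        by simp
      then show ?thesis by (simp only: E_def exp_minus inverse_eq_divide)
    qed
    have J1: "besselJ m z = E * besselI m \<zeta>" unfolding E_def by (rule besselJ_eq_besselI)
    have J2: "besselJ (- m) z = besselI (- m) \<zeta> / E"
      unfolding besselJ_eq_besselI[of "- m"] mult_minus_right exp_minus E_def[symmetric]
      by (simp only: divide_inverse mult.commute)
    have "E * E = exp (of_real s * (\<i> * (m * of_real pi)))"
      by (simp add: E_def mult_exp_exp field_simps)
    also have "\<dots> = cos (m * of_real pi) + of_real s * \<i> * sin (m * of_real pi)"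
      using s exp_Euler[of "m * of_real pi"] exp_Euler[of "- (m * of_real pi)"] by (auto simp: algebra_simps)
    finally have E2: "cos (m * of_real pi) = E * E - of_real s * \<i> * sin (m * of_real pi)" by simp
    \<comment> \<open>The first factor is \<open>exp (- s i m pi)\<close>, the reciprocal of
      \<open>E * E\<close>. This supplies the \<open>1 / E\<close> needed to match the Bessel
      function of order \<open>- m\<close>.\<close>
    have "(cos (m * of_real pi) - of_real s * \<i> * sin (m * of_real pi)) * (E * E) = 1"
    proof -
      have "(cos (m * of_real pi) - of_real s * \<i> * sin (m * of_real pi)) * (cos (m * of_real pi) + of_real s * \<i> * sin (m * of_real pi)) = 1"
        using s sin_cos_squared_add[of "m * of_real pi"] by (auto simp: algebra_simps power2_eq_square)
      then show ?thesis unfolding E2 by simp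
    qed
    then have "(cos (m * of_real pi) - of_real s * \<i> * sin (m * of_real pi)) * E = 1 / E"
      unfolding nonzero_eq_divide_eq[OF E0] by (simp only: mult.assoc)
    then have E3: "cos (m * of_real pi) * E = 1 / E + of_real s * \<i> * sin (m * of_real pi) * E"
      by (simp only: left_diff_distrib diff_eq_eq)
    have "besselJ m z * cos (m * of_real pi) - besselJ (-m) z
      = besselI m \<zeta> * (cos (m * of_real pi) * E) - besselI (- m) \<zeta> / E"
      unfolding J1 J2 by (simp only: mult_ac)
    also have "\<dots> = of_real s * \<i> * besselJ m z * sin (m * of_real pi) - 1 / E * (besselI (- m) \<zeta> - besselI m \<zeta>)"
      unfolding E3 J1 by (simp add: distrib_left right_diff_distrib)
    finally show ?case
      unfolding k_def E1 using S by (simp add: diff_divide_distrib)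
  qed
  ultimately have "((\<lambda>m. (besselJ m z * cos (m * of_real pi) - besselJ (-m) z) / sin (m * of_real pi)) \<longlongrightarrow>
     of_real s * \<i> * besselJ \<nu> z - 2 / of_real pi * (exp (- of_real s * of_real pi / 2 * \<i> * \<nu>) * besselK \<nu> \<zeta>)) (at \<nu>)"
    by (rule Lim_transform_eventually)
  then show ?thesis unfolding besselY_def by (intro tendsto_Lim) auto
qed

end

section \<open>The Lommel function and its remainder\<close>

lemma one_minus_in_Ints_iff: "1 - a \<in> \<int> \<longleftrightarrow> (a::complex) \<in> \<int>"
proof
  assume "1 - a \<in> \<int>"
  then have "1 - (1 - a) \<in> \<int>" by (rule Ints_diff[OF Ints_1])
  then show "a \<in> \<int>" by (simp only: diff_diff_eq2 add_diff_cancel_left')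
qed (intro Ints_diff Ints_1)

text \<open>The factorisation \<open>(m + 1)^2 - \<nu>^2 = 4 (1 - a) c\<close>, with
  \<open>a\<close> and \<open>c\<close> the two quotients in the assumptions, combines with the
  leading reciprocal Gamma values of the series. The assumptions keep both Gamma factors away from
  their poles.\<close>

lemma lommel_s_eq_series:
  assumes a: "(\<nu> - m + 1) / 2 \<notin> \<int>" and c: "(m + \<nu> + 1) / 2 \<notin> \<int>\<^sub>\<le>\<^sub>0"
  shows "lommel_s m \<nu> z = z powr (m + 1) / 4 * Gamma (1 - (\<nu> - m + 1) / 2) * Gamma ((m + \<nu> + 1) / 2)
    * lommel_series ((\<nu> - m + 1) / 2) (\<nu> + 1) (- (z / 2)\<^sup>2)"
proof -
  define a where "a = (\<nu> - m + 1) / 2"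
  define c where "c = (m + \<nu> + 1) / 2"
  have A: "1 - a \<notin> \<int>"
    using a by (simp add: one_minus_in_Ints_iff a_def)
  have A': "1 - a \<notin> \<int>\<^sub>\<le>\<^sub>0" "1 - a \<noteq> 0" using A nonpos_Ints_subset_Ints by auto
  have C: "c \<notin> \<int>\<^sub>\<le>\<^sub>0" "c \<noteq> 0" using c by (auto simp: c_def)
  have e: "(m - \<nu> + 3) / 2 = 2 - a" "(m + \<nu> + 3) / 2 = c + 1" "\<nu> + 1 - a + 1 = c + 1"
    by (simp_all add: a_def c_def field_simps)
  have r1: "rGamma (1 - a) = (1 - a) * rGamma (2 - a)" using rGamma_plus1[of "1 - a"] by simp
  have r2: "rGamma c = c * rGamma (c + 1)" using rGamma_plus1[of c] by simp
  have g1: "Gamma (1 - a) * rGamma (1 - a) = 1" "Gamma c * rGamma c = 1"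
    using A' C by (auto simp: rGamma_inverse_Gamma Gamma_eq_zero_iff)
  have n1: "rGamma (2 - a) \<noteq> 0" "rGamma (c + 1) \<noteq> 0" using g1 unfolding r1 r2 by auto
  have k: "rGamma (2 - a + of_nat k) * rGamma (\<nu> + 1 - a + 1 + of_nat k) * (- (z / 2)\<^sup>2) ^ k
    = rGamma (2 - a) * rGamma (c + 1) * ((- z\<^sup>2 / 4) ^ k / (pochhammer (2 - a) k * pochhammer (c + 1) k))" for k
  proof -
    have "pochhammer (2 - a) k \<noteq> 0" "pochhammer (c + 1) k \<noteq> 0"
      using pochhammer_rGamma[of "2 - a" k] pochhammer_rGamma[of "c + 1" k] n1 by auto
    moreover have mm: "- (z / 2)\<^sup>2 = - z\<^sup>2 / 4" by (simp add: power_divide)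
    ultimately show ?thesis
      unfolding e mm pochhammer_rGamma[of "2 - a" k] pochhammer_rGamma[of "c + 1" k] by simp
  qed
  have "summable (\<lambda>k. (- z\<^sup>2 / 4) ^ k / (pochhammer (2 - a) k * pochhammer (c + 1) k))"
    using summable_mult[OF summable_lommel[of a "\<nu> + 1" "- (z / 2)\<^sup>2"], of "1 / (rGamma (2 - a) * rGamma (c + 1))"] n1
    unfolding k by simp
  then have L: "lommel_series a (\<nu> + 1) (- (z / 2)\<^sup>2) = rGamma (2 - a) * rGamma (c + 1) * hyp1F2_one (2 - a) (c + 1) (- z\<^sup>2 / 4)"
    unfolding lommel_series_def hyp1F2_one_def k by (rule suminf_mult)
  have "(m + 1)\<^sup>2 - \<nu>\<^sup>2 = 4 * (1 - a) * c" by (simp add: a_def c_def field_simps power2_eq_square)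
  then have "lommel_s m \<nu> z = z powr (m + 1) / 4 * (1 / ((1 - a) * c)) * hyp1F2_one (2 - a) (c + 1) (- z\<^sup>2 / 4)"
    unfolding lommel_s_def e by simp
  also have "1 / ((1 - a) * c) = Gamma (1 - a) * Gamma c * (rGamma (2 - a) * rGamma (c + 1))"
  proof -
    have "Gamma (1 - a) * rGamma (2 - a) = 1 / (1 - a)" "Gamma c * rGamma (c + 1) = 1 / c"
      using g1 A' C unfolding r1 r2 by (simp_all only: nonzero_eq_divide_eq mult_ac right_minus_eq not_False_eq_True simp_thms)
    then have "Gamma (1 - a) * rGamma (2 - a) * (Gamma c * rGamma (c + 1)) = 1 / ((1 - a) * c)" by simp
    then show ?thesis by (simp only: mult_ac)
  qed
  finally show ?thesis unfolding a_def[symmetric] c_def[symmetric] L by (simp only: mult_ac)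
qed

text \<open>The \<open>k\<close>-th factor of the product equals
  \<open>- 4 (c - k) (a + k - 1)\<close>: one factor descends from \<open>c\<close>, the other
  ascends from \<open>a\<close>. This is the shape of the terms produced by iterating the exponent
  shift, where \<open>b - a = c\<close>.\<close>

lemma lommel_a_Gamma:
  fixes m \<nu> :: complex
  defines "a \<equiv> (\<nu> - m + 1) / 2" and "c \<equiv> (m + \<nu> + 1) / 2"
  assumes a: "a \<notin> \<int>\<^sub>\<le>\<^sub>0" and c: "c \<notin> \<int>\<^sub>\<le>\<^sub>0"
  shows "lommel_a n (- m) \<nu> = (- 4) ^ n * (Gamma c * rGamma (c - of_nat n) * rGamma a * Gamma (a + of_nat n))"
proof (induction n)
  case 0
  have "Gamma a * rGamma a = 1" "Gamma c * rGamma c = 1" using a c by (auto simp: rGamma_inverse_Gamma Gamma_eq_zero_iff)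
  then show ?case by (simp add: lommel_a_def mult_ac)
next
  case (Suc n)
  have "a + of_nat n \<notin> \<int>\<^sub>\<le>\<^sub>0" using a by (metis add_diff_cancel_right' nonpos_Ints_diff_Nats of_nat_in_Nats)
  then have 1: "Gamma (a + of_nat (Suc n)) = (a + of_nat n) * Gamma (a + of_nat n)"
    using Gamma_plus1[of "a + of_nat n"] by (simp add: add_ac)
  have 2: "rGamma (c - of_nat (Suc n)) = (c - of_nat (Suc n)) * rGamma (c - of_nat n)"
    using rGamma_plus1[of "c - of_nat (Suc n)"] by (simp add: algebra_simps)
  have 3: "(- m + 2 * of_nat (Suc n) - 1)\<^sup>2 - \<nu>\<^sup>2 = - 4 * (c - of_nat (Suc n)) * (a + of_nat n)"
    by (simp add: a_def c_def field_simps power2_eq_square)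
  have "lommel_a (Suc n) (- m) \<nu> = lommel_a n (- m) \<nu> * ((- m + 2 * of_nat (Suc n) - 1)\<^sup>2 - \<nu>\<^sup>2)"
    unfolding lommel_a_def by simp
  also have "\<dots> = (- 4) ^ Suc n * (Gamma c * rGamma (c - of_nat (Suc n)) * rGamma a * Gamma (a + of_nat (Suc n)))"
    unfolding Suc.IH 1 2 3 by (simp only: power_Suc mult_ac)
  finally show ?case .
qed

context upper_lower_plane
begin

text \<open>Since \<open>(m - \<nu>) / 2 = 1/2 - a\<close>, the sine and cosine of the formula
  become \<open>cos (pi a)\<close> and \<open>sin (pi a)\<close>. Once \<open>besselY\<close> is
  replaced, the \<open>besselJ\<close> terms combine into the singular part of the closed form and
  \<open>lommel_s\<close> supplies its power series.\<close>

lemma lommel_S_formula_closed: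
  assumes a: "(\<nu> - m + 1) / 2 \<notin> \<int>" and c: "(m + \<nu> + 1) / 2 \<notin> \<int>\<^sub>\<le>\<^sub>0"
  shows "lommel_S_formula m \<nu> z = 2 powr m * Gamma ((m + \<nu> + 1) / 2) * rGamma ((\<nu> - m + 1) / 2) *
     (z powr (m - 1) * 2 powr (- m) * w * Stieltjes_closed ((\<nu> - m + 1) / 2) (\<nu> + 1) w
       + exp (- of_real s * of_real pi / 2 * \<i> * \<nu>) * besselK \<nu> \<zeta>)"
proof -
  define a where "a = (\<nu> - m + 1) / 2"
  define c where "c = (m + \<nu> + 1) / 2"
  define K where "K = exp (- of_real s * of_real pi / 2 * \<i> * \<nu>) * besselK \<nu> \<zeta>"
  define J where "J = besselJ \<nu> z"
  define P where "P = phi (\<nu> + 1) ((z / 2)\<^sup>2)"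
  define l where "l = lommel_series a (\<nu> + 1) w"
  define S where "S = sin (of_real pi * a)"
  define C where "C = cos (of_real pi * a)"
  have Y: "besselY \<nu> z = of_real s * \<i> * J - 2 / of_real pi * K"
    unfolding J_def K_def by (rule besselY_eq_besselK)
  have S0: "S \<noteq> 0" using sin_pi_nonzero[OF a] by (simp add: S_def a_def)
  \<comment> \<open>This converts \<open>Gamma (1 - a)\<close>, which has poles in the limit, into
    the entire factor \<open>rGamma a\<close> of the theorem.\<close>
  have G: "rGamma a * of_real pi = Gamma (1 - a) * S"
  proof -
    have "1 - a \<notin> \<int>" using a by (simp add: one_minus_in_Ints_iff a_def)
    from reflection_rGamma[OF this] have "of_real pi / sin (of_real pi * (1 - a)) * rGamma a = Gamma (1 - a)" by simp
    moreover have "sin (of_real pi * (1 - a)) = S"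
      by (simp add: S_def right_diff_distrib sin_diff)
    ultimately show ?thesis using S0 by (simp add: field_simps)
  qed
  have e: "(m - \<nu> + 1) / 2 = 1 - a" "(m - \<nu>) * of_real pi / 2 = of_real pi / 2 - of_real pi * a"
    by (simp_all add: a_def field_simps)
  have t: "sin ((m - \<nu>) * of_real pi / 2) = C" "cos ((m - \<nu>) * of_real pi / 2) = S"
    unfolding e C_def S_def by (simp_all add: sin_diff cos_diff)
  have p2: "(2::complex) powr (m - 1) = 2 powr m / 2" by (simp add: powr_diff)
  have z1: "z powr (m + 1) = - 4 * w * z powr (m - 1)"
    using z_nonzero by (simp add: w_def powr_add powr_diff power2_eq_square)
  have "exp (of_real s * (\<i> * (of_real pi * a))) = cos (of_real pi * a) + of_real s * \<i> * sin (of_real pi * a)"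
    using s exp_Euler[of "of_real pi * a"] exp_Euler[of "- (of_real pi * a)"] by auto
  then have Em: "exp (- (of_real s * (\<i> * (of_real pi * a)))) = C - of_real s * \<i> * S"
    using s exp_Euler[of "of_real pi * a"] exp_Euler[of "- (of_real pi * a)"] by (auto simp: C_def S_def)
  \<comment> \<open>On the principal branch \<open>w powr a\<close> differs from
    \<open>(z / 2) powr (2 * a)\<close> by the phase \<open>exp (- s i pi a)\<close>, which is
    \<open>C - s i S\<close>, the coefficient that \<open>besselJ\<close> has after eliminating
    \<open>besselY\<close>.\<close>
  have J: "z powr (m - 1) * (w * w powr (a - 1)) * P = 2 powr m / 2 * (C - of_real s * \<i> * S) * J"
  proof -
    have "w * w powr (a - 1) = w powr a" using w_nonzero by (simp add: powr_diff)
    also have "z powr (m - 1) * \<dots> = exp ((m - 1) * Ln z + a * (2 * Ln z - 2 * Ln 2 - of_real s * of_real pi * \<i>))"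
      using z_nonzero w_nonzero by (simp add: powr_def Ln_w exp_add)
    also have "(m - 1) * Ln z + a * (2 * Ln z - 2 * Ln 2 - of_real s * of_real pi * \<i>)
      = (m - 1) * Ln 2 + - (of_real s * (\<i> * (of_real pi * a))) + \<nu> * (Ln z - Ln 2)"
      by (simp add: a_def field_simps)
    also have "exp \<dots> = 2 powr (m - 1) * exp (- (of_real s * (\<i> * (of_real pi * a)))) * (z / 2) powr \<nu>"
      unfolding exp_add using z_nonzero by (simp add: powr_def Ln_z_half)
    finally show ?thesis unfolding Em p2 J_def besselJ_eq_phi P_def by (simp only: mult.assoc)
  qed
  have mw: "- w = (z / 2)\<^sup>2" by (simp add: w_def)
  have "lommel_S_formula m \<nu> z = Gamma c * Gamma (1 - a) * (- (z powr (m - 1) * w * l) + 2 powr m / 2 * (C * J - S * besselY \<nu> z))"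
    unfolding lommel_S_formula_def lommel_s_eq_series[OF assms] t e(1) p2 z1
    unfolding w_def[symmetric] a_def[symmetric] c_def[symmetric] l_def[symmetric] J_def[symmetric]
    by (simp add: algebra_simps)
  also have "\<dots> = Gamma c * Gamma (1 - a) * (- (z powr (m - 1) * w * l) + 2 powr m / 2 * (C - of_real s * \<i> * S) * J
      + 2 powr m * S / of_real pi * K)"
    unfolding Y by (simp add: algebra_simps add_divide_distrib diff_divide_distrib)
  also have "\<dots> = Gamma c * Gamma (1 - a) * (z powr (m - 1) * w * (w powr (a - 1) * P - l) + 2 powr m * S / of_real pi * K)"
    unfolding J[symmetric] by (simp add: algebra_simps)
  also have "\<dots> = 2 powr m * Gamma c * (Gamma (1 - a) * S / of_real pi) *
     (z powr (m - 1) * 2 powr (- m) * w * (of_real pi / S * (w powr (a - 1) * P - l)) + K)"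
    using S0 by (simp add: powr_minus field_simps)
  also have "Gamma (1 - a) * S / of_real pi = rGamma a" unfolding G[symmetric] by simp
  also have "of_real pi / S * (w powr (a - 1) * P - l) = Stieltjes_closed a (\<nu> + 1) w"
    unfolding Stieltjes_closed_def P_def mw S_def l_def ..
  finally show ?thesis unfolding K_def a_def c_def .
qed

text \<open>Because \<open>4 ^ N * (- w) ^ N = z ^ (2 * N)\<close>, shifting the exponent
  \<open>N\<close> times leaves the prefactor of the closed form intact and only adds a finite sum,
  which is the negative of the asymptotic sum.\<close>

lemma remainder_closed:
  assumes a: "(\<nu> - m + 1) / 2 \<notin> \<int>" and c: "(m + \<nu> + 1) / 2 \<notin> \<int>\<^sub>\<le>\<^sub>0"
  shows "lommel_S_formula m \<nu> z - z powr (m - 1) * (\<Sum>n<N. (-1) ^ n * lommel_a n (-m) \<nu> / z ^ (2 * n))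
   = 2 powr m * Gamma ((m + \<nu> + 1) / 2) * rGamma ((\<nu> - m + 1) / 2) *
     (z powr (m - 2 * of_nat N - 1) * (2 powr (2 * of_nat N - m) * w * Stieltjes_closed ((\<nu> - m + 1) / 2 + of_nat N) (\<nu> + 1) w)
       + exp (- of_real s * of_real pi / 2 * \<i> * \<nu>) * besselK \<nu> \<zeta>)"
proof -
  define a where "a = (\<nu> - m + 1) / 2"
  define c where "c = (m + \<nu> + 1) / 2"
  have aZ: "a \<notin> \<int>" "a \<notin> \<int>\<^sub>\<le>\<^sub>0" using a nonpos_Ints_subset_Ints by (auto simp: a_def)
  have cZ: "c \<notin> \<int>\<^sub>\<le>\<^sub>0" using c by (simp add: c_def)
  have ca: "\<nu> + 1 - a = c" by (simp add: a_def c_def field_simps)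
  define K where "K = exp (- of_real s * of_real pi / 2 * \<i> * \<nu>) * besselK \<nu> \<zeta>"
  define T where "T = (\<Sum>j<N. Gamma (a + of_nat j) * rGamma (c - of_nat j) / (- w) ^ Suc j)"
  have mw: "- w = z\<^sup>2 / 4" by (simp add: w_def power_divide)
  have z2N: "z powr (m - 2 * of_nat N - 1) = z powr (m - 1) / z ^ (2 * N)"
  proof -
    have "z powr (m - 2 * of_nat N - 1) = z powr ((m - 1) - of_nat (2 * N))" by (simp add: algebra_simps)
    moreover have "z powr of_nat (2 * N) = z ^ (2 * N)" by (rule powr_nat') (simp add: z_nonzero)
    ultimately show ?thesis by (simp only: powr_diff)
  qed
  have t2N: "(2::complex) powr (2 * of_nat N - m) = 4 ^ N * 2 powr (- m)"
  proof -
    have "(2::complex) powr (2 * of_nat N - m) = 2 powr (of_nat (2 * N) + - m)" by simp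
    also have "\<dots> = 2 ^ (2 * N) * 2 powr (- m)" unfolding powr_add by (subst powr_nat') auto
    finally show ?thesis by (simp add: power_mult)
  qed
  have wN: "4 ^ N * (- w) ^ N = z ^ (2 * N)"
    unfolding mw by (simp add: power_mult_distrib[symmetric] power_mult)
  have cl: "Stieltjes_closed (a + of_nat N) (\<nu> + 1) w = (- w) ^ N * (Stieltjes_closed a (\<nu> + 1) w + T)"
    unfolding T_def closed_shift_exponent_iterate[OF aZ(1) w_nonzero] ca ..
  have "z powr (m - 2 * of_nat N - 1) * (2 powr (2 * of_nat N - m) * w * Stieltjes_closed (a + of_nat N) (\<nu> + 1) w)
    = z powr (m - 1) * 2 powr (- m) * w * ((4 ^ N * (- w) ^ N) / z ^ (2 * N)) * (Stieltjes_closed a (\<nu> + 1) w + T)"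
    unfolding z2N t2N cl by simp
  also have "(4 ^ N * (- w) ^ N) / z ^ (2 * N) = 1" unfolding wN using z_nonzero by simp
  finally have 1: "z powr (m - 2 * of_nat N - 1) * (2 powr (2 * of_nat N - m) * w * Stieltjes_closed (a + of_nat N) (\<nu> + 1) w)
    = z powr (m - 1) * 2 powr (- m) * w * Stieltjes_closed a (\<nu> + 1) w + z powr (m - 1) * 2 powr (- m) * w * T"
    by (simp add: algebra_simps)
  \<comment> \<open>The overall minus sign comes from
    \<open>w / (- w) ^ (n + 1) = - 1 / (- w) ^ n\<close>.\<close>
  have 2: "Gamma c * rGamma a * (w * T) = - (\<Sum>n<N. (-1) ^ n * lommel_a n (-m) \<nu> / z ^ (2 * n))"
    unfolding T_def sum_distrib_left sum_negf[symmetric]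
  proof (intro sum.cong refl)
    fix n
    have "(-1) ^ n * lommel_a n (-m) \<nu> / z ^ (2 * n) = ((-1) ^ n * (- 4) ^ n / z ^ (2 * n)) * (Gamma c * rGamma (c - of_nat n) * rGamma a * Gamma (a + of_nat n))"
      using lommel_a_Gamma[of \<nu> m n] aZ(2) cZ by (simp add: a_def c_def)
    also have "(-1) ^ n * (- 4) ^ n / z ^ (2 * n) = 1 / (- w) ^ n"
      unfolding mw by (simp add: power_mult_distrib[symmetric] power_mult power_divide)
    finally show "Gamma c * rGamma a * (w * (Gamma (a + of_nat n) * rGamma (c - of_nat n) / (- w) ^ Suc n)) = - ((-1) ^ n * lommel_a n (-m) \<nu> / z ^ (2 * n))"
      using w_nonzero by simp
  qed
  have 3: "(2::complex) powr m * 2 powr (- m) = 1" by (simp add: powr_add[symmetric])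
  have "2 powr m * Gamma c * rGamma a * (z powr (m - 1) * 2 powr (- m) * w * T)
     = (2 powr m * 2 powr (- m)) * z powr (m - 1) * (Gamma c * rGamma a * (w * T))" by (simp only: mult_ac)
  also have "\<dots> = - (z powr (m - 1) * (\<Sum>n<N. (-1) ^ n * lommel_a n (-m) \<nu> / z ^ (2 * n)))"
    unfolding 2 3 by simp
  finally have 4: "2 powr m * Gamma c * rGamma a * (z powr (m - 1) * 2 powr (- m) * w * T)
     = - (z powr (m - 1) * (\<Sum>n<N. (-1) ^ n * lommel_a n (-m) \<nu> / z ^ (2 * n)))" .
  show ?thesis
    unfolding lommel_S_formula_closed[OF assms] unfolding a_def[symmetric] c_def[symmetric] K_def[symmetric] 1
    using 4 by (simp only: distrib_left) simp
qed

text \<open>With \<open>x = t^2 / 4\<close> one has \<open>1 - (t / z)^2 = (x + w) / w\<close>, so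
  the Stieltjes kernel appears and a factor \<open>w\<close> comes out in front. The exponent
  \<open>a\<close> collects \<open>e\<close>, the power from the Bessel function and the
  Jacobian.\<close>

lemma integral_besselJ_eq_Stieltjes:
  fixes e \<nu> :: complex
  defines "a \<equiv> (e + \<nu> + 1) / 2"
  assumes a: "Re a > 0" and b: "2 * Re a < Re \<nu> + 5/2"
  shows "integral {0<..} (\<lambda>t. complex_of_real t powr e * besselJ \<nu> (of_real t) / (1 - (of_real t / z)\<^sup>2))
    = 2 powr e * w * phi_Stieltjes a (\<nu> + 1) w"
proof -
  define f where "f = (\<lambda>x. complex_of_real x powr (a - 1) * phi (\<nu> + 1) (of_real x) * inverse (of_real x + w))"
  have f: "integrable halfline f"
    unfolding f_def using a b by (intro integrable_Stieltjes w_slit) auto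
  have fc: "continuous_on {0<..} f"
    unfolding f_def using slit_shift_nonzero[OF w_slit] by (intro continuous_intros) auto
  have m: "(\<lambda>t. \<bar>t / 2\<bar> *\<^sub>R f (t\<^sup>2 / 4)) \<in> borel_measurable halfline"
    by (intro measurable_halfline_continuous continuous_intros continuous_on_compose2[OF fc]) auto
  have d: "((\<lambda>t. t\<^sup>2 / 4) has_field_derivative t / 2) (at t)" for t :: real
    by (auto intro!: derivative_eq_intros)
  have bij: "bij_betw (\<lambda>t. t\<^sup>2 / 4) {0<..} {0::real<..}"
    by (rule bij_betwI[where g = "\<lambda>x. 2 * sqrt x"]) (auto simp: real_sqrt_divide power_mult_distrib)
  note sub = halfline_substitution[OF f m d bij]
  have "integral {0<..} (\<lambda>t. complex_of_real t powr e * besselJ \<nu> (of_real t) / (1 - (of_real t / z)\<^sup>2))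
     = integral {0<..} (\<lambda>t. 2 powr e * w * (\<bar>t / 2\<bar> *\<^sub>R f (t\<^sup>2 / 4)))"
  proof (rule Henstock_Kurzweil_Integration.integral_cong)
    fix t :: real assume "t \<in> {0<..}"
    then have t: "t > 0" by simp
    have ln: "Ln (complex_of_real t / 2) = Ln (of_real t) - Ln 2"
      using Ln_divide_of_real[of 2 "of_real t"] Ln_of_real[of 2] t by simp
    have ln2: "Ln (complex_of_real (t\<^sup>2 / 4)) = 2 * (Ln (of_real t) - Ln 2)"
    proof -
      have "Ln (complex_of_real (t\<^sup>2 / 4)) = of_real (ln (t\<^sup>2 / 4))" using t by (intro Ln_of_real) auto
      also have "ln (t\<^sup>2 / 4) = 2 * (ln t - ln 2)" using t ln_realpow[of 2 2] by (simp add: ln_div ln_realpow)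
      finally show ?thesis using Ln_of_real[of t] Ln_of_real[of 2] t by simp
    qed
    have pw: "complex_of_real t powr e * (of_real t / 2) powr \<nu> = 2 powr e * (of_real (t / 2) * of_real (t\<^sup>2 / 4) powr (a - 1))"
    proof -
      have "complex_of_real t powr e * (of_real t / 2) powr \<nu> = exp (e * Ln (of_real t) + \<nu> * (Ln (of_real t) - Ln 2))"
        using t by (simp add: powr_def ln exp_add)
      also have "e * Ln (of_real t) + \<nu> * (Ln (of_real t) - Ln 2) = e * Ln 2 + Ln (of_real t / 2) + (a - 1) * (2 * (Ln (of_real t) - Ln 2))"
        unfolding ln by (simp add: a_def field_simps)
      also have "exp \<dots> = 2 powr e * (of_real (t / 2) * of_real (t\<^sup>2 / 4) powr (a - 1))"
      proof -
        have "complex_of_real (t\<^sup>2 / 4) powr (a - 1) = exp ((a - 1) * (2 * (Ln (of_real t) - Ln 2)))"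
          unfolding powr_def ln2 using t by simp
        moreover have "exp (e * Ln 2) = 2 powr e" by (simp add: powr_def)
        moreover have "exp (Ln (complex_of_real t / 2)) = of_real (t / 2)" using t by (subst exp_Ln) auto
        ultimately show ?thesis by (simp only: exp_add mult.assoc)
      qed
      finally show ?thesis .
    qed
    have k: "1 / (1 - (of_real t / z)\<^sup>2) = w * inverse (of_real (t\<^sup>2 / 4) + w)"
    proof -
      have "1 - (of_real t / z)\<^sup>2 = (of_real (t\<^sup>2 / 4) + w) / w"
        using z_nonzero by (simp add: w_def field_simps)
      then show ?thesis by (simp only: divide_divide_eq_right mult_1_left) (rule divide_inverse)
    qed
    have "complex_of_real t powr e * besselJ \<nu> (of_real t) / (1 - (of_real t / z)\<^sup>2)
       = (complex_of_real t powr e * (of_real t / 2) powr \<nu>) * phi (\<nu> + 1) ((of_real t / 2)\<^sup>2) * (1 / (1 - (of_real t / z)\<^sup>2))"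
      unfolding besselJ_eq_phi by simp
    also have "\<dots> = 2 powr e * w * (\<bar>t / 2\<bar> *\<^sub>R f (t\<^sup>2 / 4))"
      unfolding pw k f_def using t by (simp add: scaleR_conv_of_real power_divide)
    finally show "complex_of_real t powr e * besselJ \<nu> (of_real t) / (1 - (of_real t / z)\<^sup>2) = 2 powr e * w * (\<bar>t / 2\<bar> *\<^sub>R f (t\<^sup>2 / 4))" .
  qed
  also have "\<dots> = 2 powr e * w * integral {0<..} (\<lambda>t. \<bar>t / 2\<bar> *\<^sub>R f (t\<^sup>2 / 4))"
    by (rule integral_mult_right)
  also have "integral {0<..} (\<lambda>t. \<bar>t / 2\<bar> *\<^sub>R f (t\<^sup>2 / 4)) = phi_Stieltjes a (\<nu> + 1) w"
    using sub(2) integral_halfline_HK(1)[OF sub(1)] by (simp add: phi_Stieltjes_def f_def)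
  finally show ?thesis .
qed

text \<open>For \<open>m\<close> near \<open>\<mu>\<close> but different from it the shifted
  exponent is not an integer, and the closed form may be exchanged for the transform. The resulting
  expression is continuous at \<open>\<mu>\<close>, so the limit defining \<open>lommel_S\<close>
  exists and equals its value there, exceptional parameters included.\<close>

lemma lommel_S_remainder:
  assumes h1: "Re \<mu> - Re \<nu> < 2 * real N + 1" and h2: "2 * real N - 3 / 2 < Re \<mu>"
    and nopole: "(\<mu> + \<nu> + 1) / 2 \<notin> \<int>\<^sub>\<le>\<^sub>0"
  shows "lommel_S \<mu> \<nu> z - z powr (\<mu> - 1) * (\<Sum>n<N. (-1) ^ n * lommel_a n (-\<mu>) \<nu> / z ^ (2 * n))
   = 2 powr \<mu> * Gamma ((\<mu> + \<nu> + 1) / 2) * rGamma ((\<nu> - \<mu> + 1) / 2) *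
     (z powr (\<mu> - 2 * of_nat N - 1) * (2 powr (2 * of_nat N - \<mu>) * w * phi_Stieltjes ((\<nu> - \<mu> + 1) / 2 + of_nat N) (\<nu> + 1) w)
       + exp (- of_real s * of_real pi / 2 * \<i> * \<nu>) * besselK \<nu> \<zeta>)"
proof -
  define A where "A = (\<lambda>m. (\<nu> - m + 1) / 2)"
  define K where "K = exp (- of_real s * of_real pi / 2 * \<i> * \<nu>) * besselK \<nu> \<zeta>"
  \<comment> \<open>\<open>G\<close> is written with the transform rather than the closed form,
    because the transform is continuous in the exponent across the integers.\<close>
  define G where "G = (\<lambda>m. z powr (m - 1) * (\<Sum>n<N. (-1) ^ n * lommel_a n (-m) \<nu> / z ^ (2 * n))
     + 2 powr m * Gamma ((m + \<nu> + 1) / 2) * rGamma (A m) *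
     (z powr (m - 2 * of_nat N - 1) * (2 powr (2 * of_nat N - m) * w * phi_Stieltjes (A m + of_nat N) (\<nu> + 1) w) + K))"
  have Alim: "filterlim A (at (A \<mu>)) (at \<mu>)"
    unfolding filterlim_at A_def using eventually_neq_at_within[of \<mu>]
    by (auto intro!: tendsto_intros elim: eventually_mono)
  have ANlim: "filterlim (\<lambda>m. A m + of_nat N) (at (A \<mu> + of_nat N)) (at \<mu>)"
    unfolding filterlim_at A_def using eventually_neq_at_within[of \<mu>]
    by (auto intro!: tendsto_intros elim: eventually_mono)
  have ReA: "Re (A m + of_nat N) = (Re \<nu> - Re m + 1) / 2 + real N" for m by (simp add: A_def)
  have c1: "Re (A \<mu> + of_nat N) > 0" and c2: "2 * Re (A \<mu> + of_nat N) < Re (\<nu> + 1) + 3/2"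
    unfolding ReA using h1 h2 by (simp_all add: field_simps)
  have Slim: "((\<lambda>m. phi_Stieltjes (A m + of_nat N) (\<nu> + 1) w) \<longlongrightarrow> phi_Stieltjes (A \<mu> + of_nat N) (\<nu> + 1) w) (at \<mu>)"
    by (rule filterlim_compose[OF tendsto_Stieltjes_exponent[OF c1 c2 w_slit] ANlim])
  have pw: "((\<lambda>m. x powr f m) \<longlongrightarrow> x powr f \<mu>) (at \<mu>)" if "x \<noteq> 0" "(f \<longlongrightarrow> f \<mu>) (at \<mu>)" for x and f :: "complex \<Rightarrow> complex"
    using that(1) unfolding powr_def by (auto intro!: tendsto_intros that(2))
  have "(G \<longlongrightarrow> G \<mu>) (at \<mu>)"
    unfolding G_def lommel_a_def
  proof (intro tendsto_add tendsto_mult pw Slim tendsto_sum tendsto_divide tendsto_prod tendsto_diff tendsto_power tendsto_const tendsto_minus tendsto_ident_at)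
    show "((\<lambda>m. Gamma ((m + \<nu> + 1) / 2)) \<longlongrightarrow> Gamma ((\<mu> + \<nu> + 1) / 2)) (at \<mu>)"
      using nopole by (intro tendsto_Gamma tendsto_intros) auto
    have "isCont rGamma (A \<mu>)" by (intro continuous_intros)
    then show "((\<lambda>m. rGamma (A m)) \<longlongrightarrow> rGamma (A \<mu>)) (at \<mu>)"
      by (rule isCont_tendsto_compose) (use Alim in \<open>simp add: filterlim_at\<close>)
  qed (use z_nonzero in auto)
  moreover have "\<forall>\<^sub>F m in at \<mu>. G m = lommel_S_formula m \<nu> z"
  proof -
    have e1: "\<forall>\<^sub>F m in at \<mu>. A m \<notin> \<int>"
      by (rule eventually_compose_filterlim[OF eventually_at_not_Ints Alim])
    have "open (- \<int>\<^sub>\<le>\<^sub>0 :: complex set)" by (intro open_Compl closed_nonpos_Ints)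
    moreover have "((\<lambda>m. (m + \<nu> + 1) / 2) \<longlongrightarrow> (\<mu> + \<nu> + 1) / 2) (at \<mu>)" by (intro tendsto_intros) auto
    ultimately have e2: "\<forall>\<^sub>F m in at \<mu>. (m + \<nu> + 1) / 2 \<in> - \<int>\<^sub>\<le>\<^sub>0"
      using nopole by (intro topological_tendstoD) auto
    have "((\<lambda>m. Re (A m + of_nat N)) \<longlongrightarrow> Re (A \<mu> + of_nat N)) (at \<mu>)"
      using ANlim by (intro tendsto_Re) (simp add: filterlim_at)
    note e3 = order_tendstoD(1)[OF this c1] order_tendstoD(2)[OF this, of "(Re (\<nu> + 1) + 3/2) / 2"]
    have c2': "Re (A \<mu> + of_nat N) < (Re (\<nu> + 1) + 3/2) / 2" using c2 by (simp add: field_simps)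
    show ?thesis
      using e1 e2 e3(1) e3(2)[OF c2']
    proof eventually_elim
      case (elim m)
      have "A m + of_nat N \<notin> \<int>" using elim(1) by (metis Ints_diff Ints_of_nat add_diff_cancel_right')
      then have "phi_Stieltjes (A m + of_nat N) (\<nu> + 1) w = Stieltjes_closed (A m + of_nat N) (\<nu> + 1) w"
        using elim by (intro Stieltjes_eq_closed w_slit) auto
      then show ?case
        using remainder_closed[of \<nu> m N] elim(1,2) unfolding G_def A_def K_def by (simp add: algebra_simps)
    qed
  qed
  ultimately have "((\<lambda>m. lommel_S_formula m \<nu> z) \<longlongrightarrow> G \<mu>) (at \<mu>)"
    by (rule Lim_transform_eventually)
  then have "lommel_S \<mu> \<nu> z = G \<mu>" unfolding lommel_S_def by (intro tendsto_Lim) auto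
  then show ?thesis unfolding G_def A_def K_def by simp
qed

end

text \<open>The sign \<open>s\<close> encodes the upper and lower alternatives, and
  \<open>rGamma\<close> stands for the reciprocal Gamma factor, zero at the poles.
  \<open>nopole\<close> expresses that the Gamma function in the numerator is finite, since at a
  pole \<open>Gamma\<close> would take its default value 0.\<close>

theorem theorem1:
  fixes \<mu> \<nu> z :: complex and N :: nat and s :: real
  assumes sgn: "s = 1 \<or> s = -1"
    and argz: "0 < s * Arg z" "s * Arg z < pi"
    and h1: "Re \<mu> - Re \<nu> < 2 * real N + 1"
    and h2: "2 * real N - 3 / 2 < Re \<mu>"
    and nopole: "\<forall>n::nat. (\<mu> + \<nu> + 1) / 2 \<noteq> - of_nat n"
  shows "lommel_S \<mu> \<nu> z
           - z powr (\<mu> - 1) * (\<Sum>n<N. (-1) ^ n * lommel_a n (-\<mu>) \<nu> / z ^ (2 * n))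
         = 2 powr \<mu> * Gamma ((\<mu> + \<nu> + 1) / 2) * rGamma ((\<nu> - \<mu> + 1) / 2) *
           (z powr (\<mu> - 2 * of_nat N - 1) *
              integral {0<..} (\<lambda>t::real. complex_of_real t powr (2 * of_nat N - \<mu>)
                  * besselJ \<nu> (complex_of_real t) / (1 - (complex_of_real t / z)^2))
            + exp (- of_real s * of_real pi / 2 * \<i> * \<nu>)
              * besselK \<nu> (z * exp (- of_real s * of_real pi / 2 * \<i>)))"
proof -
  interpret upper_lower_plane z s
    by unfold_locales (use sgn argz in auto)
  have np: "(\<mu> + \<nu> + 1) / 2 \<notin> \<int>\<^sub>\<le>\<^sub>0"
    using nopole by (auto elim!: nonpos_Ints_cases')
  have e: "(2 * of_nat N - \<mu> + \<nu> + 1) / 2 = (\<nu> - \<mu> + 1) / 2 + of_nat N" by (simp add: field_simps)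
  have "integral {0<..} (\<lambda>t. complex_of_real t powr (2 * of_nat N - \<mu>) * besselJ \<nu> (of_real t) / (1 - (of_real t / z)\<^sup>2))
      = 2 powr (2 * of_nat N - \<mu>) * w * phi_Stieltjes ((\<nu> - \<mu> + 1) / 2 + of_nat N) (\<nu> + 1) w"
    unfolding e[symmetric] by (rule integral_besselJ_eq_Stieltjes) (use h1 h2 in auto)
  then show ?thesis
    using lommel_S_remainder[OF h1 h2 np] unfolding \<zeta>_def by simp
qed

end
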